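(* Let $m\in\frac12\mathbb{Z}_{>0}$, $s,s'\in\frac12\mathbb{Z}$. If $F\in\mathcal{F}^{[m;s,s']}$, then $$F\big|_S\in\mathcal{F}^{[m;s',s]}\quad\text{and}\quad F\big|_T\in\mathcal{F}^{[m;s,s+s'+m]}.$$ Consequently, $\mathcal{F}^{[m;s,s']}$ is $SL_2(\mathbb{Z})$-invariant provided that $m\equiv s\equiv s'\bmod\mathbb{Z}$.
   Context: **Domain and theta functions.** $X=\{(\tau,u,v,t)\in\mathbb{C}^4 : \operatorname{Im}\tau>0\}$, $q=e^{2\pi i\tau}$, $q^r=e^{2\pi i r\tau}$. $$\vartheta_{11}(\tau,z)=i\sum_{n\in\mathbb{Z}}(-1)^n q^{\frac12(n+\frac12)^2}e^{2\pi i(n+\frac12)z}.$$ **Action.** For $\begin{pmatrix}a&b\\c&d\end{pmatrix}\in SL_2(\mathbb{R})$ and a function $\varphi$ on $X$, $$\varphi\big|_{\left(\begin{smallmatrix}a&b\\c&d\end{smallmatrix}\right)}(\tau,u,v,t)=(c\tau+d)^{-1}\varphi\Big(\frac{a\tau+b}{c\tau+d},\frac{u}{c\tau+d},\frac{v}{c\tau+d},t-\frac{c(u^2-v^2)}{c\tau+d}\Big).$$ $S=\begin{pmatrix}0&-1\\1&0\end{pmatrix}$, $T=\begin{pmatrix}1&1\\0&1\end{pmatrix}$. **Differential operators.** Write $v=a\tau-b$ with $a,b\in\mathbb{R}$, so $a=\operatorname{Im}v/\operatorname{Im}\tau=\frac{v-\bar v}{\tau-\bar\tau}$. The partial derivatives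 $\partial/\partial\tau,\partial/\partial\bar\tau,\partial/\partial v,\partial/\partial\bar v$ are with respect to the coordinates $(\tau,\bar\tau,v,\bar v)$; $D_{\bar\tau}$ is the partial derivative with respect to $\bar\tau$ in the coordinates $(\tau,\bar\tau,a,b)$, i.e. $D_{\bar\tau}=\frac{\partial}{\partial\bar\tau}+a\frac{\partial}{\partial\bar v}$. Put $$D=4\frac{\partial}{\partial t}\frac{\partial}{\partial\tau}+\Big(\frac{\partial}{\partial v}\Big)^2-\Big(\frac{\partial}{\partial u}\Big)^2,\quad \bar D=4\frac{\partial}{\partial t}D_{\bar\tau}+\Big(\frac{\partial}{\partial\bar v}\Big)^2,\quad \Delta=2a\frac{\partial}{\partial t}\frac{\partial}{\partial\bar v}-\frac{\partial}{\partial v}\frac{\partial}{\partial\bar v}.$$ **The space $\mathcal{F}^{[m;s,s']}$** ($m\in\frac12\mathbb{Z}_{>0}$, $s,s'\in\frac12\mathbb{Z}$) is the vector space of functions $F(\tau,u,v,t)$ on $X$ (possibly singular along the zeros of $\vartheta_{11}(\tau,v-u)\vartheta_{11}(\tau,v+u)$, as allowed by (F2)) such that: (F1) $F(\tau,u,v,t)=e^{2\pi i m t}F(\tau,u,v,0)$; (F2) $\vartheta_{11}(\tau,v-u)\vartheta_{11}(\tau,v+u)F(\tau,u,v,t)$ is holomorphic in $u$ and real analytic in $\tau$ and $v$; and $\frac{\partial F}{\partial\bar v}$ is (extends to) a real analytic function in all variables; (F3) for all $j,k\in\mathbb{Z}$: (i) $F(\tau,u+j,v+k,t)=e^{2\pi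 i s(j+k)}F(\tau,u,v,t)$; (ii) $F(\tau,u+j\tau,v+k\tau,t)=e^{2\pi i(s'(j+k)+2m(kv-ju))}q^{m(k^2-j^2)}F(\tau,u,v,t)$; (F4) for all $k\in\mathbb{Z}$: (i) $F(\tau,u+\frac{k}{2m},v+\frac{k}{2m},t)=F(\tau,u,v,t)$; (ii) $F(\tau,u+\frac{k\tau}{2m},v+\frac{k\tau}{2m},t)=e^{2\pi i k(v-u)}F(\tau,u,v,t)$; (F5) $DF=0$, $\bar DF=0$, $\Delta F=0$. *)

theory Defs
  imports "HOL-Analysis.Analysis"
begin

section \<open>Real analytic functions of several variables\<close>

text \<open>
  Local expansion into a power series in the coordinates with respect to the standard basis.
  A multi-index is a function \<open>\<alpha>\<close> assigning an exponent to every basis vector; convergence is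
  unconditional. The definition is intended for open \<open>S\<close>.
\<close>

definition real_analytic_on ::
  "('a::euclidean_space \<Rightarrow> 'b::real_normed_vector) \<Rightarrow> 'a set \<Rightarrow> bool"
  (infixl "real'_analytic'_on" 50) where
  "f real_analytic_on S \<longleftrightarrow>
     (\<forall>a\<in>S. \<exists>r>0. \<exists>c :: ('a \<Rightarrow> nat) \<Rightarrow> 'b. \<forall>x\<in>ball a r.
        ((\<lambda>\<alpha>. (\<Prod>b\<in>Basis. ((x - a) \<bullet> b) ^ \<alpha> b) *\<^sub>R c \<alpha>) has_sum f x)
          (Basis \<rightarrow>\<^sub>E UNIV))"


section \<open>The domain and the theta function\<close>

type_synonym point = "complex \<times> complex \<times> complex \<times> complex"

definition domX :: "point set" where
  "domX = {(\<tau>, u, v, t) |\<tau> u v t. Im \<tau> > 0}"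

definition ex :: "complex \<Rightarrow> complex" where
  "ex z = exp (2 * of_real pi * \<i> * z)"

text \<open>\<open>qp \<tau> r\<close> is $q^r$ with $q = e^{2\pi i\tau}$.\<close>

definition qp :: "complex \<Rightarrow> real \<Rightarrow> complex" where
  "qp \<tau> r = ex (of_real r * \<tau>)"

definition theta11 :: "complex \<Rightarrow> complex \<Rightarrow> complex" where
  "theta11 \<tau> z = \<i> * (\<Sum>\<^sub>\<infinity>n::int. (-1) powi n * qp \<tau> (1/2 * (of_int n + 1/2)\<^sup>2)
                                        * ex ((of_int n + 1/2) * z))"

definition thetaprod :: "point \<Rightarrow> complex" where
  "thetaprod = (\<lambda>(\<tau>, u, v, t). theta11 \<tau> (v - u) * theta11 \<tau> (v + u))"

text \<open>
  The functions \<open>F\<close> below are genuinely defined only off the zeros of \<open>thetaprod\<close>, i.e. on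
  \<open>regX\<close>. Since HOL functions are total, they also have values elsewhere; these values are
  arbitrary and no condition below refers to them.
\<close>

definition regX :: "point set" where
  "regX = {p \<in> domX. thetaprod p \<noteq> 0}"


section \<open>The action of \<open>SL\<^sub>2\<close>\<close>

definition slash :: "(point \<Rightarrow> complex) \<Rightarrow> real^2^2 \<Rightarrow> point \<Rightarrow> complex" where
  "slash \<phi> \<gamma> = (\<lambda>(\<tau>, u, v, t).
     let a = of_real (\<gamma> $ 1 $ 1); b = of_real (\<gamma> $ 1 $ 2);
         c = of_real (\<gamma> $ 2 $ 1); d = of_real (\<gamma> $ 2 $ 2)
     in inverse (c * \<tau> + d) *
        \<phi> ((a * \<tau> + b) / (c * \<tau> + d), u / (c * \<tau> + d), v / (c * \<tau> + d),
           t - c * (u\<^sup>2 - v\<^sup>2) / (c * \<tau> + d)))"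

definition matS :: "real^2^2" where
  "matS = vector [vector [0, -1], vector [1, 0]]"

definition matT :: "real^2^2" where
  "matT = vector [vector [1, 1], vector [0, 1]]"

definition SL2Z :: "(real^2^2) set" where
  "SL2Z = {\<gamma>. det \<gamma> = 1 \<and> (\<forall>i j. \<gamma> $ i $ j \<in> \<int>)}"


section \<open>Differential operators\<close>

text \<open>
  Wirtinger derivatives $\partial/\partial z = \frac12(\partial_x - i\partial_y)$ and
  $\partial/\partial\bar z = \frac12(\partial_x + i\partial_y)$ for $z = x + iy$.
\<close>

definition partial_x :: "(complex \<Rightarrow> complex) \<Rightarrow> complex \<Rightarrow> complex" where
  "partial_x f z = vector_derivative (\<lambda>h::real. f (z + of_real h)) (at 0)"

definition partial_y :: "(complex \<Rightarrow> complex) \<Rightarrow> complex \<Rightarrow> complex" where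
  "partial_y f z = vector_derivative (\<lambda>h::real. f (z + \<i> * of_real h)) (at 0)"

definition wd :: "(complex \<Rightarrow> complex) \<Rightarrow> complex \<Rightarrow> complex" where
  "wd f z = (partial_x f z - \<i> * partial_y f z) / 2"

definition wd_bar :: "(complex \<Rightarrow> complex) \<Rightarrow> complex \<Rightarrow> complex" where
  "wd_bar f z = (partial_x f z + \<i> * partial_y f z) / 2"

definition d_tau :: "(point \<Rightarrow> complex) \<Rightarrow> point \<Rightarrow> complex" where
  "d_tau F = (\<lambda>(\<tau>, u, v, t). wd (\<lambda>z. F (z, u, v, t)) \<tau>)"

definition d_tau_bar :: "(point \<Rightarrow> complex) \<Rightarrow> point \<Rightarrow> complex" where
  "d_tau_bar F = (\<lambda>(\<tau>, u, v, t). wd_bar (\<lambda>z. F (z, u, v, t)) \<tau>)"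

text \<open>
  For functions holomorphic in \<open>u\<close> resp. \<open>t\<close>, as are all those considered below, the
  Wirtinger derivatives \<open>d_u\<close> and \<open>d_t\<close> are the ordinary complex derivatives.
\<close>

definition d_u :: "(point \<Rightarrow> complex) \<Rightarrow> point \<Rightarrow> complex" where
  "d_u F = (\<lambda>(\<tau>, u, v, t). wd (\<lambda>z. F (\<tau>, z, v, t)) u)"

definition d_v :: "(point \<Rightarrow> complex) \<Rightarrow> point \<Rightarrow> complex" where
  "d_v F = (\<lambda>(\<tau>, u, v, t). wd (\<lambda>z. F (\<tau>, u, z, t)) v)"

definition d_v_bar :: "(point \<Rightarrow> complex) \<Rightarrow> point \<Rightarrow> complex" where
  "d_v_bar F = (\<lambda>(\<tau>, u, v, t). wd_bar (\<lambda>z. F (\<tau>, u, z, t)) v)"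

definition d_t :: "(point \<Rightarrow> complex) \<Rightarrow> point \<Rightarrow> complex" where
  "d_t F = (\<lambda>(\<tau>, u, v, t). wd (\<lambda>z. F (\<tau>, u, v, z)) t)"

text \<open>The real coordinate $a$ in $v = a\tau - b$ with $a, b$ real.\<close>

definition coord_a :: "point \<Rightarrow> complex" where
  "coord_a = (\<lambda>(\<tau>, u, v, t). of_real (Im v / Im \<tau>))"

text \<open>
  The derivative with respect to $\bar\tau$ in the coordinates $(\tau, \bar\tau, a, b)$:
  as $\bar v = a\bar\tau - b$, the chain rule gives
  $\partial/\partial\bar\tau + a\,\partial/\partial\bar v$.
\<close>

definition D_tau_bar :: "(point \<Rightarrow> complex) \<Rightarrow> point \<Rightarrow> complex" where
  "D_tau_bar F = (\<lambda>p. d_tau_bar F p + coord_a p * d_v_bar F p)"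

definition opD :: "(point \<Rightarrow> complex) \<Rightarrow> point \<Rightarrow> complex" where
  "opD F = (\<lambda>p. 4 * d_t (d_tau F) p + d_v (d_v F) p - d_u (d_u F) p)"

definition opD_bar :: "(point \<Rightarrow> complex) \<Rightarrow> point \<Rightarrow> complex" where
  "opD_bar F = (\<lambda>p. 4 * d_t (D_tau_bar F) p + d_v_bar (d_v_bar F) p)"

definition opDelta :: "(point \<Rightarrow> complex) \<Rightarrow> point \<Rightarrow> complex" where
  "opDelta F = (\<lambda>p. 2 * coord_a p * d_t (d_v_bar F) p - d_v (d_v_bar F) p)"


section \<open>The function space\<close>

definition F1 :: "real \<Rightarrow> (point \<Rightarrow> complex) \<Rightarrow> bool" where
  "F1 m F \<longleftrightarrow> (\<forall>\<tau> u v t. (\<tau>, u, v, t) \<in> regX \<longrightarrow>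
     F (\<tau>, u, v, t) = ex (of_real m * t) * F (\<tau>, u, v, 0))"

text \<open>
  \<open>G\<close> and \<open>H\<close> are the extensions of \<open>thetaprod \<cdot> F\<close> and $\partial F/\partial\bar v$ from
  \<open>regX\<close> to all of \<open>domX\<close>. Real analyticity is joint in all variables.
\<close>

definition F2 :: "(point \<Rightarrow> complex) \<Rightarrow> bool" where
  "F2 F \<longleftrightarrow>
     (\<exists>G. (\<forall>p\<in>regX. G p = thetaprod p * F p) \<and>
          G real_analytic_on domX \<and>
          (\<forall>\<tau> v t. Im \<tau> > 0 \<longrightarrow> (\<lambda>u. G (\<tau>, u, v, t)) holomorphic_on UNIV)) \<and>
     (\<exists>H. (\<forall>p\<in>regX. H p = d_v_bar F p) \<and> H real_analytic_on domX)"

text \<open>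
  \<open>regX\<close> is stable under the translations in \<open>F3\<close>, but not under those in \<open>F4\<close>; the identities
  are required wherever both sides are defined.
\<close>

definition F3 :: "real \<Rightarrow> real \<Rightarrow> real \<Rightarrow> (point \<Rightarrow> complex) \<Rightarrow> bool" where
  "F3 m s s' F \<longleftrightarrow> (\<forall>(j::int) (k::int) \<tau> u v t.
     ((\<tau>, u, v, t) \<in> regX \<and> (\<tau>, u + of_int j, v + of_int k, t) \<in> regX \<longrightarrow>
        F (\<tau>, u + of_int j, v + of_int k, t)
          = ex (of_real s * (of_int j + of_int k)) * F (\<tau>, u, v, t)) \<and>
     ((\<tau>, u, v, t) \<in> regX \<and> (\<tau>, u + of_int j * \<tau>, v + of_int k * \<tau>, t) \<in> regX \<longrightarrow>
        F (\<tau>, u + of_int j * \<tau>, v + of_int k * \<tau>, t)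
          = ex (of_real s' * (of_int j + of_int k)
                 + 2 * of_real m * (of_int k * v - of_int j * u))
            * qp \<tau> (m * ((of_int k)\<^sup>2 - (of_int j)\<^sup>2)) * F (\<tau>, u, v, t)))"

definition F4 :: "real \<Rightarrow> (point \<Rightarrow> complex) \<Rightarrow> bool" where
  "F4 m F \<longleftrightarrow> (\<forall>(k::int) \<tau> u v t. let h = of_int k / (2 * of_real m) in
     ((\<tau>, u, v, t) \<in> regX \<and> (\<tau>, u + h, v + h, t) \<in> regX \<longrightarrow>
        F (\<tau>, u + h, v + h, t) = F (\<tau>, u, v, t)) \<and>
     ((\<tau>, u, v, t) \<in> regX \<and> (\<tau>, u + h * \<tau>, v + h * \<tau>, t) \<in> regX \<longrightarrow>
        F (\<tau>, u + h * \<tau>, v + h * \<tau>, t) = ex (of_int k * (v - u)) * F (\<tau>, u, v, t)))"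

definition F5 :: "(point \<Rightarrow> complex) \<Rightarrow> bool" where
  "F5 F \<longleftrightarrow> (\<forall>p\<in>regX. opD F p = 0 \<and> opD_bar F p = 0 \<and> opDelta F p = 0)"

definition Fspace :: "real \<Rightarrow> real \<Rightarrow> real \<Rightarrow> (point \<Rightarrow> complex) set" where
  "Fspace m s s' = {F. F1 m F \<and> F2 F \<and> F3 m s s' F \<and> F4 m F \<and> F5 F}"

end

theory Submission
  imports Defs "HOL-Complex_Analysis.Complex_Analysis"
begin

text \<open>
  For a unimodular matrix with lower row \<open>(c, d)\<close> and \<open>w = c * \<tau> + d\<close>, property (F1) makes
  \<open>\<partial>/\<partial>t\<close> act as the scalar \<open>2 * pi * \<i> * m\<close>, and the chain rule for Wirtinger derivatives shows
  that \<open>D\<close>, \<open>D_bar\<close> and \<open>\<Delta>\<close> of the transformed function are those of the original one multiplied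
  by powers of \<open>w\<close> and its conjugate; here the real coordinate \<open>a\<close> becomes \<open>a * w - c * v\<close>.

  Analyticity is transported by the transformation law of \<open>theta11\<close>. Only its shape
  \<open>theta11 (-1/\<tau>) (z/\<tau>) = c(\<tau>) * ex (z\<^sup>2/(2*\<tau>)) * theta11 \<tau> z\<close> with a nonvanishing real analytic
  \<open>c(\<tau>)\<close> matters, not the value of \<open>c(\<tau>)\<close>. It holds because a quasi-periodic entire function is
  determined by a single Fourier coefficient, and \<open>c(\<tau>)\<close> is locally a quotient of the two theta
  values at a fixed \<open>z\<close>.

  Real analyticity is handled through the Banach algebra of functions on a cube which have an
  absolutely convergent power series, where inverses, exponentials, theta series and composites are
  sums of series converging in norm.
\<close>

section \<open>Power series with absolute convergence\<close>

text \<open>Where \<open>thetaprod\<close> vanishes the functions have arbitrary values, so every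
  step must stay inside the open set \<open>regX\<close>. This is why the transformation law of
  theta is needed at all: a nonvanishing factor shows that the action preserves \<open>regX\<close>,
  and the same factor corrects the analytic extension demanded by (F2). Two obstacles remain. (F2)
  gives holomorphy in u alone, while u also enters the t-slot of the transformed point, so (F1) must
  remove t before the extension is composed with the action. The shifts in (F4) do not preserve
  \<open>regX\<close>, so that for T, where one shift is split into two, an identity is known only
  on a dense set at first. For the group, the action of a product is the composed action only on
  \<open>domX\<close>; membership is therefore shown to depend on the values on \<open>regX\<close>
  only. The exponents s and s' matter modulo 1, which makes the spaces for S and T coincide with the
  given one under the congruences.\<close>

definition mexps :: "('a::euclidean_space \<Rightarrow> nat) set" where
  "mexps = (Basis \<rightarrow>\<^sub>E UNIV)"

definition mpow :: "'a::euclidean_space \<Rightarrow> ('a \<Rightarrow> nat) \<Rightarrow> real" where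
  "mpow x \<alpha> = (\<Prod>b\<in>Basis. (x \<bullet> b) ^ \<alpha> b)"

definition mdeg :: "('a::euclidean_space \<Rightarrow> nat) \<Rightarrow> nat" where
  "mdeg \<alpha> = (\<Sum>b\<in>Basis. \<alpha> b)"

text \<open>A cube, not a ball: on it all monomials attain their maximal modulus
  \<open>r ^ mdeg \<alpha>\<close> at one common corner, so the weighted l1 norm of the coefficients
  is absolute convergence at that corner.\<close>

definition cube :: "'a::euclidean_space \<Rightarrow> real \<Rightarrow> 'a set" where
  "cube a r = {x. \<forall>b\<in>Basis. \<bar>(x - a) \<bullet> b\<bar> \<le> r}"

definition expansion ::
  "'a::euclidean_space \<Rightarrow> real \<Rightarrow> ('a \<Rightarrow> complex) \<Rightarrow> (('a \<Rightarrow> nat) \<Rightarrow> complex) \<Rightarrow> real \<Rightarrow> bool" where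
  "expansion a r f c K \<longleftrightarrow> ((\<lambda>\<alpha>. norm (c \<alpha>) * r ^ mdeg \<alpha>) has_sum K) mexps \<and>
     (\<forall>x\<in>cube a r. ((\<lambda>\<alpha>. mpow (x - a) \<alpha> *\<^sub>R c \<alpha>) has_sum f x) mexps)"

text \<open>\<open>M\<close> is only an upper bound of the norm, so that estimates for sums,
  products and composites can be chained without computing norms exactly.\<close>

definition expands :: "'a::euclidean_space \<Rightarrow> real \<Rightarrow> ('a \<Rightarrow> complex) \<Rightarrow> real \<Rightarrow> bool" where
  "expands a r f M \<longleftrightarrow> (\<exists>c K. expansion a r f c K \<and> K \<le> M)"

lemma expansionD:
  assumes "expansion a r f c K"
  shows "((\<lambda>\<alpha>. norm (c \<alpha>) * r ^ mdeg \<alpha>) has_sum K) mexps"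
    "x \<in> cube a r \<Longrightarrow> ((\<lambda>\<alpha>. mpow (x - a) \<alpha> *\<^sub>R c \<alpha>) has_sum f x) mexps"
  using assms unfolding expansion_def by blast+

lemma expandsE:
  assumes "expands a r f M"
  obtains c K where "expansion a r f c K" "K \<le> M"
  using assms unfolding expands_def by blast

lemma cube_mono: "r \<le> s \<Longrightarrow> cube a r \<subseteq> cube a s"
  by (force simp: cube_def)

lemma center_in_cube [simp]: "r \<ge> 0 \<Longrightarrow> a \<in> cube a r"
  by (simp add: cube_def)

lemma cball_subset_cube: "cball a r \<subseteq> cube a r"
proof
  fix x assume "x \<in> cball a r"
  hence "norm (x - a) \<le> r"
    by (simp add: dist_norm norm_minus_commute)
  thus "x \<in> cube a r"
    unfolding cube_def by (auto intro: order_trans[OF Basis_le_norm])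
qed

lemma cube_norm_le: "x \<in> cube a r \<Longrightarrow> norm (x - a) \<le> real DIM('a) * r" for a :: "'a::euclidean_space"
proof -
  assume x: "x \<in> cube a r"
  have "norm (x - a) \<le> (\<Sum>b\<in>Basis. \<bar>(x - a) \<bullet> b\<bar>)"
    by (rule norm_le_l1)
  also have "\<dots> \<le> (\<Sum>b\<in>(Basis::'a set). r)"
    using x by (intro sum_mono) (auto simp: cube_def)
  finally show ?thesis by simp
qed

lemma abs_mpow_le:
  assumes "\<forall>b\<in>Basis. \<bar>y \<bullet> b\<bar> \<le> r"
  shows "\<bar>mpow y \<alpha>\<bar> \<le> r ^ mdeg \<alpha>"
proof -
  have "\<bar>mpow y \<alpha>\<bar> = (\<Prod>b\<in>Basis. \<bar>y \<bullet> b\<bar> ^ \<alpha> b)"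
    by (simp add: mpow_def abs_prod power_abs)
  also have "\<dots> \<le> (\<Prod>b\<in>Basis. r ^ \<alpha> b)"
    using assms by (intro prod_mono) (auto intro: power_mono)
  also have "\<dots> = r ^ mdeg \<alpha>"
    by (simp add: mdeg_def power_sum)
  finally show ?thesis .
qed

lemma expands_bound:
  assumes "expands a r f M" "x \<in> cube a r"
  shows "norm (f x) \<le> M"
proof -
  obtain c K where e: "expansion a r f c K" "K \<le> M"
    using assms(1) by (rule expandsE)
  note c = expansionD(1)[OF e(1)] e(2) expansionD(2)[OF e(1)]
  have "norm (f x) \<le> K"
  proof (rule norm_infsum_le[OF c(3) c(1)])
    show "norm (mpow (x - a) \<alpha> *\<^sub>R c \<alpha>) \<le> norm (c \<alpha>) * r ^ mdeg \<alpha>" for \<alpha>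
      using abs_mpow_le[of "x - a" r \<alpha>] assms(2)
      by (simp add: cube_def mult.commute mult_left_mono)
  qed (use assms in auto)
  with c(2) show ?thesis by simp
qed

text \<open>The exponent map \<open>e\<close> may repeat multi-indices. Absolute convergence allows
  equal ones to be grouped, and the triangle inequality inside a group can only lower the
  norm.\<close>

lemma expandsI_collect:
  fixes a :: "'a::euclidean_space" and e :: "'i \<Rightarrow> 'a \<Rightarrow> nat" and k :: "'i \<Rightarrow> complex"
  assumes r: "r > 0" and e: "\<And>i. i \<in> I \<Longrightarrow> e i \<in> mexps"
    and N: "((\<lambda>i. norm (k i) * r ^ mdeg (e i)) has_sum K) I" "K \<le> M"
    and f: "\<And>x. x \<in> cube a r \<Longrightarrow> ((\<lambda>i. mpow (x - a) (e i) *\<^sub>R k i) has_sum f x) I"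
  shows "expands a r f M"
proof -
  define B where "B \<alpha> = {i \<in> I. e i = \<alpha>}" for \<alpha>
  have bij: "bij_betw (\<lambda>i. (e i, i)) I (Sigma mexps B)"
    by (rule bij_betwI[where g = snd]) (auto simp: B_def e)
  have re: "((\<lambda>i. g (e i) i) has_sum S) I \<longleftrightarrow> ((\<lambda>(\<alpha>, i). g \<alpha> i) has_sum S) (Sigma mexps B)"
    for g and S :: "'x::{comm_monoid_add,topological_space}"
    using has_sum_reindex_bij_betw[OF bij, of "\<lambda>(\<alpha>, i). g \<alpha> i" S] by simp
  define S where "S \<alpha> = infsum (\<lambda>i. norm (k i)) (B \<alpha>)" for \<alpha>
  define c where "c \<alpha> = infsum k (B \<alpha>)" for \<alpha>
  have abs: "(\<lambda>i. norm (k i)) summable_on B \<alpha>" for \<alpha>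
  proof -
    have "(\<lambda>i. norm (k i) * r ^ mdeg (e i)) summable_on B \<alpha>"
      using N(1) by (rule summable_on_subset_banach[OF has_sum_imp_summable]) (auto simp: B_def)
    hence "(\<lambda>i. norm (k i) * r ^ mdeg \<alpha>) summable_on B \<alpha>"
      by (rule summable_on_cong[THEN iffD1, rotated]) (auto simp: B_def)
    thus ?thesis
      using r by (subst (asm) summable_on_cmult_left') auto
  qed
  have S: "((\<lambda>i. norm (k i)) has_sum S \<alpha>) (B \<alpha>)" for \<alpha>
    unfolding S_def using abs by simp
  have c: "(k has_sum c \<alpha>) (B \<alpha>)" for \<alpha>
    unfolding c_def using abs_summable_summable[OF abs] by simp
  have "((\<lambda>(\<alpha>, i). norm (k i) * r ^ mdeg \<alpha>) has_sum K) (Sigma mexps B)"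
    using N(1) re[of "\<lambda>\<alpha> i. norm (k i) * r ^ mdeg \<alpha>"] by simp
  hence SM: "((\<lambda>\<alpha>. S \<alpha> * r ^ mdeg \<alpha>) has_sum K) mexps"
    by (rule has_sum_SigmaD) (auto intro: has_sum_cmult_left S)
  have cS: "norm (c \<alpha>) \<le> S \<alpha>" for \<alpha>
    by (rule norm_infsum_le[OF c S]) simp
  have le: "norm (c \<alpha>) * r ^ mdeg \<alpha> \<le> S \<alpha> * r ^ mdeg \<alpha>" for \<alpha>
    using cS r by (simp add: mult_right_mono)
  have sm: "(\<lambda>\<alpha>. norm (c \<alpha>) * r ^ mdeg \<alpha>) summable_on mexps"
    by (rule summable_on_comparison_test[OF has_sum_imp_summable[OF SM] le]) (use r in auto)
  have "infsum (\<lambda>\<alpha>. norm (c \<alpha>) * r ^ mdeg \<alpha>) mexps \<le> K"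
    by (rule has_sum_mono[OF has_sum_infsum[OF sm] SM le])
  moreover have "((\<lambda>\<alpha>. mpow (x - a) \<alpha> *\<^sub>R c \<alpha>) has_sum f x) mexps" if "x \<in> cube a r" for x
  proof -
    have "((\<lambda>(\<alpha>, i). mpow (x - a) \<alpha> *\<^sub>R k i) has_sum f x) (Sigma mexps B)"
      using f[OF that] re[of "\<lambda>\<alpha> i. mpow (x - a) \<alpha> *\<^sub>R k i"] by simp
    thus ?thesis
      by (rule has_sum_SigmaD) (auto intro: has_sum_scaleR c)
  qed
  ultimately show ?thesis
    unfolding expands_def expansion_def using has_sum_infsum[OF sm] N(2) by (meson order_trans)
qed

text \<open>Completeness of the algebra: the coefficients form an absolutely summable family over
  \<open>I \<times> mexps\<close>, which is regrouped by exponent. Products, inverses, exponentials,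
  composites and theta series all reduce to this.\<close>

lemma expands_has_sum:
  fixes a :: "'a::euclidean_space" and f :: "'i \<Rightarrow> 'a \<Rightarrow> complex"
  assumes r: "r > 0" and f: "\<And>i. i \<in> I \<Longrightarrow> expands a r (f i) (B i)"
    and B: "(B has_sum L) I" "L \<le> M"
    and F: "\<And>x. x \<in> cube a r \<Longrightarrow> ((\<lambda>i. f i x) has_sum F x) I"
  shows "expands a r F M"
proof -
  have "\<forall>i\<in>I. \<exists>c K. expansion a r (f i) c K \<and> K \<le> B i"
    using f unfolding expands_def by blast
  from bchoice[OF this] obtain c where "\<forall>i\<in>I. \<exists>K. expansion a r (f i) (c i) K \<and> K \<le> B i" ..
  from bchoice[OF this] obtain K where e: "\<And>i. i \<in> I \<Longrightarrow> expansion a r (f i) (c i) (K i)"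
    and K: "\<And>i. i \<in> I \<Longrightarrow> K i \<le> B i" by blast
  note c = expansionD(1)[OF e] and fx = expansionD(2)[OF e]
  have K0: "0 \<le> K i" if "i \<in> I" for i
    using c[OF that] by (rule has_sum_nonneg) (use r in auto)
  have Ks: "K summable_on I"
    by (rule summable_on_comparison_test[OF has_sum_imp_summable[OF B(1)] K K0])
  have KM: "infsum K I \<le> M"
    using has_sum_mono[OF has_sum_infsum[OF Ks] B(1) K] B(2) by simp
  let ?N = "\<lambda>(i, \<alpha>). norm (c i \<alpha>) * r ^ mdeg \<alpha>"
  have Ns: "?N summable_on (I \<times> mexps)"
    by (rule summable_on_SigmaI[where g = K]) (use c Ks r in auto)
  have "(K has_sum infsum ?N (I \<times> mexps)) I"
    by (rule has_sum_SigmaD[OF has_sum_infsum[OF Ns]]) (use c in auto)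
  hence NM: "infsum ?N (I \<times> mexps) \<le> M"
    using KM by (simp add: infsumI)
  show ?thesis
  proof (rule expandsI_collect[where e = snd and k = "\<lambda>(i, \<alpha>). c i \<alpha>", OF r _ _ NM])
    show "((\<lambda>i. norm (case i of (i, \<alpha>) \<Rightarrow> c i \<alpha>) * r ^ mdeg (snd i)) has_sum
       infsum ?N (I \<times> mexps)) (I \<times> mexps)"
      using has_sum_infsum[OF Ns] by (simp add: case_prod_unfold)
    fix x assume x: "x \<in> cube a r"
    have s: "(\<lambda>(i, \<alpha>). mpow (x - a) \<alpha> *\<^sub>R c i \<alpha>) summable_on (I \<times> mexps)"
    proof (rule abs_summable_summable, rule summable_on_comparison_test[OF Ns])
      fix p :: "'i \<times> ('a \<Rightarrow> nat)"
      show "norm (case p of (i, \<alpha>) \<Rightarrow> mpow (x - a) \<alpha> *\<^sub>R c i \<alpha>) \<le> ?N p"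
        using mult_right_mono[OF abs_mpow_le[of "x - a" r "snd p"], of "norm (c (fst p) (snd p))"] x
        by (auto simp: case_prod_unfold cube_def mult.commute)
    qed auto
    have "((\<lambda>i. f i x) has_sum infsum (\<lambda>(i, \<alpha>). mpow (x - a) \<alpha> *\<^sub>R c i \<alpha>) (I \<times> mexps)) I"
      by (rule has_sum_SigmaD[OF has_sum_infsum[OF s]]) (use fx x in auto)
    with F[OF x] have "infsum (\<lambda>(i, \<alpha>). mpow (x - a) \<alpha> *\<^sub>R c i \<alpha>) (I \<times> mexps) = F x"
      using has_sum_unique by blast
    thus "((\<lambda>i. mpow (x - a) (snd i) *\<^sub>R (case i of (i, \<alpha>) \<Rightarrow> c i \<alpha>)) has_sum F x) (I \<times> mexps)"
      using has_sum_infsum[OF s] by (simp add: case_prod_unfold)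
  qed auto
qed

section \<open>Algebraic operations on power series\<close>

lemma expands_const: "r > 0 \<Longrightarrow> expands a r (\<lambda>_. k) (norm k)"
  by (rule expandsI_collect[where I = "{()}" and e = "\<lambda>_. restrict (\<lambda>_. 0) Basis" and k = "\<lambda>_. k"])
     (auto simp: mexps_def mdeg_def mpow_def intro!: has_sum_finiteI)

lemma expands_coord:
  assumes "r > 0" "b \<in> Basis"
  shows "expands a r (\<lambda>x. of_real ((x - a) \<bullet> b)) r"
proof (rule expandsI_collect[where I = "{()}" and e = "\<lambda>_. restrict (\<lambda>b'. if b' = b then 1 else 0) Basis"
        and k = "\<lambda>_. 1" and K = r])
  let ?e = "restrict (\<lambda>b'. if b' = b then 1 else 0) (Basis :: 'a set)"
  have "(\<Sum>b'\<in>Basis. if b' = b then 1 else 0) = (1::nat)"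
    using assms by simp
  thus "((\<lambda>i. norm (1::complex) * r ^ mdeg ?e) has_sum r) {()}"
    by (intro has_sum_finiteI) (auto simp: mdeg_def)
  have "(\<Prod>b'\<in>Basis. ((x - a) \<bullet> b') ^ (if b' = b then 1 else 0)) = (\<Prod>b'\<in>Basis. if b' = b then (x - a) \<bullet> b else 1)" for x
    by (intro prod.cong) auto
  also have "\<dots> x = (x - a) \<bullet> b" for x
    using assms by simp
  finally show "((\<lambda>i. mpow (x - a) ?e *\<^sub>R 1) has_sum
          complex_of_real ((x - a) \<bullet> b)) {()}" for x
    by (intro has_sum_finiteI) (auto simp: mpow_def scaleR_conv_of_real)
qed (use assms in \<open>auto simp: mexps_def\<close>)

lemma expands_shift:
  assumes "r > 0" and f: "expands a r f M" and b: "\<beta> \<in> mexps"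
  shows "expands a r (\<lambda>x. mpow (x - a) \<beta> *\<^sub>R f x) (r ^ mdeg \<beta> * M)"
proof -
  obtain c K where e: "expansion a r f c K" "K \<le> M"
    using f by (rule expandsE)
  note c = expansionD(1)[OF e(1)] e(2) expansionD(2)[OF e(1)]
  have d: "mdeg (restrict (\<lambda>b. \<alpha> b + \<beta> b) Basis) = mdeg \<beta> + mdeg \<alpha>" for \<alpha>
    by (simp add: mdeg_def sum.distrib)
  have m: "mpow y (restrict (\<lambda>b. \<alpha> b + \<beta> b) Basis) = mpow y \<beta> * mpow y \<alpha>" for \<alpha> y
    by (simp add: mpow_def power_add prod.distrib)
  show ?thesis
  proof (rule expandsI_collect[where I = mexps and e = "\<lambda>\<alpha>. restrict (\<lambda>b. \<alpha> b + \<beta> b) Basis" and k = c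
          and K = "r ^ mdeg \<beta> * K"])
    show "((\<lambda>i. norm (c i) * r ^ mdeg (restrict (\<lambda>b. i b + \<beta> b) Basis)) has_sum r ^ mdeg \<beta> * K) mexps"
      using has_sum_cmult_right[OF c(1), of "r ^ mdeg \<beta>"] by (simp add: d power_add mult_ac)
    show "((\<lambda>i. mpow (x - a) (restrict (\<lambda>b. i b + \<beta> b) Basis) *\<^sub>R c i) has_sum mpow (x - a) \<beta> *\<^sub>R f x) mexps"
      if "x \<in> cube a r" for x
      using has_sum_scaleR[OF c(3)[OF that], of "mpow (x - a) \<beta>"] by (simp add: m)
  qed (use assms c in \<open>auto simp: mexps_def intro!: mult_left_mono\<close>)
qed

lemma expands_cmult:
  assumes "r > 0" and f: "expands a r f M"
  shows "expands a r (\<lambda>x. k * f x) (norm k * M)"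
proof -
  obtain c K where e: "expansion a r f c K" "K \<le> M"
    using f by (rule expandsE)
  note c = expansionD(1)[OF e(1)] e(2) expansionD(2)[OF e(1)]
  show ?thesis unfolding expands_def expansion_def
    using has_sum_cmult_right[OF c(1), of "norm k"] has_sum_cmult_right[OF c(3), of _ k] c(2)
    by (intro exI[of _ "\<lambda>\<alpha>. k * c \<alpha>"] exI[of _ "norm k * K"])
       (auto simp: norm_mult mult_ac intro!: mult_right_mono)
qed

lemma expands_mono:
  assumes "expands a r f M" "M \<le> M'" shows "expands a r f M'"
  using assms unfolding expands_def by (meson order_trans)

text \<open>Instead of a Cauchy product, \<open>f\<close> is summed monomial by monomial: a monomial
  times \<open>g\<close> is an exponent shift of \<open>g\<close>, and these shifts converge in
  norm.\<close>

lemma expands_mult: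
  fixes f g :: "'a::euclidean_space \<Rightarrow> complex"
  assumes "r > 0" and f: "expands a r f M" and g: "expands a r g N"
  shows "expands a r (\<lambda>x. f x * g x) (M * N)"
proof -
  obtain c K where e: "expansion a r f c K" "K \<le> M"
    using f by (rule expandsE)
  note c = expansionD(1)[OF e(1)] e(2) expansionD(2)[OF e(1)]
  have N: "0 \<le> N"
    using expands_bound[OF g center_in_cube] assms(1) norm_ge_zero order_trans by (metis less_imp_le)
  show ?thesis
  proof (rule expands_has_sum[where f = "\<lambda>\<alpha> x. c \<alpha> * (mpow (x - a) \<alpha> *\<^sub>R g x)" and
        B = "\<lambda>\<alpha>. norm (c \<alpha>) * (r ^ mdeg \<alpha> * N)" and I = mexps and L = "K * N"])
    show "expands a r (\<lambda>x. c \<alpha> * (mpow (x - a) \<alpha> *\<^sub>R g x)) (norm (c \<alpha>) * (r ^ mdeg \<alpha> * N))"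
      if "\<alpha> \<in> mexps" for \<alpha>
      by (intro expands_cmult expands_shift assms that)
    show "((\<lambda>\<alpha>. norm (c \<alpha>) * (r ^ mdeg \<alpha> * N)) has_sum K * N) mexps"
      using has_sum_cmult_left[OF c(1), of N] by (simp add: mult_ac)
    show "((\<lambda>i. c i * (mpow (x - a) i *\<^sub>R g x)) has_sum f x * g x) mexps" if "x \<in> cube a r" for x
      using has_sum_cmult_left[OF c(3)[OF that], of "g x"] by (simp add: scaleR_conv_of_real mult_ac)
  qed (use assms c N in \<open>auto intro!: mult_right_mono\<close>)
qed

lemma expands_add:
  assumes "r > 0" and "expands a r f M" and "expands a r g N"
  shows "expands a r (\<lambda>x. f x + g x) (M + N)"
  by (rule expands_has_sum[where I = UNIV and f = "\<lambda>i. if i then f else g" and B = "\<lambda>i. if i then M else N"])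
     (use assms in \<open>auto simp: UNIV_bool intro!: has_sum_finiteI\<close>)

lemma expands_power:
  assumes "r > 0" and "expands a r f M"
  shows "expands a r (\<lambda>x. f x ^ n) (M ^ n)"
  using assms expands_const[OF assms(1), of a 1] by (induction n) (auto intro!: expands_mult)

lemma expands_prod:
  assumes "r > 0" and "finite I" and "\<And>i. i \<in> I \<Longrightarrow> expands a r (f i) (M i)"
  shows "expands a r (\<lambda>x. \<Prod>i\<in>I. f i x) (\<Prod>i\<in>I. M i)"
  using assms(2,3) expands_const[OF assms(1), of a 1] by (induction) (auto intro!: expands_mult assms(1))

lemma expands_shrink:
  assumes "0 < s" "s \<le> r" and f: "expands a r f M"
  shows "expands a s f M"
proof -
  obtain c K where e: "expansion a r f c K" "K \<le> M"
    using f by (rule expandsE)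
  note c = expansionD(1)[OF e(1)] e(2) expansionD(2)[OF e(1)]
  have le: "norm (c \<alpha>) * s ^ mdeg \<alpha> \<le> norm (c \<alpha>) * r ^ mdeg \<alpha>" for \<alpha>
    using assms by (intro mult_left_mono power_mono) auto
  have s: "(\<lambda>\<alpha>. norm (c \<alpha>) * s ^ mdeg \<alpha>) summable_on mexps"
    by (rule summable_on_comparison_test[OF has_sum_imp_summable[OF c(1)] le]) (use assms in auto)
  show ?thesis unfolding expands_def expansion_def
    using has_sum_infsum[OF s] has_sum_mono[OF has_sum_infsum[OF s] c(1) le] c(2,3) cube_mono[OF assms(2), of a]
    by (intro exI[of _ c] exI) (auto intro: order_trans)
qed

lemma mpow_0: "\<alpha> \<in> mexps \<Longrightarrow> mpow 0 \<alpha> = (if \<alpha> = restrict (\<lambda>_. 0) Basis then 1 else 0)"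
proof -
  assume a: "\<alpha> \<in> mexps"
  show ?thesis
  proof (cases "\<forall>b\<in>Basis. \<alpha> b = 0")
    case True
    with a have "\<alpha> = restrict (\<lambda>_. 0) Basis"
      unfolding mexps_def by (intro PiE_ext[of \<alpha> Basis "\<lambda>_. UNIV"]) auto
    with True show ?thesis by (simp add: mpow_def)
  next
    case False
    hence "mpow 0 \<alpha> = 0" by (auto simp: mpow_def)
    moreover from False have "\<alpha> \<noteq> restrict (\<lambda>_. 0) Basis" by auto
    ultimately show ?thesis by simp
  qed
qed

lemma mdeg_eq_0: "\<alpha> \<in> mexps \<Longrightarrow> mdeg \<alpha> = 0 \<longleftrightarrow> \<alpha> = restrict (\<lambda>_. 0) Basis"
proof
  assume a: "\<alpha> \<in> mexps" and "mdeg \<alpha> = 0"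
  hence "\<forall>b\<in>Basis. \<alpha> b = 0" by (simp add: mdeg_def)
  with a show "\<alpha> = restrict (\<lambda>_. 0) Basis"
    unfolding mexps_def by (intro PiE_ext[of \<alpha> Basis "\<lambda>_. UNIV"]) auto
qed (simp add: mdeg_def)

lemma has_sum_center:
  fixes a :: "'a::euclidean_space" and c :: "('a \<Rightarrow> nat) \<Rightarrow> complex"
  assumes "((\<lambda>\<alpha>. mpow (a - a) \<alpha> *\<^sub>R c \<alpha>) has_sum s) mexps"
  shows "s = c (restrict (\<lambda>_. 0) Basis)"
proof -
  let ?z = "restrict (\<lambda>_. 0) Basis :: 'a \<Rightarrow> nat"
  have "?z \<in> mexps" by (simp add: mexps_def)
  hence "((\<lambda>\<alpha>. mpow (a - a) \<alpha> *\<^sub>R c \<alpha>) has_sum s) mexps \<longleftrightarrow> (c has_sum s) {?z}"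
    by (intro has_sum_cong_neutral) (auto simp: mpow_0)
  moreover have "(c has_sum c ?z) {?z}"
    by (intro has_sum_finiteI) auto
  ultimately show ?thesis using assms has_sum_unique by blast
qed

text \<open>Without a constant term every monomial has degree at least one and gains a factor
  \<open>s / r\<close>. This is how norms are made small, for inverses and for substitution.\<close>

lemma expands_shrink_zero:
  assumes "0 < s" "s \<le> r" and f: "expands a r f M" and "f a = 0"
  shows "expands a s f (s / r * M)"
proof -
  let ?z = "restrict (\<lambda>_. 0) Basis :: 'a \<Rightarrow> nat"
  obtain c K where e: "expansion a r f c K" "K \<le> M"
    using f by (rule expandsE)
  note c = expansionD(1)[OF e(1)] e(2) expansionD(2)[OF e(1)]
  have c0: "c ?z = 0"
    using has_sum_center[OF c(3)[OF center_in_cube]] assms by simp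
  have le: "norm (c \<alpha>) * s ^ mdeg \<alpha> \<le> s / r * (norm (c \<alpha>) * r ^ mdeg \<alpha>)" if "\<alpha> \<in> mexps" for \<alpha>
  proof (cases "mdeg \<alpha>")
    case 0
    with c0 that show ?thesis by (simp add: mdeg_eq_0)
  next
    case (Suc n)
    have "s ^ Suc n \<le> s * r ^ n"
      using assms by (auto intro: power_mono)
    also have "\<dots> = s / r * r ^ Suc n"
      using assms by simp
    finally have "norm (c \<alpha>) * s ^ Suc n \<le> norm (c \<alpha>) * (s / r * r ^ Suc n)"
      by (rule mult_left_mono) simp
    also have "\<dots> = s / r * (norm (c \<alpha>) * r ^ Suc n)"
      by (rule mult.left_commute)
    finally show ?thesis unfolding Suc .
  qed
  have h: "((\<lambda>\<alpha>. s / r * (norm (c \<alpha>) * r ^ mdeg \<alpha>)) has_sum s / r * K) mexps"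
    by (rule has_sum_cmult_right[OF c(1)])
  have s: "(\<lambda>\<alpha>. norm (c \<alpha>) * s ^ mdeg \<alpha>) summable_on mexps"
    by (rule summable_on_comparison_test[OF has_sum_imp_summable[OF h] le]) (use assms in auto)
  have "s / r * K \<le> s / r * M"
    using assms c(2) by (intro mult_left_mono) auto
  with has_sum_mono[OF has_sum_infsum[OF s] h le]
  have "infsum (\<lambda>\<alpha>. norm (c \<alpha>) * s ^ mdeg \<alpha>) mexps \<le> s / r * M" by linarith
  thus ?thesis unfolding expands_def expansion_def
    using has_sum_infsum[OF s] c(3) cube_mono[OF assms(2), of a]
    by (intro exI[of _ c] exI) auto
qed

text \<open>Each inner coordinate has norm at most \<rho>, so a substituted monomial has norm at
  most \<open>\<rho> ^ mdeg \<alpha>\<close>, and the outer series converges in the inner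
  algebra.\<close>

lemma expands_compose:
  fixes \<phi> :: "'a::euclidean_space \<Rightarrow> 'b::euclidean_space"
  assumes r: "r > 0" and G: "expands a' \<rho> G M"
    and \<phi>: "\<And>b. b \<in> Basis \<Longrightarrow> expands a r (\<lambda>x. of_real ((\<phi> x - a') \<bullet> b)) \<rho>"
  shows "expands a r (\<lambda>x. G (\<phi> x)) M"
proof -
  obtain c K where e: "expansion a' \<rho> G c K" "K \<le> M"
    using G by (rule expandsE)
  note c = expansionD(1)[OF e(1)] e(2) expansionD(2)[OF e(1)]
  have in_cube: "\<phi> x \<in> cube a' \<rho>" if "x \<in> cube a r" for x
    using expands_bound[OF \<phi> that] by (auto simp: cube_def)
  show ?thesis
  proof (rule expands_has_sum[OF r _ c(1,2)])
    fix \<alpha> :: "'b \<Rightarrow> nat"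
    have "expands a r (\<lambda>x. \<Prod>b\<in>Basis. of_real ((\<phi> x - a') \<bullet> b) ^ \<alpha> b) (\<Prod>b\<in>Basis. \<rho> ^ \<alpha> b)"
      using \<phi> r by (intro expands_prod expands_power) auto
    from expands_cmult[OF r this, of "c \<alpha>"]
    show "expands a r (\<lambda>x. mpow (\<phi> x - a') \<alpha> *\<^sub>R c \<alpha>) (norm (c \<alpha>) * \<rho> ^ mdeg \<alpha>)"
      by (simp add: mpow_def mdeg_def power_sum scaleR_conv_of_real mult_ac)
  next
    show "((\<lambda>\<alpha>. mpow (\<phi> x - a') \<alpha> *\<^sub>R c \<alpha>) has_sum G (\<phi> x)) mexps" if "x \<in> cube a r" for x
      using c(3) in_cube that by blast
  qed
qed

text \<open>Unconditional convergence of a complex series is absolute convergence; at the corner of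
  a cube inside the ball it is finiteness of the norm.\<close>

lemma real_analytic_on_iff:
  "f real_analytic_on S \<longleftrightarrow> (\<forall>a\<in>S. \<exists>r>0. \<exists>M. expands a r f M)" for f :: "'a::euclidean_space \<Rightarrow> complex"
proof -
  have 1: "(\<exists>r>0. \<exists>M. expands a r f M)"
    if r: "r > 0" and c: "\<forall>x\<in>ball a r. ((\<lambda>\<alpha>. mpow (x - a) \<alpha> *\<^sub>R c \<alpha>) has_sum f x) mexps" for a r c
  proof -
    \<comment> \<open>On the cube the euclidean distance from the centre is at most
      \<open>DIM('a) * s\<close>, which is half of \<open>r\<close>.\<close>
    define s where "s = r / (2 * DIM('a))"
    have s: "s > 0" "DIM('a) * s < r" using r by (auto simp: s_def)
    have sub: "cube a s \<subseteq> ball a r"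
    proof
      fix x assume "x \<in> cube a s"
      from cube_norm_le[OF this] s show "x \<in> ball a r"
        by (auto simp: dist_norm norm_minus_commute)
    qed
    \<comment> \<open>The corner at which the monomial of exponent \<alpha> equals
      \<open>s ^ mdeg \<alpha>\<close>.\<close>
    define p where "p = a + (\<Sum>b\<in>Basis. s *\<^sub>R b)"
    have p: "(p - a) \<bullet> b = s" if "b \<in> Basis" for b
      using that by (simp add: p_def inner_sum_left_Basis)
    have "p \<in> cube a s" using p s by (simp add: cube_def)
    with sub c have "((\<lambda>\<alpha>. mpow (p - a) \<alpha> *\<^sub>R c \<alpha>) has_sum f p) mexps" by blast
    hence "(\<lambda>\<alpha>. norm (mpow (p - a) \<alpha> *\<^sub>R c \<alpha>)) summable_on mexps"
      by (intro summable_on_iff_abs_summable_on_complex[THEN iffD1] has_sum_imp_summable)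
    moreover have "norm (mpow (p - a) \<alpha> *\<^sub>R c \<alpha>) = norm (c \<alpha>) * s ^ mdeg \<alpha>" for \<alpha>
      using s by (simp add: mpow_def p mdeg_def power_sum abs_prod)
    ultimately have "(\<lambda>\<alpha>. norm (c \<alpha>) * s ^ mdeg \<alpha>) summable_on mexps" by (simp only:)
    from has_sum_infsum[OF this]
    have "expands a s f (infsum (\<lambda>\<alpha>. norm (c \<alpha>) * s ^ mdeg \<alpha>) mexps)"
      using sub c unfolding expands_def expansion_def by blast
    with s(1) show ?thesis by blast
  qed
  have 2: "\<exists>r>0. \<exists>c. \<forall>x\<in>ball a r. ((\<lambda>\<alpha>. mpow (x - a) \<alpha> *\<^sub>R c \<alpha>) has_sum f x) mexps"
    if "r > 0" "expands a r f M" for a r M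
  proof -
    have "ball a r \<subseteq> cube a r"
      using ball_subset_cball cball_subset_cube by blast
    with that show ?thesis unfolding expands_def expansion_def by blast
  qed
  show ?thesis
    unfolding real_analytic_on_def mpow_def[symmetric] mexps_def[symmetric]
    by (intro ball_cong refl iffI; elim exE conjE; rule 1 2)
qed

lemma expands_cong:
  "expands a r f M \<Longrightarrow> (\<And>x. x \<in> cube a r \<Longrightarrow> f x = g x) \<Longrightarrow> expands a r g M"
  unfolding expands_def expansion_def by auto

lemma expands_nonneg: "r > 0 \<Longrightarrow> expands a r f M \<Longrightarrow> 0 \<le> M"
  using expands_bound[of a r f M a] by (metis center_in_cube less_imp_le norm_ge_zero order_trans)

lemma expands_small:
  assumes "r > 0" "expands a r f M" "f a = 0" "\<epsilon> > 0"
  shows "\<exists>s>0. s \<le> r \<and> expands a s f \<epsilon>"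
proof -
  \<comment> \<open>\<open>M + 1\<close> avoids a division by zero, and the minimum with 1 keeps
    \<open>s \<le> r\<close>.\<close>
  define s where "s = r * min 1 (\<epsilon> / (M + 1))"
  have M: "M \<ge> 0" using assms by (intro expands_nonneg) auto
  hence s: "s > 0" "s \<le> r" using assms by (auto simp: s_def mult_le_cancel_left1)
  have "s / r * M = min 1 (\<epsilon> / (M + 1)) * M" using assms by (simp add: s_def)
  also have "\<dots> \<le> \<epsilon> / (M + 1) * M" using M by (intro mult_right_mono) auto
  also have "\<dots> \<le> \<epsilon>" using M assms by (simp add: field_simps)
  finally show ?thesis
    using expands_mono[OF expands_shrink_zero[OF s assms(2,3)]] s by blast
qed

lemma expands_exp:
  assumes "r > 0" "expands a r f M"
  shows "expands a r (\<lambda>x. exp (f x)) (exp M)"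
proof (rule expands_has_sum[OF assms(1)])
  show "expands a r (\<lambda>x. (1 / fact n) * f x ^ n) (norm (1 / fact n :: complex) * M ^ n)" for n
    by (intro expands_cmult expands_power assms)
  have M: "M \<ge> 0" using assms by (rule expands_nonneg)
  have "((\<lambda>n. M ^ n /\<^sub>R fact n) has_sum exp M) UNIV"
    using M by (intro norm_summable_imp_has_sum summable_norm_exp exp_converges)
  thus "((\<lambda>n. norm (1 / fact n :: complex) * M ^ n) has_sum exp M) UNIV"
    by (simp add: norm_divide field_simps)
  fix x
  have "((\<lambda>n. f x ^ n /\<^sub>R fact n) has_sum exp (f x)) UNIV"
    by (intro norm_summable_imp_has_sum summable_norm_exp exp_converges)
  thus "((\<lambda>n. (1 / fact n) * f x ^ n) has_sum exp (f x)) UNIV"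
    by (simp add: scaleR_conv_of_real field_simps)
qed auto

text \<open>The function \<open>h = 1 - f / f a\<close> vanishes at \<open>a\<close>, so on a
  smaller cube it has norm at most 1/2 and the geometric series converges.\<close>

lemma expands_inverse:
  assumes "r > 0" "expands a r f M" "f a \<noteq> 0"
  shows "\<exists>s>0. \<exists>N. expands a s (\<lambda>x. inverse (f x)) N"
proof -
  define h where "h x = 1 + - (inverse (f a)) * f x" for x
  have "expands a r h (norm (1 :: complex) + norm (- inverse (f a)) * M)"
    unfolding h_def using assms by (intro expands_add expands_const expands_cmult)
  from expands_small[OF assms(1) this, of "1/2"] assms(3)
  obtain s where s: "s > 0" "expands a s h (1/2)" by (auto simp: h_def)
  have "expands a s (\<lambda>x. inverse (1 - h x)) 2"
  proof (rule expands_has_sum[OF s(1)])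
    show "expands a s (\<lambda>x. h x ^ n) ((1/2) ^ n)" for n
      by (intro expands_power s)
    show "((\<lambda>n. (1/2) ^ n) has_sum (2::real)) UNIV"
      using geometric_sums[of "1/2::real"]
      by (intro norm_summable_imp_has_sum) (auto simp: norm_power intro: summable_geometric)
    show "((\<lambda>n. h x ^ n) has_sum inverse (1 - h x)) UNIV" if "x \<in> cube a s" for x
    proof -
      have "norm (h x) < 1" using expands_bound[OF s(2) that] by simp
      thus ?thesis
        using geometric_sums[of "h x"]
        by (intro norm_summable_imp_has_sum) (auto simp: norm_power divide_inverse intro: summable_geometric)
    qed
  qed auto
  moreover have "inverse (f a) * inverse (1 - h x) = inverse (f x)" for x
    using assms(3) by (simp add: h_def)
  ultimately show ?thesis
    using expands_cmult[OF s(1), of a "\<lambda>x. inverse (1 - h x)" 2 "inverse (f a)"] s(1) by auto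
qed

lemma expands_cnj:
  assumes "expands a r f M" shows "expands a r (\<lambda>x. cnj (f x)) M"
proof -
  obtain c K where e: "expansion a r f c K" "K \<le> M"
    using assms by (rule expandsE)
  have "((\<lambda>\<alpha>. mpow (x - a) \<alpha> *\<^sub>R cnj (c \<alpha>)) has_sum cnj (f x)) mexps" if "x \<in> cube a r" for x
    using has_sum_cnj_iff[THEN iffD2, OF expansionD(2)[OF e(1) that]] by (simp add: scaleR_conv_of_real)
  with expansionD(1)[OF e(1)] have "expansion a r (\<lambda>x. cnj (f x)) (\<lambda>\<alpha>. cnj (c \<alpha>)) K"
    by (simp add: expansion_def)
  with e(2) show ?thesis unfolding expands_def by blast
qed

section \<open>Differentiation of power series\<close>

lemma has_sum_diff:
  fixes f g :: "'i \<Rightarrow> 'b::real_normed_vector"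
  assumes "(f has_sum a) A" "(g has_sum b) A"
  shows "((\<lambda>x. f x - g x) has_sum (a - b)) A"
  using has_sum_add[OF assms(1), of "\<lambda>x. - g x" "- b"] assms(2) by (simp add: has_sum_uminus)

lemma has_derivative_quadratic:
  fixes f :: "'a::real_normed_vector \<Rightarrow> 'b::real_normed_vector"
  assumes f': "bounded_linear f'" and "\<epsilon> > 0"
    and le: "\<And>h. norm h < \<epsilon> \<Longrightarrow> norm (f (x + h) - f x - f' h) \<le> C * (norm h)\<^sup>2"
  shows "(f has_derivative f') (at x)"
  unfolding has_derivative_at
proof
  have "((\<lambda>h. C * norm h) \<longlongrightarrow> 0) (at (0::'a))"
    by (rule tendsto_eq_intros refl | simp)+
  moreover have "eventually (\<lambda>h. norm (norm (f (x + h) - f x - f' h) / norm h) \<le> C * norm h) (at 0)"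
    unfolding eventually_at
  proof (intro exI conjI allI impI ballI)
    fix h :: 'a assume h: "h \<noteq> 0 \<and> dist h 0 < \<epsilon>"
    have "norm (norm (f (x + h) - f x - f' h) / norm h) \<le> C * (norm h)\<^sup>2 / norm h"
      using le[of h] h by (auto intro: divide_right_mono)
    thus "norm (norm (f (x + h) - f x - f' h) / norm h) \<le> C * norm h"
      using h by (simp add: power2_eq_square)
  qed (use assms in auto)
  ultimately show "((\<lambda>h. norm (f (x + h) - f x - f' h) / norm h) \<longlongrightarrow> 0) (at 0)"
    by (rule Lim_null_comparison[rotated])
qed (rule f')

lemma mpow_differentiable: "(\<lambda>x. mpow (x - a) \<alpha>) differentiable (at x)"
proof -
  have "(\<lambda>x. \<Prod>b\<in>B. ((x - a) \<bullet> b) ^ \<alpha> b) differentiable (at x)" if "finite B" for B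
    using that by induction (auto intro!: derivative_intros)
  thus ?thesis by (simp add: mpow_def)
qed

text \<open>The terms of degree at most one form a polynomial; all others share a factor
  \<open>(norm (x - a) / r)\<^sup>2\<close>. The centre suffices, since an analytic function has an
  expansion centred at every point.\<close>

lemma expands_differentiable_center:
  fixes f :: "'a::euclidean_space \<Rightarrow> complex"
  assumes "r > 0" "expands a r f M"
  shows "f differentiable (at a)"
proof -
  obtain c K where e: "expansion a r f c K" "K \<le> M"
    using assms(2) by (rule expandsE)
  note c = expansionD(1)[OF e(1)] e(2) expansionD(2)[OF e(1)]
  define S where "S = {\<alpha> \<in> mexps :: ('a \<Rightarrow> nat) set. mdeg \<alpha> \<le> 1}"
  have "S \<subseteq> Basis \<rightarrow>\<^sub>E {..1}"
  proof
    fix \<alpha> :: "'a \<Rightarrow> nat" assume \<alpha>: "\<alpha> \<in> S"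
    have "\<alpha> b \<le> 1" if "b \<in> Basis" for b
      using member_le_sum[of b Basis \<alpha>] that \<alpha> by (simp add: S_def mdeg_def)
    with \<alpha> show "\<alpha> \<in> Basis \<rightarrow>\<^sub>E {..1}"
      by (auto simp: S_def mexps_def PiE_def)
  qed
  hence fin: "finite S"
    by (rule finite_subset) (auto intro: finite_PiE)
  have SM: "S \<subseteq> mexps" by (auto simp: S_def)
  define P where "P x = (\<Sum>\<alpha>\<in>S. mpow (x - a) \<alpha> *\<^sub>R c \<alpha>)" for x
  have rest: "norm (f x - P x) \<le> (norm (x - a) / r)\<^sup>2 * K" if x: "norm (x - a) \<le> r" for x
  proof -
    let ?q = "(norm (x - a) / r)\<^sup>2"
    have xc: "x \<in> cube a r"
      using cball_subset_cube[of a r] x by (auto simp: dist_norm norm_minus_commute)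
    have 1: "((\<lambda>\<alpha>. mpow (x - a) \<alpha> *\<^sub>R c \<alpha>) has_sum f x - P x) (mexps - S)"
      unfolding P_def by (intro has_sum_Diff c xc has_sum_finite fin SM)
    have 2: "((\<lambda>\<alpha>. ?q * (norm (c \<alpha>) * r ^ mdeg \<alpha>)) has_sum ?q * K) mexps"
      by (rule has_sum_cmult_right[OF c(1)])
    have 3: "norm (mpow (x - a) \<alpha> *\<^sub>R c \<alpha>) \<le> ?q * (norm (c \<alpha>) * r ^ mdeg \<alpha>)"
      if "\<alpha> \<in> mexps - S" for \<alpha>
    proof -
      from that have "mdeg \<alpha> \<ge> 2" by (auto simp: S_def)
      then obtain n where n: "mdeg \<alpha> = Suc (Suc n)" by (metis Suc_le_D numeral_2_eq_2 Suc_le_mono)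
      have "\<bar>mpow (x - a) \<alpha>\<bar> \<le> norm (x - a) ^ mdeg \<alpha>"
        by (rule abs_mpow_le) (auto intro: Basis_le_norm)
      also have "\<dots> \<le> (norm (x - a))\<^sup>2 * r ^ n"
        using x by (auto simp: n power2_eq_square mult.assoc intro!: mult_left_mono power_mono)
      also have "\<dots> = ?q * r ^ mdeg \<alpha>"
        using assms by (simp add: n power2_eq_square)
      finally show ?thesis
        using mult_right_mono[of "\<bar>mpow (x - a) \<alpha>\<bar>" "?q * r ^ mdeg \<alpha>" "norm (c \<alpha>)"]
        by (simp add: mult_ac)
    qed
    have s: "(\<lambda>\<alpha>. ?q * (norm (c \<alpha>) * r ^ mdeg \<alpha>)) summable_on mexps - S"
      by (rule summable_on_subset_banach[OF has_sum_imp_summable[OF 2]]) auto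
    have "norm (f x - P x) \<le> infsum (\<lambda>\<alpha>. ?q * (norm (c \<alpha>) * r ^ mdeg \<alpha>)) (mexps - S)"
      by (rule norm_infsum_le[OF 1 has_sum_infsum[OF s] 3])
    also have "\<dots> \<le> ?q * K"
      by (rule has_sum_mono2[OF has_sum_infsum[OF s] 2]) (use assms in auto)
    finally show ?thesis .
  qed
  have "P differentiable (at a)"
    unfolding P_def using fin mpow_differentiable by (auto intro!: derivative_intros)
  moreover have "((\<lambda>x. f x - P x) has_derivative (\<lambda>_. 0)) (at a)"
  proof (rule has_derivative_quadratic[where \<epsilon> = r and C = "K / r\<^sup>2"])
    have "f a - P a = 0" using rest[of a] assms by simp
    thus "norm (f (a + h) - P (a + h) - (f a - P a) - 0) \<le> K / r\<^sup>2 * (norm h)\<^sup>2" if "norm h < r" for h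
      using rest[of "a + h"] that by (simp add: power_divide mult.commute)
  qed (use assms in auto)
  ultimately have "(\<lambda>x. (f x - P x) + P x) differentiable (at a)"
    by (intro differentiable_add) (auto simp: differentiable_def)
  thus ?thesis by simp
qed

text \<open>The left side is the tail of the binomial expansion from the second power of
  \<open>h\<close> on. Taking out \<open>(h / \<rho>)\<^sup>2\<close> and bounding everything else
  by \<rho> leaves the sum of the binomial coefficients with \<open>k \<ge> 2\<close>, which is
  \<open>2 ^ n - n - 1\<close>.\<close>

lemma power_add_linear_bound:
  fixes y h \<rho> :: real
  assumes "\<bar>y\<bar> \<le> \<rho>" "\<bar>h\<bar> \<le> \<rho>" "\<rho> > 0"
  shows "\<bar>(y + h) ^ n - y ^ n - h * (of_nat n * y ^ (n - 1))\<bar> \<le> (h / \<rho>)\<^sup>2 * (\<rho> ^ n * (2 ^ n - real n - 1))"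
proof (induction n)
  case (Suc n)
  let ?E = "(y + h) ^ n - y ^ n - h * (of_nat n * y ^ (n - 1))"
  have id: "(y + h) ^ Suc n - y ^ Suc n - h * (of_nat (Suc n) * y ^ (Suc n - 1)) =
     (y + h) * ?E + h\<^sup>2 * (real n * y ^ (n - 1))"
    by (cases n) (simp_all add: algebra_simps power2_eq_square)
  have "\<bar>(y + h) * ?E\<bar>
      \<le> (2 * \<rho>) * ((h / \<rho>)\<^sup>2 * (\<rho> ^ n * (2 ^ n - real n - 1)))"
    unfolding abs_mult using assms by (intro mult_mono Suc) auto
  moreover have "\<bar>h\<^sup>2 * (real n * y ^ (n - 1))\<bar> \<le> h\<^sup>2 * (real n * \<rho> ^ (n - 1))"
    unfolding abs_mult power_abs using assms by (auto intro!: mult_left_mono power_mono)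
  moreover have "h\<^sup>2 * (real n * \<rho> ^ (n - 1)) = (h / \<rho>)\<^sup>2 * (real n * \<rho> ^ Suc n)"
    using assms by (cases n) (auto simp: power2_eq_square)
  moreover have "(2 * \<rho>) * ((h / \<rho>)\<^sup>2 * (\<rho> ^ n * (2 ^ n - real n - 1))) + (h / \<rho>)\<^sup>2 * (real n * \<rho> ^ Suc n)
     = (h / \<rho>)\<^sup>2 * (\<rho> ^ Suc n * (2 ^ Suc n - real (Suc n) - 1))"
    by (simp add: algebra_simps)
  ultimately show ?case
    unfolding id using abs_triangle_ineq[of "(y + h) * ?E" "h\<^sup>2 * (real n * y ^ (n - 1))"]
    by linarith
qed simp

text \<open>Termwise differentiation: halving the radius pays for the factor
  \<open>\<alpha> b\<close>, which is at most \<open>2 ^ \<alpha> b\<close>. The derivative is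
  identified on the whole smaller cube and not only at the centre, so that it is itself seen to be
  analytic.\<close>

lemma expands_partial:
  fixes f :: "'a::euclidean_space \<Rightarrow> complex"
  assumes r: "r > 0" and f: "expands a r f M" and b: "b \<in> Basis"
  shows "\<exists>g. expands a (r / 2) g (2 / r * M) \<and>
    (\<forall>x\<in>cube a (r / 2). ((\<lambda>h. f (x + h *\<^sub>R b)) has_vector_derivative g x) (at 0))"
proof -
  obtain c K where e: "expansion a r f c K" "K \<le> M"
    using f by (rule expandsE)
  note c = expansionD(1)[OF e(1)] e(2) expansionD(2)[OF e(1)]
  define \<rho> where "\<rho> = r / 2"
  have \<rho>: "\<rho> > 0" using r by (simp add: \<rho>_def)
  \<comment> \<open>For \<open>\<alpha> b = 0\<close> the truncated subtraction leaves the exponent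
    at 0, which is harmless because \<open>k \<alpha>\<close> is then 0.\<close>
  define e where "e \<alpha> = restrict (\<lambda>b'. if b' = b then \<alpha> b - 1 else \<alpha> b') Basis" for \<alpha> :: "'a \<Rightarrow> nat"
  define k where "k \<alpha> = of_nat (\<alpha> b) * c \<alpha>" for \<alpha>
  define R where "R y \<alpha> = (\<Prod>b'\<in>Basis - {b}. (y \<bullet> b') ^ \<alpha> b')" for y :: 'a and \<alpha>
  define d where "d \<alpha> = (\<Sum>b'\<in>Basis - {b}. \<alpha> b')" for \<alpha> :: "'a \<Rightarrow> nat"
  have mdeg: "mdeg \<alpha> = \<alpha> b + d \<alpha>" for \<alpha>
    using b by (simp add: mdeg_def d_def sum.remove)
  have mdeg_e: "mdeg (e \<alpha>) = (\<alpha> b - 1) + d \<alpha>" for \<alpha>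
    using b by (simp add: mdeg_def d_def e_def sum.remove)
  have mpow: "mpow y \<alpha> = (y \<bullet> b) ^ \<alpha> b * R y \<alpha>" for y \<alpha>
    using b by (simp add: mpow_def R_def prod.remove)
  have mpow_e: "mpow y (e \<alpha>) = (y \<bullet> b) ^ (\<alpha> b - 1) * R y \<alpha>" for y \<alpha>
    using b by (simp add: mpow_def R_def e_def prod.remove)
  have R_shift: "R (y + h *\<^sub>R b) \<alpha> = R y \<alpha>" for y h \<alpha>
    unfolding R_def using b by (intro prod.cong) (auto simp: inner_add_left inner_Basis)
  have le: "norm (k \<alpha>) * \<rho> ^ mdeg (e \<alpha>) \<le> 2 / r * (norm (c \<alpha>) * r ^ mdeg \<alpha>)" for \<alpha>
  proof (cases "\<alpha> b")
    case (Suc n)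
    have "real (\<alpha> b) \<le> 2 ^ \<alpha> b"
      by (rule less_imp_le, rule of_nat_less_two_power)
    also have "\<dots> \<le> 2 ^ mdeg \<alpha>"
      by (rule power_increasing) (auto simp: mdeg)
    finally have "real (\<alpha> b) * \<rho> ^ mdeg (e \<alpha>) \<le> 2 ^ mdeg \<alpha> * \<rho> ^ mdeg (e \<alpha>)"
      using \<rho> by (intro mult_right_mono) auto
    also have "\<dots> = 2 / r * r ^ mdeg \<alpha>"
      using r by (simp add: mdeg[of \<alpha>] mdeg_e Suc \<rho>_def power_divide power_add)
    finally show ?thesis
      using mult_right_mono[of "real (\<alpha> b) * \<rho> ^ mdeg (e \<alpha>)" "2 / r * r ^ mdeg \<alpha>" "norm (c \<alpha>)"]
      by (simp add: k_def norm_mult mult_ac)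
  qed (use r in \<open>auto simp: k_def\<close>)
  have h: "((\<lambda>\<alpha>. 2 / r * (norm (c \<alpha>) * r ^ mdeg \<alpha>)) has_sum 2 / r * K) mexps"
    by (rule has_sum_cmult_right[OF c(1)])
  have ks: "(\<lambda>\<alpha>. norm (k \<alpha>) * \<rho> ^ mdeg (e \<alpha>)) summable_on mexps"
    by (rule summable_on_comparison_test[OF has_sum_imp_summable[OF h] le]) (use \<rho> in auto)
  have kM: "infsum (\<lambda>\<alpha>. norm (k \<alpha>) * \<rho> ^ mdeg (e \<alpha>)) mexps \<le> 2 / r * M"
    using has_sum_mono[OF has_sum_infsum[OF ks] h le] mult_left_mono[OF c(2), of "2 / r"] r by simp
  define g where "g x = infsum (\<lambda>\<alpha>. mpow (x - a) (e \<alpha>) *\<^sub>R k \<alpha>) mexps" for x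
  have g: "((\<lambda>\<alpha>. mpow (x - a) (e \<alpha>) *\<^sub>R k \<alpha>) has_sum g x) mexps" if "x \<in> cube a \<rho>" for x
    unfolding g_def
  proof (rule has_sum_infsum, rule abs_summable_summable, rule summable_on_comparison_test[OF ks])
    show "norm (mpow (x - a) (e \<alpha>) *\<^sub>R k \<alpha>) \<le> norm (k \<alpha>) * \<rho> ^ mdeg (e \<alpha>)" for \<alpha>
      using mult_right_mono[OF abs_mpow_le[of "x - a" \<rho> "e \<alpha>"], of "norm (k \<alpha>)"] that
      by (auto simp: cube_def mult.commute)
  qed auto
  have "expands a \<rho> g (2 / r * M)"
    by (rule expandsI_collect[OF \<rho> _ has_sum_infsum[OF ks] kM g]) (auto simp: e_def mexps_def)
  moreover have "((\<lambda>h. f (x + h *\<^sub>R b)) has_vector_derivative g x) (at 0)" if x: "x \<in> cube a \<rho>" for x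
    unfolding has_vector_derivative_def
  proof (rule has_derivative_quadratic[where \<epsilon> = \<rho> and C = "K / \<rho>\<^sup>2"])
    \<comment> \<open>With the coordinates of \<open>x - a\<close> and \<open>h\<close> both bounded
      by \<open>\<rho> = r / 2\<close>, the shifted point stays in the large cube, where the series
      may be subtracted term by term.\<close>
    fix h :: real assume h: "norm h < \<rho>"
    define y where "y = x - a"
    have yb: "\<bar>y \<bullet> b'\<bar> \<le> \<rho>" if "b' \<in> Basis" for b'
      using x that by (simp add: y_def cube_def)
    have xr: "x \<in> cube a r" using x cube_mono[of \<rho> r a] r by (auto simp: \<rho>_def)
    have "\<bar>(y + h *\<^sub>R b) \<bullet> b'\<bar> \<le> r" if "b' \<in> Basis" for b'
      using yb[OF that] h b that by (auto simp: inner_add_left inner_Basis \<rho>_def)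
    hence xh: "x + h *\<^sub>R b \<in> cube a r" by (auto simp: cube_def y_def algebra_simps)
    have 1: "((\<lambda>\<alpha>. mpow (x + h *\<^sub>R b - a) \<alpha> *\<^sub>R c \<alpha> - mpow (x - a) \<alpha> *\<^sub>R c \<alpha> - h *\<^sub>R (mpow (x - a) (e \<alpha>) *\<^sub>R k \<alpha>))
        has_sum f (x + h *\<^sub>R b) - f x - h *\<^sub>R g x) mexps"
      by (intro has_sum_diff has_sum_scaleR c(3) xr xh g x)
    have 2: "((\<lambda>\<alpha>. (h / \<rho>)\<^sup>2 * (norm (c \<alpha>) * r ^ mdeg \<alpha>)) has_sum (h / \<rho>)\<^sup>2 * K) mexps"
      by (rule has_sum_cmult_right[OF c(1)])
    have "norm (f (x + h *\<^sub>R b) - f x - h *\<^sub>R g x) \<le> (h / \<rho>)\<^sup>2 * K"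
    proof (rule norm_infsum_le[OF 1 2])
      fix \<alpha> :: "'a \<Rightarrow> nat"
      let ?n = "\<alpha> b"
      have "mpow (x + h *\<^sub>R b - a) \<alpha> - mpow (x - a) \<alpha> - h * (of_nat ?n * mpow (x - a) (e \<alpha>))
          = ((y \<bullet> b + h) ^ ?n - (y \<bullet> b) ^ ?n - h * (of_nat ?n * (y \<bullet> b) ^ (?n - 1))) * R y \<alpha>"
        using b R_shift[of y h \<alpha>]
        by (simp add: mpow[of _ \<alpha>] mpow_e y_def algebra_simps inner_add_left inner_diff_left)
      also have "\<bar>\<dots>\<bar> \<le> ((h / \<rho>)\<^sup>2 * (\<rho> ^ ?n * (2 ^ ?n - real ?n - 1))) * \<rho> ^ d \<alpha>"
      proof -
        have "\<bar>R y \<alpha>\<bar> \<le> \<rho> ^ d \<alpha>"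
          unfolding R_def d_def power_sum abs_prod power_abs using yb
          by (intro prod_mono) (auto intro: power_mono)
        thus ?thesis
          unfolding abs_mult using h yb[OF b] \<rho>
          by (intro mult_mono power_add_linear_bound) (auto intro: order_trans[OF _ power_add_linear_bound])
      qed
      also have "\<dots> \<le> ((h / \<rho>)\<^sup>2 * (\<rho> ^ ?n * 2 ^ ?n)) * (2 ^ d \<alpha> * \<rho> ^ d \<alpha>)"
      proof -
        have "real (Suc ?n) \<le> 2 ^ ?n"
          using less_exp[of ?n] of_nat_mono[of "Suc ?n" "2 ^ ?n", where 'a = real] by (simp add: Suc_le_eq)
        thus ?thesis using \<rho> by (intro mult_mono) auto
      qed
      also have "\<dots> = (h / \<rho>)\<^sup>2 * r ^ mdeg \<alpha>"
        by (simp add: mdeg power_add \<rho>_def power_divide)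
      finally have *: "\<bar>mpow (x + h *\<^sub>R b - a) \<alpha> - mpow (x - a) \<alpha> - h * (of_nat ?n * mpow (x - a) (e \<alpha>))\<bar>
          \<le> (h / \<rho>)\<^sup>2 * r ^ mdeg \<alpha>" .
      have eq: "mpow (x + h *\<^sub>R b - a) \<alpha> *\<^sub>R c \<alpha> - mpow (x - a) \<alpha> *\<^sub>R c \<alpha> - h *\<^sub>R (mpow (x - a) (e \<alpha>) *\<^sub>R k \<alpha>)
        = (mpow (x + h *\<^sub>R b - a) \<alpha> - mpow (x - a) \<alpha> - h * (of_nat ?n * mpow (x - a) (e \<alpha>))) *\<^sub>R c \<alpha>"
        by (simp add: k_def scaleR_conv_of_real algebra_simps)
      show "norm (mpow (x + h *\<^sub>R b - a) \<alpha> *\<^sub>R c \<alpha> - mpow (x - a) \<alpha> *\<^sub>R c \<alpha> - h *\<^sub>R (mpow (x - a) (e \<alpha>) *\<^sub>R k \<alpha>))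
         \<le> (h / \<rho>)\<^sup>2 * (norm (c \<alpha>) * r ^ mdeg \<alpha>)"
        unfolding eq norm_scaleR using mult_right_mono[OF *, of "norm (c \<alpha>)"] by (simp add: mult_ac)
    qed
    thus "norm (f (x + (0 + h) *\<^sub>R b) - f (x + 0 *\<^sub>R b) - h *\<^sub>R g x) \<le> K / \<rho>\<^sup>2 * (norm h)\<^sup>2"
      by (simp add: power_divide mult.commute)
  qed (use \<rho> in \<open>auto intro: bounded_linear_scaleR_left\<close>)
  ultimately show ?thesis by (auto simp: \<rho>_def)
qed

section \<open>Real analytic functions\<close>

named_theorems real_analytic_intros

lemma real_analytic_on_const [real_analytic_intros]: "(\<lambda>_. k :: complex) real_analytic_on S"
  unfolding real_analytic_on_iff using expands_const zero_less_one by blast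

lemma real_analytic_on_subset: "f real_analytic_on T \<Longrightarrow> S \<subseteq> T \<Longrightarrow> f real_analytic_on S"
  unfolding real_analytic_on_def by blast

lemma expands_common:
  assumes "\<exists>r>0. \<exists>M. expands a r f M" "\<exists>r>0. \<exists>M. expands a r g M"
  shows "\<exists>r>0. \<exists>M N. expands a r f M \<and> expands a r g N"
proof -
  from assms obtain r1 r2 M N where r: "r1 > 0" "expands a r1 f M" "r2 > 0" "expands a r2 g N" by blast
  have "expands a (min r1 r2) f M" "expands a (min r1 r2) g N"
    using r expands_shrink[of "min r1 r2" r1 a f M] expands_shrink[of "min r1 r2" r2 a g N] by auto
  moreover have "min r1 r2 > 0" using r by simp
  ultimately show ?thesis by blast
qed

lemma real_analytic_on_add [real_analytic_intros]:
  fixes f g :: "'a::euclidean_space \<Rightarrow> complex"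
  assumes "f real_analytic_on S" "g real_analytic_on S"
  shows "(\<lambda>x. f x + g x) real_analytic_on S"
  unfolding real_analytic_on_iff
proof
  fix a assume "a \<in> S"
  with assms obtain r M N where "r > 0" "expands a r f M" "expands a r g N"
    using expands_common[of a f g] unfolding real_analytic_on_iff by blast
  thus "\<exists>r>0. \<exists>M. expands a r (\<lambda>x. f x + g x) M" using expands_add by blast
qed

lemma real_analytic_on_mult [real_analytic_intros]:
  fixes f g :: "'a::euclidean_space \<Rightarrow> complex"
  assumes "f real_analytic_on S" "g real_analytic_on S"
  shows "(\<lambda>x. f x * g x) real_analytic_on S"
  unfolding real_analytic_on_iff
proof
  fix a assume "a \<in> S"
  with assms obtain r M N where "r > 0" "expands a r f M" "expands a r g N"
    using expands_common[of a f g] unfolding real_analytic_on_iff by blast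
  thus "\<exists>r>0. \<exists>M. expands a r (\<lambda>x. f x * g x) M" using expands_mult by blast
qed

lemma real_analytic_on_inverse [real_analytic_intros]:
  fixes f :: "'a::euclidean_space \<Rightarrow> complex"
  assumes "f real_analytic_on S" "\<And>x. x \<in> S \<Longrightarrow> f x \<noteq> 0"
  shows "(\<lambda>x. inverse (f x)) real_analytic_on S"
  unfolding real_analytic_on_iff
proof
  fix a assume a: "a \<in> S"
  with assms obtain r M where "r > 0" "expands a r f M"
    unfolding real_analytic_on_iff by blast
  with expands_inverse[OF this assms(2)[OF a]]
  show "\<exists>r>0. \<exists>M. expands a r (\<lambda>x. inverse (f x)) M" by blast
qed

lemma real_analytic_on_exp [real_analytic_intros]:
  fixes f :: "'a::euclidean_space \<Rightarrow> complex"
  assumes "f real_analytic_on S"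
  shows "(\<lambda>x. exp (f x)) real_analytic_on S"
  using assms unfolding real_analytic_on_iff by (blast intro: expands_exp)

lemma real_analytic_on_cnj [real_analytic_intros]:
  fixes f :: "'a::euclidean_space \<Rightarrow> complex"
  assumes "f real_analytic_on S"
  shows "(\<lambda>x. cnj (f x)) real_analytic_on S"
  using assms unfolding real_analytic_on_iff by (blast intro: expands_cnj)

lemma real_analytic_on_uminus [real_analytic_intros]:
  fixes f :: "'a::euclidean_space \<Rightarrow> complex"
  assumes "f real_analytic_on S"
  shows "(\<lambda>x. - f x) real_analytic_on S"
  using real_analytic_on_mult[OF real_analytic_on_const[of "-1"] assms] by simp

lemma real_analytic_on_diff [real_analytic_intros]:
  fixes f g :: "'a::euclidean_space \<Rightarrow> complex"
  assumes "f real_analytic_on S" "g real_analytic_on S"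
  shows "(\<lambda>x. f x - g x) real_analytic_on S"
  using real_analytic_on_add[OF assms(1) real_analytic_on_uminus[OF assms(2)]] by simp

lemma real_analytic_on_divide [real_analytic_intros]:
  fixes f g :: "'a::euclidean_space \<Rightarrow> complex"
  assumes "f real_analytic_on S" "g real_analytic_on S" "\<And>x. x \<in> S \<Longrightarrow> g x \<noteq> 0"
  shows "(\<lambda>x. f x / g x) real_analytic_on S"
  unfolding divide_inverse by (intro real_analytic_intros assms)

lemma real_analytic_on_power [real_analytic_intros]:
  fixes f :: "'a::euclidean_space \<Rightarrow> complex"
  assumes "f real_analytic_on S"
  shows "(\<lambda>x. f x ^ n) real_analytic_on S"
  by (induction n) (auto intro!: real_analytic_intros assms)

lemma real_analytic_on_sum [real_analytic_intros]:
  fixes f :: "'i \<Rightarrow> 'a::euclidean_space \<Rightarrow> complex"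
  assumes "\<And>i. i \<in> I \<Longrightarrow> f i real_analytic_on S"
  shows "(\<lambda>x. \<Sum>i\<in>I. f i x) real_analytic_on S"
  using assms by (induction I rule: infinite_finite_induct) (auto intro!: real_analytic_intros)

lemma real_analytic_on_coord:
  assumes "b \<in> Basis"
  shows "(\<lambda>x. complex_of_real (x \<bullet> b)) real_analytic_on S"
proof -
  have "\<exists>M. expands a 1 (\<lambda>x. of_real ((x - a) \<bullet> b) + of_real (a \<bullet> b)) M" for a
    using expands_add[OF _ expands_coord expands_const, of 1 b] assms by fastforce
  hence "\<exists>M. expands a 1 (\<lambda>x. complex_of_real (x \<bullet> b)) M" for a
    by (simp add: inner_diff_left)
  thus ?thesis unfolding real_analytic_on_iff using zero_less_one by blast
qed

lemma real_analytic_on_linear: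
  fixes L :: "'a::euclidean_space \<Rightarrow> complex"
  assumes "linear L"
  shows "L real_analytic_on S"
proof -
  let ?S = "\<lambda>x. \<Sum>b\<in>Basis. complex_of_real (x \<bullet> b) * L b"
  have "L = ?S"
  proof
    fix x
    have "L x = L (\<Sum>b\<in>Basis. (x \<bullet> b) *\<^sub>R b)" by (simp add: euclidean_representation)
    also have "\<dots> = ?S x"
      using assms by (simp add: linear_sum linear_cmul scaleR_conv_of_real)
    finally show "L x = ?S x" .
  qed
  moreover have "?S real_analytic_on S"
    by (intro real_analytic_intros real_analytic_on_coord)
  ultimately show ?thesis by simp
qed

text \<open>The increments of the inner coordinates vanish at \<open>a\<close>, so a small cube
  brings their norms below the outer radius \<rho>; finiteness of the basis gives a common
  cube.\<close>

lemma real_analytic_on_compose: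
  fixes \<phi> :: "'a::euclidean_space \<Rightarrow> 'b::euclidean_space" and f :: "'b \<Rightarrow> complex"
  assumes f: "f real_analytic_on T" and ST: "\<And>x. x \<in> S \<Longrightarrow> \<phi> x \<in> T"
    and \<phi>: "\<And>b. b \<in> Basis \<Longrightarrow> (\<lambda>x. complex_of_real (\<phi> x \<bullet> b)) real_analytic_on S"
  shows "(\<lambda>x. f (\<phi> x)) real_analytic_on S"
  unfolding real_analytic_on_iff
proof
  fix a assume a: "a \<in> S"
  with f ST obtain \<rho> M where \<rho>: "\<rho> > 0" "expands (\<phi> a) \<rho> f M"
    unfolding real_analytic_on_iff by blast
  have "\<exists>s>0. expands a s (\<lambda>x. complex_of_real ((\<phi> x - \<phi> a) \<bullet> b)) \<rho>" if b: "b \<in> Basis" for b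
  proof -
    have "(\<lambda>x. complex_of_real (\<phi> x \<bullet> b) - complex_of_real (\<phi> a \<bullet> b)) real_analytic_on S"
      by (intro real_analytic_intros \<phi> b)
    with a obtain r N where "r > 0" "expands a r (\<lambda>x. complex_of_real ((\<phi> x - \<phi> a) \<bullet> b)) N"
      unfolding real_analytic_on_iff by (auto simp: inner_diff_left)
    with expands_small[OF this _ \<rho>(1)] show ?thesis by auto
  qed
  then obtain s where s: "\<And>b. b \<in> Basis \<Longrightarrow> s b > 0"
    "\<And>b. b \<in> Basis \<Longrightarrow> expands a (s b) (\<lambda>x. complex_of_real ((\<phi> x - \<phi> a) \<bullet> b)) \<rho>" by metis
  define r where "r = Min (s ` Basis)"
  have r: "r > 0" "\<And>b. b \<in> Basis \<Longrightarrow> r \<le> s b"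
    using s(1) by (auto simp: r_def)
  have "expands a r (\<lambda>x. f (\<phi> x)) M"
    by (rule expands_compose[OF r(1) \<rho>(2) expands_shrink[OF r s(2)]])
  with r(1) show "\<exists>r>0. \<exists>M. expands a r (\<lambda>x. f (\<phi> x)) M" by blast
qed

lemma real_analytic_on_Re [real_analytic_intros]:
  fixes f :: "'a::euclidean_space \<Rightarrow> complex"
  assumes "f real_analytic_on S"
  shows "(\<lambda>x. complex_of_real (Re (f x))) real_analytic_on S"
proof -
  have "(\<lambda>x. (f x + cnj (f x)) / 2) real_analytic_on S"
    by (intro real_analytic_intros assms) auto
  thus ?thesis by (simp add: complex_add_cnj)
qed

lemma real_analytic_on_Im [real_analytic_intros]:
  fixes f :: "'a::euclidean_space \<Rightarrow> complex"
  assumes "f real_analytic_on S"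
  shows "(\<lambda>x. complex_of_real (Im (f x))) real_analytic_on S"
proof -
  have "(\<lambda>x. complex_of_real (Re (- \<i> * f x))) real_analytic_on S"
    by (intro real_analytic_intros assms)
  thus ?thesis by simp
qed

lemma real_analytic_on_inner [real_analytic_intros]:
  fixes f :: "'a::euclidean_space \<Rightarrow> complex"
  assumes "f real_analytic_on S"
  shows "(\<lambda>x. complex_of_real (f x \<bullet> w)) real_analytic_on S"
  unfolding inner_complex_def of_real_add of_real_mult by (intro real_analytic_intros assms)

lemma real_analytic_on_compose_point:
  fixes f :: "complex \<times> complex \<times> complex \<times> complex \<Rightarrow> complex"
  assumes "f real_analytic_on T" "\<And>x. x \<in> S \<Longrightarrow> (f1 x, f2 x, f3 x, f4 x) \<in> T"
    "f1 real_analytic_on S" "f2 real_analytic_on S" "f3 real_analytic_on S" "f4 real_analytic_on S"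
  shows "(\<lambda>x. f (f1 x, f2 x, f3 x, f4 x)) real_analytic_on S"
  by (rule real_analytic_on_compose[OF assms(1)])
     (auto simp: assms(2) inner_prod_def intro!: real_analytic_intros assms)

lemma real_analytic_on_compose_pair:
  fixes f :: "complex \<times> complex \<Rightarrow> complex"
  assumes "f real_analytic_on T" "\<And>x. x \<in> S \<Longrightarrow> (f1 x, f2 x) \<in> T"
    "f1 real_analytic_on S" "f2 real_analytic_on S"
  shows "(\<lambda>x. f (f1 x, f2 x)) real_analytic_on S"
  by (rule real_analytic_on_compose[OF assms(1)])
     (auto simp: assms(2) inner_prod_def intro!: real_analytic_intros assms)

text \<open>Openness matters, as an expansion at a point of \<open>S\<close> involves the values on
  a full neighbourhood.\<close>

lemma real_analytic_on_cong:
  fixes f g :: "'a::euclidean_space \<Rightarrow> complex"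
  assumes "open S" "\<And>x. x \<in> S \<Longrightarrow> f x = g x" "f real_analytic_on S"
  shows "g real_analytic_on S"
  unfolding real_analytic_on_iff
proof
  fix a assume a: "a \<in> S"
  with assms obtain r M where r: "r > 0" "expands a r f M"
    unfolding real_analytic_on_iff by blast
  from assms(1) a obtain e where e: "e > 0" "ball a e \<subseteq> S" by (meson open_contains_ball)
  define s where "s = min r (e / (2 * DIM('a)))"
  have s: "s > 0" "s \<le> r" using r e by (auto simp: s_def)
  have "real DIM('a) * s \<le> real DIM('a) * (e / (2 * DIM('a)))"
    by (intro mult_left_mono) (auto simp: s_def)
  also have "\<dots> < e" using e by simp
  finally have "cube a s \<subseteq> ball a e"
    using le_less_trans[OF cube_norm_le] by (force simp: dist_norm norm_minus_commute)
  with e assms(2) have "expands a s g M"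
    by (intro expands_cong[OF expands_shrink[OF s r(2)]]) auto
  with s(1) show "\<exists>r>0. \<exists>M. expands a r g M" by blast
qed

lemma real_analytic_on_local:
  fixes f :: "'a::euclidean_space \<Rightarrow> complex"
  assumes "\<And>a. a \<in> S \<Longrightarrow> \<exists>U. a \<in> U \<and> f real_analytic_on U"
  shows "f real_analytic_on S"
  using assms unfolding real_analytic_on_def by blast

lemma real_analytic_on_imp_differentiable:
  fixes f :: "'a::euclidean_space \<Rightarrow> complex"
  assumes "f real_analytic_on S" "x \<in> S"
  shows "f differentiable (at x)"
  using assms expands_differentiable_center unfolding real_analytic_on_iff by blast

lemma real_analytic_on_imp_continuous_on:
  fixes f :: "'a::euclidean_space \<Rightarrow> complex"
  shows "f real_analytic_on S \<Longrightarrow> continuous_on S f"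
  by (meson continuous_at_imp_continuous_on differentiable_imp_continuous_within
      real_analytic_on_imp_differentiable)

lemma real_analytic_on_partial:
  fixes f :: "'a::euclidean_space \<Rightarrow> complex"
  assumes "f real_analytic_on S" "b \<in> Basis"
  shows "(\<lambda>x. vector_derivative (\<lambda>h. f (x + h *\<^sub>R b)) (at 0)) real_analytic_on S"
  unfolding real_analytic_on_iff
proof
  fix a assume a: "a \<in> S"
  with assms obtain r M where r: "r > 0" "expands a r f M"
    unfolding real_analytic_on_iff by blast
  from expands_partial[OF this assms(2)] obtain g where
    g: "expands a (r / 2) g (2 / r * M)"
    "\<And>x. x \<in> cube a (r / 2) \<Longrightarrow> ((\<lambda>h. f (x + h *\<^sub>R b)) has_vector_derivative g x) (at 0)" by blast
  from expands_cong[OF g(1) vector_derivative_at[OF g(2), symmetric]] r(1)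
  show "\<exists>r>0. \<exists>M. expands a r (\<lambda>x. vector_derivative (\<lambda>h. f (x + h *\<^sub>R b)) (at 0)) M"
    by (meson half_gt_zero)
qed

section \<open>Fourier coefficients of periodic entire functions\<close>

lemma ex_add: "ex (a + b) = ex a * ex b"
  by (simp add: ex_def exp_add[symmetric] algebra_simps)

lemma ex_0 [simp]: "ex 0 = 1"
  by (simp add: ex_def)

lemma ex_nonzero [simp]: "ex z \<noteq> 0"
  by (simp add: ex_def)

lemma ex_minus: "ex (- z) = inverse (ex z)"
  by (simp add: ex_def exp_minus)

lemma ex_diff: "ex (a - b) = ex a / ex b"
  by (simp add: ex_def exp_diff[symmetric] algebra_simps)

lemma ex_eq_1_iff: "ex z = 1 \<longleftrightarrow> z \<in> \<int>"
proof -
  have "ex z = 1 \<longleftrightarrow> (\<exists>n::int. z = of_int n)"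
    unfolding ex_def exp_eq_1 by (auto simp: complex_eq_iff)
  thus ?thesis by (auto elim: Ints_cases)
qed

lemma ex_eq_iff: "ex a = ex b \<longleftrightarrow> a - b \<in> \<int>"
  unfolding ex_eq_1_iff[symmetric] ex_diff by auto

lemma norm_ex: "norm (ex z) = exp (- 2 * pi * Im z)"
  by (simp add: ex_def norm_exp_eq_Re)

lemma ex_holomorphic [holomorphic_intros]: "f holomorphic_on S \<Longrightarrow> (\<lambda>z. ex (f z)) holomorphic_on S"
  unfolding ex_def by (intro holomorphic_intros)

lemma ex_real_analytic [real_analytic_intros]:
  "f real_analytic_on S \<Longrightarrow> (\<lambda>z. ex (f z)) real_analytic_on S" for f :: "'a::euclidean_space \<Rightarrow> complex"
  unfolding ex_def by (intro real_analytic_intros)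

lemma continuous_on_ex [continuous_intros]: "continuous_on S f \<Longrightarrow> continuous_on S (\<lambda>x. ex (f x))"
  unfolding ex_def by (intro continuous_intros)

text \<open>On functions of period 1 this is the constant Fourier coefficient.\<close>

definition per :: "(complex \<Rightarrow> complex) \<Rightarrow> complex" where
  "per f = contour_integral (linepath 0 1) f"

lemma entire_primitive:
  assumes "f holomorphic_on UNIV"
  obtains \<Phi> where "\<And>z. (\<Phi> has_field_derivative f z) (at z)"
  using holomorphic_convex_primitive'[of UNIV f] assms by auto

lemma linepath_primitive:
  assumes "\<And>z. (\<Phi> has_field_derivative f z) (at z)"
  shows "(f has_contour_integral (\<Phi> b - \<Phi> a)) (linepath a b)"
  using contour_integral_primitive[of UNIV \<Phi> f "linepath a b"] assms by simp

lemma per_primitive: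
  assumes "\<And>z. (\<Phi> has_field_derivative f z) (at z)"
  shows "per f = \<Phi> 1 - \<Phi> 0"
  unfolding per_def by (rule contour_integral_unique[OF linepath_primitive[OF assms]])

text \<open>The increment of a primitive over one period has derivative zero. Moving the line of
  integration thus needs no rectangular contour.\<close>

lemma periodic_primitive:
  assumes "\<And>z. (\<Phi> has_field_derivative f z) (at z)" "\<And>z. f (z + 1) = f z"
  shows "\<Phi> (z + 1) - \<Phi> z = per f"
proof -
  have "((\<lambda>z. \<Phi> (z + 1) - \<Phi> z) has_field_derivative 0) (at z)" for z
  proof -
    have "((\<lambda>z. \<Phi> (z + 1)) has_field_derivative f (z + 1)) (at z)"
      using assms(1)[of "z + 1"] by (simp add: DERIV_shift)
    from DERIV_diff[OF this assms(1)] show ?thesis by (simp add: assms(2))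
  qed
  then obtain c where "\<And>z. \<Phi> (z + 1) - \<Phi> z = c"
    using has_field_derivative_zero_constant[of UNIV "\<lambda>z. \<Phi> (z + 1) - \<Phi> z"] by auto
  from this[of z] this[of 0] per_primitive[OF assms(1)] show ?thesis by simp
qed

lemma per_shift:
  assumes "f holomorphic_on UNIV" "\<And>z. f (z + 1) = f z"
  shows "contour_integral (linepath w (w + 1)) f = per f"
proof -
  obtain \<Phi> where \<Phi>: "\<And>z. (\<Phi> has_field_derivative f z) (at z)"
    using entire_primitive[OF assms(1)] by blast
  show ?thesis
    using contour_integral_unique[OF linepath_primitive[OF \<Phi>]] periodic_primitive[OF \<Phi> assms(2)] by simp
qed

lemma per_translate:
  assumes "f holomorphic_on UNIV" "\<And>z. f (z + 1) = f z"
  shows "per (\<lambda>z. f (z + w)) = per f"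
proof -
  obtain \<Phi> where \<Phi>: "\<And>z. (\<Phi> has_field_derivative f z) (at z)"
    using entire_primitive[OF assms(1)] by blast
  have "((\<lambda>z. \<Phi> (z + w)) has_field_derivative f (z + w)) (at z)" for z
    using \<Phi>[of "z + w"] by (simp add: DERIV_shift)
  from per_primitive[OF this] periodic_primitive[OF \<Phi> assms(2), of w] show ?thesis
    by (simp add: add.commute)
qed

lemma entire_contour_integrable: "f holomorphic_on UNIV \<Longrightarrow> f contour_integrable_on linepath a b"
  by (meson contour_integrable_holomorphic_simple open_UNIV subset_UNIV valid_path_linepath)

lemma per_add: "f holomorphic_on UNIV \<Longrightarrow> g holomorphic_on UNIV \<Longrightarrow> per (\<lambda>z. f z + g z) = per f + per g"
  unfolding per_def by (intro contour_integral_add entire_contour_integrable)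

lemma per_diff: "f holomorphic_on UNIV \<Longrightarrow> g holomorphic_on UNIV \<Longrightarrow> per (\<lambda>z. f z - g z) = per f - per g"
  unfolding per_def by (intro contour_integral_diff entire_contour_integrable)

lemma per_cmult: "f holomorphic_on UNIV \<Longrightarrow> per (\<lambda>z. k * f z) = k * per f"
  unfolding per_def by (intro contour_integral_lmul entire_contour_integrable)

lemma per_ex: "per (\<lambda>z. ex (of_int n * z)) = (if n = 0 then 1 else 0)"
proof (cases "n = 0")
  case True
  have "per (\<lambda>_. 1) = 1 - 0"
    by (rule per_primitive) (auto intro!: derivative_eq_intros)
  with True show ?thesis by simp
next
  case False
  have "per (\<lambda>z. ex (of_int n * z)) = ex (of_int n * 1) / (2 * pi * \<i> * of_int n) - ex (of_int n * 0) / (2 * pi * \<i> * of_int n)"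
  proof (rule per_primitive)
    fix z show "((\<lambda>z. ex (of_int n * z) / (2 * pi * \<i> * of_int n)) has_field_derivative ex (of_int n * z)) (at z)"
      unfolding ex_def using False by (auto intro!: derivative_eq_intros simp: field_simps)
  qed
  moreover have "ex (of_int n) = 1" by (simp add: ex_eq_1_iff)
  ultimately show ?thesis using False by simp
qed

lemma per_bound:
  assumes "f holomorphic_on UNIV" "\<And>z. f (z + 1) = f z"
    "\<And>z. z \<in> closed_segment w (w + 1) \<Longrightarrow> norm (f z) \<le> B" "B \<ge> 0"
  shows "norm (per f) \<le> B"
  using contour_integral_bound_linepath[of f w "w + 1" B] assms
  by (simp add: per_shift entire_contour_integrable)

text \<open>\<open>f z - f w\<close> vanishes on \<open>w + \<int>\<close>, which is the set of
  zeros of \<open>ex (z - w) - 1\<close>, all of them simple. Near \<open>w\<close> the quotient is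
  a quotient of two difference quotients; periodicity carries this to the other zeros.\<close>

lemma entire_difference_quotient:
  assumes "f holomorphic_on UNIV" "\<And>z. f (z + 1) = f z"
  obtains K where "K holomorphic_on UNIV" "\<And>z. K (z + 1) = K z"
    "\<And>z. f z = f w + (ex (z - w) - 1) * K z"
proof -
  \<comment> \<open>The value at the zeros is the limit there, as \<open>ex (z - w)\<close> has
    derivative \<open>2 * pi * \<i>\<close> at \<open>w\<close>.\<close>
  define K where "K z = (if ex (z - w) = 1 then deriv f w / (2 * pi * \<i>) else (f z - f w) / (ex (z - w) - 1))" for z
  have fint: "f (z + of_int k) = f z" for z k
  proof -
    have nat: "f (z + of_nat n) = f z" for z n
    proof (induction n)
      case (Suc n)
      have "f (z + of_nat (Suc n)) = f ((z + of_nat n) + 1)" by (simp add: add_ac)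
      thus ?case using Suc assms(2) by simp
    qed simp
    show ?thesis
    proof (cases "k \<ge> 0")
      case True
      thus ?thesis using nat[of z "nat k"] by simp
    next
      case False
      thus ?thesis using nat[of "z + of_int k" "nat (-k)"] by simp
    qed
  qed
  have exint: "ex (z + of_int k - w) = ex (z - w)" for z k
    by (simp add: ex_eq_iff)
  have Kint: "K (z + of_int k) = K z" for z k
    unfolding K_def exint fint ..
  define p where "p = (\<lambda>z. if z = w then deriv f w else (f z - f w) / (z - w))"
  have p: "p holomorphic_on UNIV"
    unfolding p_def by (rule pole_lemma[OF assms(1)]) auto
  define g where "g z = ex (z - w)" for z
  have g: "g holomorphic_on UNIV"
    unfolding g_def by (intro holomorphic_intros)
  have "(g has_field_derivative (2 * pi * \<i> * g w)) (at w)"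
    unfolding g_def ex_def by (auto intro!: derivative_eq_intros)
  hence g': "deriv g w = 2 * pi * \<i>"
    using DERIV_imp_deriv by (fastforce simp: g_def)
  \<comment> \<open>Its value at \<open>w\<close> is \<open>2 * pi * \<i>\<close>, so
    \<open>e\<close> stays nonzero near \<open>w\<close> and \<open>K = p / e\<close> is holomorphic
    there.\<close>
  define e where "e = (\<lambda>z. if z = w then deriv g w else (g z - g w) / (z - w))"
  have e: "e holomorphic_on UNIV"
    unfolding e_def by (rule pole_lemma[OF g]) auto
  define U where "U = {z. e z \<noteq> 0}"
  have "continuous_on UNIV e" using e by (rule holomorphic_on_imp_continuous_on)
  hence "open U"
    unfolding U_def by (intro open_Collect_neq) auto
  have wU: "w \<in> U" by (simp add: U_def e_def g')
  have KU: "K z = p z / e z" if "z \<in> U" for z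
  proof (cases "z = w")
    case True
    thus ?thesis by (simp add: K_def p_def e_def g')
  next
    case False
    hence "ex (z - w) \<noteq> 1" using that by (auto simp: U_def e_def g_def)
    with False show ?thesis by (simp add: K_def p_def e_def g_def)
  qed
  have "(\<lambda>z. p z / e z) holomorphic_on U"
    by (intro holomorphic_intros holomorphic_on_subset[OF p] holomorphic_on_subset[OF e]) (auto simp: U_def)
  hence KU_hol: "K holomorphic_on U"
    by (rule holomorphic_transform) (simp add: KU)
  hence Kw: "K field_differentiable (at w)"
    using \<open>open U\<close> wU holomorphic_on_imp_differentiable_at by blast
  have "K field_differentiable (at z)" for z
  proof (cases "ex (z - w) = 1")
    case True
    then obtain k :: int where "z - w = of_int k"
      by (auto simp: ex_eq_1_iff elim: Ints_cases)
    hence z: "z = w + of_int k" by (simp add: algebra_simps)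
    from Kw obtain D where "(K has_field_derivative D) (at w)"
      by (auto simp: field_differentiable_def)
    hence "((\<lambda>x. K (x + of_int (-k))) has_field_derivative D) (at z)"
      using DERIV_shift[of K D z "of_int (-k)"] z by simp
    thus ?thesis unfolding Kint by (auto simp: field_differentiable_def)
  next
    case False
    define V where "V = {z. ex (z - w) \<noteq> 1}"
    have "open V" unfolding V_def by (intro open_Collect_neq continuous_intros)
    have "(\<lambda>z. (f z - f w) / (ex (z - w) - 1)) holomorphic_on V"
      by (intro holomorphic_intros holomorphic_on_subset[OF assms(1)]) (auto simp: V_def)
    hence "K holomorphic_on V"
      by (rule holomorphic_transform) (auto simp: K_def V_def)
    with \<open>open V\<close> False show ?thesis
      using holomorphic_on_imp_differentiable_at by (auto simp: V_def)
  qed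
  hence "K holomorphic_on UNIV" by (simp add: holomorphic_on_def field_differentiable_at_within)
  moreover have "f z = f w + (ex (z - w) - 1) * K z" for z
  proof (cases "ex (z - w) = 1")
    case True
    then obtain k :: int where "z - w = of_int k"
      by (auto simp: ex_eq_1_iff elim: Ints_cases)
    hence "z = w + of_int k" by (simp add: algebra_simps)
    with True show ?thesis using fint by simp
  qed (simp add: K_def)
  moreover have "K (z + 1) = K z" for z using Kint[of z 1] by simp
  ultimately show thesis by (intro that[of K])
qed

lemma exp_decay_zero:
  fixes c :: complex
  assumes "\<And>n::nat. norm c \<le> B * exp (- 2 * pi * real n)"
  shows "c = 0"
proof -
  have "(\<lambda>n. B * exp (- 2 * pi) ^ n) \<longlonglongrightarrow> B * 0"
    by (intro tendsto_mult tendsto_const LIMSEQ_realpow_zero) auto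
  moreover have "norm c \<le> B * exp (- 2 * pi) ^ n" for n
    using assms[of n] by (simp add: exp_of_nat_mult[symmetric] mult_ac)
  ultimately have "norm c \<le> B * 0"
    by (intro LIMSEQ_le_const) auto
  thus ?thesis by simp
qed

lemma entire_bounded_on_segment:
  assumes "K holomorphic_on UNIV"
  obtains B where "B \<ge> 0" "\<And>z. z \<in> closed_segment a b \<Longrightarrow> norm (K z) \<le> (B::real)"
proof -
  have "compact (K ` closed_segment a b)"
    using assms by (intro compact_continuous_image)
      (auto intro: holomorphic_on_imp_continuous_on holomorphic_on_subset)
  then obtain B where "\<forall>x\<in>K ` closed_segment a b. norm x \<le> B"
    using compact_imp_bounded bounded_iff by metis
  thus thesis by (intro that[of "max B 0"]) (auto simp: le_max_iff_disj)
qed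

text \<open>
  With \<open>f z = f w + (ex (z - w) - 1) * K z\<close>, the Fourier coefficients of \<open>K\<close> centred at \<open>w\<close>
  are constant on either side of \<open>0\<close> and jump by \<open>f w\<close>. They decay, as is seen by moving the line
  of integration below and above \<open>w\<close>.
\<close>

lemma entire_periodic_eq_0:
  assumes f: "f holomorphic_on UNIV" "\<And>z. f (z + 1) = f z"
    and coef: "\<And>n::int. per (\<lambda>z. f z * ex (of_int n * z)) = 0"
  shows "f w = 0"
proof -
  let ?E = "\<lambda>n z. ex (of_int n * (z - w))"
  obtain K where K: "K holomorphic_on UNIV" "\<And>z. K (z + 1) = K z"
    "\<And>z. f z = f w + (ex (z - w) - 1) * K z"
    using entire_difference_quotient[OF f] by blast
  define c where "c n = per (\<lambda>z. K z * ?E n z)" for n :: int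
  have hol: "(\<lambda>z. K z * ?E n z) holomorphic_on UNIV" for n :: int
    by (intro holomorphic_intros K)
  have ex1: "ex (of_int n * (z + 1 - w)) = ?E n z" for n :: int and z
    by (simp add: ex_eq_iff algebra_simps)
  \<comment> \<open>Compares constant Fourier coefficients after multiplication by
    \<open>?E n\<close>: the left side gives 0 by assumption, and the constant \<open>f w\<close>
    contributes only for \<open>n = 0\<close>.\<close>
  have step: "c (n + 1) = c n - (if n = 0 then f w else 0)" for n
  proof -
    have "per (\<lambda>z. f z * ?E n z) = per (\<lambda>z. ex (- of_int n * w) * (f z * ex (of_int n * z)))"
      by (simp add: ex_add[symmetric] algebra_simps)
    also have "\<dots> = 0"
      by (subst per_cmult) (auto intro!: holomorphic_intros f simp: coef)
    finally have "0 = per (\<lambda>z. f z * ?E n z)" by simp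
    also have "(\<lambda>z. f z * ?E n z) =
      (\<lambda>z. (f w * ex (- of_int n * w)) * ex (of_int n * z) + (K z * ?E (n + 1) z - K z * ?E n z))"
    proof
      fix z
      have "?E (n + 1) z = ex (z - w) * ?E n z"
        by (simp add: ex_add[symmetric] algebra_simps)
      moreover have "?E n z = ex (- of_int n * w) * ex (of_int n * z)"
        by (simp add: ex_add[symmetric] algebra_simps)
      ultimately show "f z * ?E n z = (f w * ex (- of_int n * w)) * ex (of_int n * z) + (K z * ?E (n + 1) z - K z * ?E n z)"
        by (subst K(3)) (simp add: algebra_simps)
    qed
    also have "per \<dots> = (f w * ex (- of_int n * w)) * per (\<lambda>z. ex (of_int n * z)) + (c (n + 1) - c n)"
      by (subst per_add; (subst per_diff)?; (subst per_cmult)?) (auto intro!: holomorphic_intros K simp: c_def)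
    finally have "0 = (f w * ex (- of_int n * w)) * (if n = 0 then 1 else 0) + (c (n + 1) - c n)"
      unfolding per_ex .
    thus ?thesis by (cases "n = 0") (simp_all add: algebra_simps)
  qed
  have neg: "c (- int n) = c 0" for n
  proof (induction n)
    case (Suc n)
    thus ?case using step[of "- int (Suc n)"] by simp
  qed simp
  have pos: "c (1 + int n) = c 1" for n
  proof (induction n)
    case (Suc n)
    thus ?case using step[of "1 + int n"] by (simp add: add_ac)
  qed simp
  \<comment> \<open>On the line through \<open>w + \<delta>\<close> the factor \<open>?E n\<close>
    has constant modulus. Taking \<delta> as \<open>- \<i>\<close> makes it small for negative
    \<open>n\<close>, taking it as \<open>\<i>\<close> for positive \<open>n\<close>.\<close>
  have shift: "norm (c n) \<le> B * exp (- 2 * pi * (real_of_int n * Im \<delta>))"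
    if B: "B \<ge> 0" "\<And>z. z \<in> closed_segment (w + \<delta>) (w + \<delta> + 1) \<Longrightarrow> norm (K z) \<le> B" for n B \<delta>
    unfolding c_def
  proof (rule per_bound[OF hol])
    fix z assume z: "z \<in> closed_segment (w + \<delta>) (w + \<delta> + 1)"
    then obtain u :: real where "z = (1 - u) *\<^sub>R (w + \<delta>) + u *\<^sub>R (w + \<delta> + 1)"
      by (auto simp: in_segment)
    hence "z = w + \<delta> + of_real u" by (simp add: scaleR_conv_of_real algebra_simps)
    hence "z - w = \<delta> + of_real u" by simp
    hence "Im (of_int n * (z - w)) = real_of_int n * Im \<delta>" by simp
    hence "norm (?E n z) = exp (- 2 * pi * (real_of_int n * Im \<delta>))"
      by (simp only: norm_ex)
    thus "norm (K z * ?E n z) \<le> B * exp (- 2 * pi * (real_of_int n * Im \<delta>))"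
      using B(2)[OF z] by (simp add: norm_mult)
  qed (use B K ex1 in auto)
  have "c 0 = 0"
  proof -
    obtain B where "B \<ge> 0" "\<And>z. z \<in> closed_segment (w - \<i>) (w - \<i> + 1) \<Longrightarrow> norm (K z) \<le> B"
      using entire_bounded_on_segment[OF K(1)] by blast
    from shift[of B "-\<i>" "- int n" for n] this show ?thesis
      by (intro exp_decay_zero[of _ B]) (simp add: neg)
  qed
  moreover have "c 1 = 0"
  proof -
    obtain B where B: "B \<ge> 0" "\<And>z. z \<in> closed_segment (w + \<i>) (w + \<i> + 1) \<Longrightarrow> norm (K z) \<le> B"
      using entire_bounded_on_segment[OF K(1)] by blast
    have "norm (c 1) \<le> B * exp (- 2 * pi * real n)" for n
    proof -
      have "norm (c 1) \<le> B * exp (- 2 * pi * (1 + real n))"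
        using shift[of B \<i> "1 + int n"] B by (simp add: pos)
      also have "\<dots> \<le> B * exp (- 2 * pi * real n)"
        using B(1) by (intro mult_left_mono) auto
      finally show ?thesis .
    qed
    thus ?thesis by (rule exp_decay_zero)
  qed
  ultimately show ?thesis using step[of 0] by simp
qed

section \<open>The theta function\<close>

text \<open>The power of q and the exponential in z are merged into one \<open>ex\<close>, so that
  the laws of theta become identities between exponents.\<close>

definition tterm :: "complex \<Rightarrow> complex \<Rightarrow> int \<Rightarrow> complex" where
  "tterm \<tau> z n = (-1) powi n * ex (of_real ((of_int n + 1/2)\<^sup>2 / 2) * \<tau> + (of_int n + 1/2) * z)"

lemma theta11_eq: "theta11 \<tau> z = \<i> * infsum (tterm \<tau> z) UNIV"
proof -
  have "(-1) powi n * qp \<tau> (1/2 * (of_int n + 1/2)\<^sup>2) * ex ((of_int n + 1/2) * z) = tterm \<tau> z n" for n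
    by (simp add: tterm_def qp_def ex_add)
  thus ?thesis by (simp add: theta11_def)
qed

lemma summable_exp_abs_int: "(\<lambda>n::int. exp (- \<bar>real_of_int n\<bar>)) summable_on UNIV"
proof -
  have nat: "(\<lambda>n::nat. exp (- real n)) summable_on UNIV"
  proof (rule norm_summable_imp_summable_on)
    have "summable (\<lambda>n. exp (-1::real) ^ n)" by (intro summable_geometric) auto
    thus "summable (\<lambda>n::nat. norm (exp (- real n)))" by (simp add: exp_of_nat_mult[symmetric])
  qed
  have "(\<lambda>n::int. exp (- \<bar>real_of_int n\<bar>)) summable_on range int"
    by (subst summable_on_reindex) (use nat in \<open>auto simp: o_def\<close>)
  moreover have "(\<lambda>n::int. exp (- \<bar>real_of_int n\<bar>)) summable_on range (\<lambda>n. - int n)"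
    by (subst summable_on_reindex) (use nat in \<open>auto simp: o_def inj_on_def\<close>)
  ultimately have "(\<lambda>n::int. exp (- \<bar>real_of_int n\<bar>)) summable_on (range int \<union> range (\<lambda>n. - int n))"
    by (rule summable_on_union)
  moreover have "range int \<union> range (\<lambda>n. - int n) = UNIV"
  proof -
    have "n \<in> range int \<union> range (\<lambda>n. - int n)" for n :: int
      by (cases n rule: int_cases2) auto
    thus ?thesis by auto
  qed
  ultimately show ?thesis by simp
qed

text \<open>The majorant for theta terms: \<open>a\<close> stands for a lower bound of
  \<open>pi * Im \<tau>\<close> and \<open>c\<close> for an upper bound of
  \<open>2 * pi * \<bar>Im z\<bar>\<close>.\<close>

definition gauss :: "real \<Rightarrow> real \<Rightarrow> int \<Rightarrow> real" where
  "gauss a c n = exp (- a * (of_int n + 1/2)\<^sup>2 + c * \<bar>of_int n + 1/2\<bar>)"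

lemma summable_gauss:
  assumes "a > 0"
  shows "gauss a c summable_on UNIV"
proof (rule summable_on_comparison_test)
  \<comment> \<open>\<open>(c + 1)\<^sup>2 / (4 * a)\<close> is the maximum of
    \<open>(c + 1) * B - a * B\<^sup>2\<close> over real B; the summand 1/2 makes up for
    \<open>\<bar>n\<bar> \<le> B + 1/2\<close>.\<close>
  define C where "C = (c + 1)\<^sup>2 / (4 * a) + 1 / 2"
  show "(\<lambda>n::int. exp C * exp (- \<bar>real_of_int n\<bar>)) summable_on UNIV"
    by (intro summable_on_cmult_right summable_exp_abs_int)
  fix n :: int
  define B where "B = \<bar>of_int n + 1/2 :: real\<bar>"
  have "0 \<le> (2 * a * B - (c + 1))\<^sup>2 / (4 * a)" using assms by simp
  also have "\<dots> = a * B\<^sup>2 - (c + 1) * B + (c + 1)\<^sup>2 / (4 * a)"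
    using assms by (simp add: field_simps power2_eq_square)
  finally have "- a * B\<^sup>2 + c * B \<le> C - 1 / 2 - B" by (simp add: C_def algebra_simps)
  moreover have "\<bar>real_of_int n\<bar> \<le> B + 1 / 2" by (simp add: B_def)
  ultimately have "- a * B\<^sup>2 + c * B \<le> C + - \<bar>real_of_int n\<bar>" by linarith
  thus "gauss a c n \<le> exp C * exp (- \<bar>real_of_int n\<bar>)"
    unfolding exp_add[symmetric] by (simp add: B_def gauss_def)
qed (auto simp: gauss_def)

lemma norm_tterm_le:
  assumes "y \<le> Im \<tau>" "\<bar>Im z\<bar> \<le> c"
  shows "norm (tterm \<tau> z n) \<le> gauss (pi * y) (2 * pi * c) n"
proof -
  define B where "B = (of_int n + 1/2 :: real)"
  have "norm (tterm \<tau> z n) = exp (- 2 * pi * (B\<^sup>2 / 2 * Im \<tau> + B * Im z))"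
    by (simp add: tterm_def norm_mult norm_power_int norm_ex B_def)
  also have "- 2 * pi * (B\<^sup>2 / 2 * Im \<tau> + B * Im z) = - (pi * Im \<tau>) * B\<^sup>2 + 2 * pi * (- (B * Im z))"
    by (simp add: algebra_simps)
  also have "\<dots> \<le> - (pi * y) * B\<^sup>2 + 2 * pi * (c * \<bar>B\<bar>)"
  proof (intro add_mono mult_left_mono)
    have "- (B * Im z) \<le> \<bar>B\<bar> * \<bar>Im z\<bar>" by (simp add: abs_mult[symmetric])
    also have "\<dots> \<le> \<bar>B\<bar> * c" by (intro mult_left_mono assms) auto
    finally show "- (B * Im z) \<le> c * \<bar>B\<bar>" by (simp add: mult.commute)
    show "- (pi * Im \<tau>) * B\<^sup>2 \<le> - (pi * y) * B\<^sup>2"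
      using assms by (intro mult_right_mono) auto
  qed auto
  finally show ?thesis by (simp add: B_def gauss_def algebra_simps)
qed

lemma tterm_has_sum: "Im \<tau> > 0 \<Longrightarrow> (tterm \<tau> z has_sum infsum (tterm \<tau> z) UNIV) UNIV"
proof -
  assume "Im \<tau> > 0"
  hence "pi * Im \<tau> > 0" by simp
  from summable_gauss[OF this] have "(\<lambda>n. norm (tterm \<tau> z n)) summable_on UNIV"
    by (rule summable_on_comparison_test[OF _ norm_tterm_le[OF order_refl order_refl]]) simp
  thus ?thesis by (rule has_sum_infsum[OF abs_summable_summable])
qed

lemma uniform_limit_tterm:
  assumes "Im \<tau> > 0" "\<And>z. z \<in> Z \<Longrightarrow> \<bar>Im z\<bar> \<le> c"
  shows "uniform_limit Z (\<lambda>N z. \<Sum>n\<in>N. tterm \<tau> z n) (\<lambda>z. infsum (tterm \<tau> z) UNIV) (finite_subsets_at_top UNIV)"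
proof (rule Weierstrass_m_test_general)
  show "norm (tterm \<tau> z n) \<le> gauss (pi * Im \<tau>) (2 * pi * c) n"
    if "z \<in> Z" for z n
    by (intro norm_tterm_le order_refl assms that)
  show "gauss (pi * Im \<tau>) (2 * pi * c) summable_on UNIV"
    using assms by (intro summable_gauss) auto
qed

lemma tterm_holomorphic [holomorphic_intros]: "(\<lambda>z. tterm \<tau> z n) holomorphic_on S"
  unfolding tterm_def by (intro holomorphic_intros)

lemma theta11_entire:
  assumes "Im \<tau> > 0" shows "theta11 \<tau> holomorphic_on UNIV"
proof -
  have "(\<lambda>z. infsum (tterm \<tau> z) UNIV) field_differentiable (at w)" for w
  proof -
    have "\<bar>Im z\<bar> \<le> norm w + 1" if "z \<in> cball w 1" for z
    proof -
      have "\<bar>Im z\<bar> \<le> norm z" by (rule abs_Im_le_cmod)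
      also have "\<dots> \<le> norm w + norm (z - w)" by (metis add.commute diff_add_cancel norm_triangle_ineq)
      finally show ?thesis using that by (simp add: dist_norm norm_minus_commute)
    qed
    note ul = uniform_limit_tterm[OF assms this]
    have "(\<lambda>z. infsum (tterm \<tau> z) UNIV) holomorphic_on ball w 1"
      by (rule holomorphic_uniform_limit[OF _ ul])
         (auto intro!: always_eventually holomorphic_intros holomorphic_on_imp_continuous_on)
    thus ?thesis by (intro holomorphic_on_imp_differentiable_at[of _ "ball w 1"]) auto
  qed
  hence "(\<lambda>z. infsum (tterm \<tau> z) UNIV) holomorphic_on UNIV"
    by (simp add: holomorphic_on_def field_differentiable_at_within)
  thus ?thesis unfolding theta11_eq[abs_def] by (intro holomorphic_intros)
qed

lemma theta11_holomorphic [holomorphic_intros]: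
  "Im \<tau> > 0 \<Longrightarrow> f holomorphic_on S \<Longrightarrow> (\<lambda>z. theta11 \<tau> (f z)) holomorphic_on S"
  using holomorphic_on_compose_gen[OF _ theta11_entire, of f S \<tau>] by (simp add: o_def)

section \<open>Quasi-periods of theta, its behaviour under T, and its analyticity\<close>

lemma theta11_plus_1: "theta11 \<tau> (z + 1) = - theta11 \<tau> z"
proof -
  have "tterm \<tau> (z + 1) n = - tterm \<tau> z n" for n
  proof -
    have "ex (1/2) = -1" by (simp add: ex_def exp_pi_i')
    moreover have "ex (of_int n) = 1" by (simp add: ex_eq_1_iff)
    ultimately have "ex (of_int n + 1/2) = -1" unfolding ex_add by simp
    thus ?thesis by (simp add: tterm_def distrib_left ex_add)
  qed
  hence "tterm \<tau> (z + 1) = (\<lambda>n. - tterm \<tau> z n)" by blast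
  thus ?thesis by (simp add: theta11_eq infsum_uminus)
qed

text \<open>Completing the square turns the shift by \<tau> into the index shift from
  \<open>n\<close> to \<open>n + 1\<close>, and \<open>(-1) powi n\<close> supplies the
  sign.\<close>

lemma theta11_plus_tau: "theta11 \<tau> (z + \<tau>) = - ex (- \<tau> / 2 - z) * theta11 \<tau> z"
proof -
  have "tterm \<tau> (z + \<tau>) n = - ex (- \<tau> / 2 - z) * tterm \<tau> z (n + 1)" for n
  proof -
    have "of_real ((of_int n + 1/2)\<^sup>2 / 2) * \<tau> + (of_int n + 1/2) * (z + \<tau>) =
       (- \<tau> / 2 - z) + (of_real ((of_int (n + 1) + 1/2)\<^sup>2 / 2) * \<tau> + (of_int (n + 1) + 1/2) * z)"
      by (simp add: field_simps power2_eq_square)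
    thus ?thesis by (simp add: tterm_def ex_add power_int_add)
  qed
  hence "tterm \<tau> (z + \<tau>) = (\<lambda>n. - ex (- \<tau> / 2 - z) * tterm \<tau> z (n + 1))" by blast
  hence "infsum (tterm \<tau> (z + \<tau>)) UNIV = - ex (- \<tau> / 2 - z) * infsum (\<lambda>n. tterm \<tau> z (n + 1)) UNIV"
    by (simp only: infsum_cmult_right')
  also have "infsum (\<lambda>n. tterm \<tau> z (n + 1)) UNIV = infsum (tterm \<tau> z) UNIV"
    by (rule infsum_reindex_bij_betw) (auto intro!: bij_betwI[where g = "\<lambda>n. n - 1"])
  finally show ?thesis by (simp add: theta11_eq)
qed

text \<open>\<open>(n + 1/2)\<^sup>2 / 2\<close> is \<open>n * (n + 1) / 2 + 1/8\<close> with
  integral first summand, so all terms acquire the same root of unity.\<close>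

lemma theta11_tau_plus_1: "theta11 (\<tau> + 1) z = ex (1/8) * theta11 \<tau> z"
proof -
  have "tterm (\<tau> + 1) z n = ex (1/8) * tterm \<tau> z n" for n
  proof -
    have "even (n * (n + 1))" by simp
    then obtain k where k: "n * (n + 1) = 2 * k" by (elim evenE)
    hence "real_of_int n * (real_of_int n + 1) = 2 * real_of_int k"
      by (metis of_int_1 of_int_add of_int_mult of_int_numeral)
    hence "(of_int n + 1/2 :: real)\<^sup>2 / 2 = of_int k + 1 / 8"
      by (simp add: power2_eq_square field_simps)
    hence "complex_of_real ((of_int n + 1/2)\<^sup>2 / 2) = of_int k + 1 / 8"
      by (simp only: of_real_add of_real_of_int_eq) simp
    hence "ex (of_real ((of_int n + 1/2)\<^sup>2 / 2)) = ex (1/8)"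
      by (simp only: ex_eq_iff) simp
    thus ?thesis by (simp add: tterm_def distrib_left ex_add)
  qed
  hence "tterm (\<tau> + 1) z = (\<lambda>n. ex (1/8) * tterm \<tau> z n)" by blast
  thus ?thesis by (simp add: theta11_eq infsum_cmult_right')
qed

text \<open>Each term is the exponential of an affine function of the two variables, so
  \<open>expands_exp\<close> bounds its norm on a cube; on a small cube these bounds still have
  Gaussian decay and are summable.\<close>

lemma theta11_real_analytic: "(\<lambda>p. theta11 (fst p) (snd p)) real_analytic_on {p. Im (fst p) > 0}"
proof -
  have "(\<lambda>p. infsum (tterm (fst p) (snd p)) UNIV) real_analytic_on {p. Im (fst p) > 0}"
    unfolding real_analytic_on_iff
  proof clarsimp
    fix t0 z0 :: complex assume y0: "Im t0 > 0"
    \<comment> \<open>On the cube \<tau> differs from \<open>t0\<close> by at most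
      \<open>2 * r\<close>, half of \<open>Im t0\<close>. This costs half of the Gaussian decay and
      keeps the cube in the upper half-plane.\<close>
    define r where "r = Im t0 / 4"
    have r: "r > 0" using y0 by (simp add: r_def)
    have coord: "expands (t0, z0) r (\<lambda>p. fst p - t0) (2 * r)" "expands (t0, z0) r (\<lambda>p. snd p - z0) (2 * r)"
    proof -
      have 1: "expands (t0, z0) r (\<lambda>x. of_real ((x - (t0, z0)) \<bullet> b) + \<i> * of_real ((x - (t0, z0)) \<bullet> b')) (r + norm \<i> * r)"
        if "b \<in> Basis" "b' \<in> Basis" for b b'
        using r that by (intro expands_add expands_cmult expands_coord)
      have "(\<lambda>x. of_real ((x - (t0, z0)) \<bullet> (1, 0)) + \<i> * of_real ((x - (t0, z0)) \<bullet> (\<i>, 0))) = (\<lambda>p. fst p - t0)"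
        "(\<lambda>x. of_real ((x - (t0, z0)) \<bullet> (0, 1)) + \<i> * of_real ((x - (t0, z0)) \<bullet> (0, \<i>))) = (\<lambda>p. snd p - z0)"
        by (auto simp: fun_eq_iff complex_eq_iff inner_prod_def)
      thus "expands (t0, z0) r (\<lambda>p. fst p - t0) (2 * r)" "expands (t0, z0) r (\<lambda>p. snd p - z0) (2 * r)"
        using 1[of "(1, 0)" "(\<i>, 0)"] 1[of "(0, 1)" "(0, \<i>)"]
        by (simp_all add: Basis_prod_def Basis_complex_def)
    qed
    define a where "a = pi * Im t0 / 2"
    define c where "c = 2 * pi * (\<bar>Im z0\<bar> + 2 * r)"
    have a: "a > 0" using y0 by (simp add: a_def)
    have "expands (t0, z0) r (\<lambda>p. tterm (fst p) (snd p) n) (gauss a c n)" for n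
    proof -
      define B where "B = (of_int n + 1/2 :: real)"
      have Bc: "complex_of_real B = of_int n + 1/2" by (simp add: B_def)
      have "expands (t0, z0) r (\<lambda>p. tterm t0 z0 n * exp (of_real (pi * B\<^sup>2) * \<i> * (fst p - t0) + of_real (2 * pi * B) * \<i> * (snd p - z0)))
        (norm (tterm t0 z0 n) * exp (norm (of_real (pi * B\<^sup>2) * \<i>) * (2 * r) + norm (of_real (2 * pi * B) * \<i>) * (2 * r)))"
        by (intro expands_cmult expands_exp expands_add coord r)
      moreover have "tterm t0 z0 n * exp (of_real (pi * B\<^sup>2) * \<i> * (fst p - t0) + of_real (2 * pi * B) * \<i> * (snd p - z0))
        = tterm (fst p) (snd p) n" for p
      proof -
        have "exp (of_real (pi * B\<^sup>2) * \<i> * (fst p - t0) + of_real (2 * pi * B) * \<i> * (snd p - z0))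
          = ex (of_real (B\<^sup>2 / 2) * (fst p - t0) + of_real B * (snd p - z0))"
          unfolding ex_def by (rule arg_cong[of _ _ exp]) (simp add: field_simps)
        moreover have "(q * t0 + b * z0) + (q * (fst p - t0) + b * (snd p - z0)) = q * fst p + b * snd p" for q b :: complex
          by (simp add: algebra_simps)
        ultimately show ?thesis
          unfolding tterm_def B_def[symmetric] Bc[symmetric]
          by (simp only: mult.assoc ex_add[symmetric])
      qed
      moreover have "norm (tterm t0 z0 n) * exp (norm (of_real (pi * B\<^sup>2) * \<i>) * (2 * r) + norm (of_real (2 * pi * B) * \<i>) * (2 * r))
        \<le> exp (- (pi * Im t0) * B\<^sup>2 + (2 * pi * \<bar>Im z0\<bar>) * \<bar>B\<bar>) * exp (pi * B\<^sup>2 * (2 * r) + 2 * pi * \<bar>B\<bar> * (2 * r))"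
      proof (rule mult_mono)
        show "norm (tterm t0 z0 n) \<le> exp (- (pi * Im t0) * B\<^sup>2 + (2 * pi * \<bar>Im z0\<bar>) * \<bar>B\<bar>)"
          unfolding B_def gauss_def[symmetric] by (rule norm_tterm_le) auto
      qed (auto simp: norm_mult abs_mult norm_power)
      moreover have "\<dots> = exp (- a * B\<^sup>2 + c * \<bar>B\<bar>)"
        by (simp add: exp_add[symmetric] a_def c_def r_def field_simps)
      ultimately show ?thesis
        unfolding gauss_def B_def[symmetric] by (simp add: expands_mono)
    qed
    hence "expands (t0, z0) r (\<lambda>p. infsum (tterm (fst p) (snd p)) UNIV)
      (infsum (gauss a c) UNIV)"
    proof (rule expands_has_sum[OF r _ has_sum_infsum[OF summable_gauss[OF a]] order_refl])
      fix p assume "p \<in> cube (t0, z0) r"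
      from expands_bound[OF coord(1) this] have "norm (fst p - t0) \<le> 2 * r" .
      hence "\<bar>Im (fst p - t0)\<bar> \<le> 2 * r" using abs_Im_le_cmod order_trans by blast
      hence "- Im (fst p - t0) \<le> 2 * r" by linarith
      hence "Im (fst p) > 0" using y0 by (simp add: r_def)
      thus "(tterm (fst p) (snd p) has_sum infsum (tterm (fst p) (snd p)) UNIV) UNIV"
        by (rule tterm_has_sum)
    qed
    with r show "\<exists>r>0. \<exists>M. expands (t0, z0) r (\<lambda>p. infsum (tterm (fst p) (snd p)) UNIV) M" by blast
  qed
  thus ?thesis unfolding theta11_eq by (intro real_analytic_intros)
qed

lemma theta11_real_analytic_on [real_analytic_intros]:
  fixes f g :: "'a::euclidean_space \<Rightarrow> complex"
  assumes "f real_analytic_on S" "g real_analytic_on S" "\<And>x. x \<in> S \<Longrightarrow> Im (f x) > 0"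
  shows "(\<lambda>x. theta11 (f x) (g x)) real_analytic_on S"
  using real_analytic_on_compose_pair[OF theta11_real_analytic, of S f g] assms by simp

lemma tterm_times_ex: "tterm \<tau> z n * ex (- z / 2) = (-1) powi n * ex (of_real ((of_int n + 1/2)\<^sup>2 / 2) * \<tau>) * ex (of_int n * z)"
  by (simp add: tterm_def ex_add[symmetric] algebra_simps add_divide_distrib)

text \<open>The factor \<open>ex (- z / 2)\<close> moves the half-integral frequencies to the
  integers, and only \<open>n = 0\<close> survives integration. The value is nonzero, so theta does
  not vanish identically and this coefficient can be used for normalisation.\<close>

lemma theta11_per:
  assumes "Im \<tau> > 0"
  shows "per (\<lambda>z. theta11 \<tau> z * ex (- z / 2)) = \<i> * ex (\<tau> / 8)"
proof -
  let ?U = "finite_subsets_at_top (UNIV :: int set)"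
  let ?C = "contour_integral (linepath 0 1)"
  let ?F = "\<lambda>N z. \<Sum>n\<in>N. tterm \<tau> z n * ex (- z / 2)"
  let ?G = "\<lambda>z. \<Sum>\<^sub>\<infinity>n. tterm \<tau> z n * ex (- z / 2)"
  have "uniform_limit (closed_segment 0 1) ?F ?G ?U"
  proof (rule Weierstrass_m_test_general)
    fix z :: complex and n assume "z \<in> closed_segment 0 1"
    hence "Im z = 0" by (auto simp: in_segment)
    thus "norm (tterm \<tau> z n * ex (- z / 2)) \<le> gauss (pi * Im \<tau>) (2 * pi * 0) n"
      using norm_tterm_le[OF order_refl, of z 0 \<tau> n] by (simp add: norm_mult norm_ex)
  next
    show "gauss (pi * Im \<tau>) (2 * pi * 0) summable_on UNIV"
      using assms by (intro summable_gauss) auto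
  qed
  hence "((\<lambda>N. ?C (?F N)) \<longlongrightarrow> ?C ?G) ?U"
    by (intro contour_integral_uniform_limit(2)[where B = 1])
       (auto intro!: always_eventually entire_contour_integrable holomorphic_intros)
  moreover have "?C (?F N) = ex (\<tau> / 8)" if "finite N" "0 \<in> N" for N
  proof -
    have *: "per (\<lambda>z. tterm \<tau> z n * ex (- z / 2)) = (if n = 0 then ex (\<tau> / 8) else 0)" for n
      unfolding tterm_times_ex
      by (subst per_cmult) (auto intro!: holomorphic_intros simp: per_ex power2_eq_square)
    have "?C (?F N) = (\<Sum>n\<in>N. per (\<lambda>z. tterm \<tau> z n * ex (- z / 2)))"
      unfolding per_def by (intro contour_integral_sum that entire_contour_integrable holomorphic_intros) auto
    thus ?thesis using that unfolding * by simp
  qed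
  hence "eventually (\<lambda>N. ?C (?F N) = ex (\<tau> / 8)) ?U"
    by (intro eventually_finite_subsets_at_top[THEN iffD2] exI[of _ "{0}"]) auto
  hence "((\<lambda>N. ?C (?F N)) \<longlongrightarrow> ex (\<tau> / 8)) ?U"
    by (rule tendsto_eventually)
  ultimately have G: "?C ?G = ex (\<tau> / 8)"
    by (intro tendsto_unique[of ?U]) auto
  have "(\<lambda>z. theta11 \<tau> z * ex (- z / 2)) = (\<lambda>z. \<i> * ?G z)"
    by (simp add: theta11_eq infsum_cmult_left' mult.assoc)
  moreover have "?G contour_integrable_on linepath 0 1"
  proof -
    have "?G = (\<lambda>z. - \<i> * (theta11 \<tau> z * ex (- z / 2)))"
      by (simp add: theta11_eq infsum_cmult_left' mult.assoc)
    thus ?thesis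
      using assms by (auto intro!: entire_contour_integrable holomorphic_intros)
  qed
  ultimately show ?thesis
    unfolding per_def by (simp only: contour_integral_lmul G)
qed

lemma theta11_not_identically_0:
  assumes "Im \<tau> > 0" obtains z where "theta11 \<tau> z \<noteq> 0"
proof (rule ccontr)
  assume "\<not> thesis"
  with that have "theta11 \<tau> z = 0" for z by blast
  with theta11_per[OF assms] show False by (simp add: per_def)
qed

lemma theta11_dense:
  assumes "Im \<tau> > 0" "open U" "z \<in> U"
  obtains z' where "z' \<in> U" "theta11 \<tau> z' \<noteq> 0"
proof (rule ccontr)
  assume "\<not> thesis"
  with that have "theta11 \<tau> x = 0" if "x \<in> U" for x using that by blast
  hence "theta11 \<tau> x = 0" for x
    using analytic_continuation_open[OF assms(2) open_UNIV _ _ _ theta11_entire[OF assms(1)] holomorphic_on_const[of 0]]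
      assms by auto
  thus False using theta11_not_identically_0[OF assms(1)] by metis
qed

text \<open>
  The quasi-periods determine all Fourier coefficients from a single one, so theta functions form a
  one-dimensional space.
\<close>

lemma theta_quasi_periodic_eq_0:
  assumes g: "g holomorphic_on UNIV" "\<And>z. g (z + 1) = - g z"
    "\<And>z. g (z + \<tau>) = - ex (- \<tau> / 2 - z) * g z" and 0: "per (\<lambda>z. g z * ex (- z / 2)) = 0"
  shows "g z = 0"
proof -
  define f where "f z = g z * ex (- z / 2)" for z
  have f: "f holomorphic_on UNIV" unfolding f_def by (intro holomorphic_intros g) auto
  have "ex (- (1/2)) = - 1" by (simp add: ex_def exp_minus exp_pi_i')
  hence 1: "ex (- z / 2 + - (1/2)) = - ex (- z / 2)" for z
    unfolding ex_add by simp
  have 2: "- (z + 1) / 2 = - z / 2 + - (1/2)" for z :: complex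
    by (simp add: field_simps)
  have f1: "f (z + 1) = f z" for z
    unfolding f_def g(2) 2 1 by simp
  define a where "a n = per (\<lambda>z. f z * ex (of_int n * z))" for n :: int
  have hol: "(\<lambda>z. f z * ex (of_int n * z)) holomorphic_on UNIV" for n :: int
    by (intro holomorphic_intros f)
  \<comment> \<open>Moving the line of integration by \<tau> does not change the coefficient, while
    the quasi-period rewrites the integrand as a multiple of the one for \<open>n - 1\<close>. The
    multiplier never vanishes, so a zero coefficient propagates in both directions.\<close>
  have rec: "a n = - ex (of_int (n - 1) * \<tau>) * a (n - 1)" for n
  proof -
    have "ex (of_int n * (z + 1)) = ex (of_int n * z)" for z
      by (simp add: ex_eq_iff algebra_simps)
    hence "per (\<lambda>z. f (z + \<tau>) * ex (of_int n * (z + \<tau>))) = a n"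
      unfolding a_def using per_translate[OF hol[of n], of \<tau>] by (simp add: f1)
    moreover have "f (z + \<tau>) * ex (of_int n * (z + \<tau>)) = - ex (of_int (n - 1) * \<tau>) * (f z * ex (of_int (n - 1) * z))" for z
    proof -
      have "f (z + \<tau>) * ex (of_int n * (z + \<tau>)) =
        - (g z * (ex (- \<tau> / 2 - z) * ex (- (z + \<tau>) / 2) * ex (of_int n * (z + \<tau>))))"
        by (simp add: f_def g(3))
      also have "ex (- \<tau> / 2 - z) * ex (- (z + \<tau>) / 2) * ex (of_int n * (z + \<tau>))
        = ex (of_int (n - 1) * \<tau>) * (ex (- z / 2) * ex (of_int (n - 1) * z))"
        unfolding ex_add[symmetric] by (rule arg_cong[of _ _ ex]) (simp add: field_simps)
      finally show ?thesis by (simp add: f_def)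
    qed
    ultimately have "a n = per (\<lambda>z. - ex (of_int (n - 1) * \<tau>) * (f z * ex (of_int (n - 1) * z)))"
      by simp
    also have "\<dots> = - ex (of_int (n - 1) * \<tau>) * a (n - 1)"
      unfolding a_def by (rule per_cmult[OF hol])
    finally show ?thesis .
  qed
  have "a n = 0" for n
  proof (induction n rule: int_induct[where k = 0])
    case base
    show ?case using 0 by (simp add: a_def f_def)
  next
    case (step1 i)
    thus ?case using rec[of "i + 1"] by simp
  next
    case (step2 i)
    thus ?case using rec[of i] by simp
  qed
  hence "f z = 0" using entire_periodic_eq_0[OF f f1] by (simp add: a_def)
  thus ?thesis by (simp add: f_def)
qed

lemma Im_minus_inverse_pos: "Im \<tau> > 0 \<Longrightarrow> Im (- 1 / \<tau>) > 0"
  by (simp add: Im_divide power2_eq_square[symmetric] divide_pos_pos sum_power2_gt_zero_iff)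

text \<open>Division by \<tau> exchanges the roles of the periods 1 and \<tau> up to sign. The
  Gaussian factor is the one with which the inverted theta function regains exactly the
  quasi-periods of \<open>theta11 \<tau>\<close>.\<close>

lemma theta11_inversion_ex:
  assumes "Im \<tau> > 0"
  shows "\<exists>c. c \<noteq> 0 \<and> (\<forall>z. theta11 (- 1 / \<tau>) (z / \<tau>) * ex (- (z\<^sup>2 / (2 * \<tau>))) = c * theta11 \<tau> z)"
proof -
  let ?\<theta> = "theta11 (- 1 / \<tau>)"
  have \<tau>: "\<tau> \<noteq> 0" using assms by auto
  note im = Im_minus_inverse_pos[OF assms]
  define g where "g z = ?\<theta> (z / \<tau>) * ex (- (z\<^sup>2 / (2 * \<tau>)))" for z
  have g: "g holomorphic_on UNIV"
    unfolding g_def using \<tau> by (intro holomorphic_intros im) auto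
  have g1: "g (z + 1) = - g z" for z
  proof -
    have "?\<theta> (z / \<tau>) = ?\<theta> ((z + 1) / \<tau> + - 1 / \<tau>)"
      by (simp add: add_divide_distrib)
    also have "\<dots> = - ex (- (- 1 / \<tau>) / 2 - (z + 1) / \<tau>) * ?\<theta> ((z + 1) / \<tau>)"
      by (rule theta11_plus_tau)
    finally have *: "?\<theta> (z / \<tau>) = - ex (- (- 1 / \<tau>) / 2 - (z + 1) / \<tau>) * ?\<theta> ((z + 1) / \<tau>)" .
    have "ex (- ((z + 1)\<^sup>2 / (2 * \<tau>))) = ex (- (- 1 / \<tau>) / 2 - (z + 1) / \<tau>) * ex (- (z\<^sup>2 / (2 * \<tau>)))"
      unfolding ex_add[symmetric] by (rule arg_cong[of _ _ ex]) (use \<tau> in \<open>simp add: field_simps power2_eq_square\<close>)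
    thus ?thesis unfolding g_def by (subst *) simp
  qed
  have g2: "g (z + \<tau>) = - ex (- \<tau> / 2 - z) * g z" for z
  proof -
    have *: "?\<theta> ((z + \<tau>) / \<tau>) = - ?\<theta> (z / \<tau>)"
      using theta11_plus_1[of "- 1 / \<tau>" "z / \<tau>"] \<tau> by (simp add: add_divide_distrib)
    have "ex (- ((z + \<tau>)\<^sup>2 / (2 * \<tau>))) = ex (- \<tau> / 2 - z) * ex (- (z\<^sup>2 / (2 * \<tau>)))"
      unfolding ex_add[symmetric] by (rule arg_cong[of _ _ ex]) (use \<tau> in \<open>simp add: field_simps power2_eq_square\<close>)
    thus ?thesis unfolding g_def * by simp
  qed
  \<comment> \<open>Chosen so that \<open>g - c * theta11 \<tau>\<close> has zero normalising
    coefficient; the denominator is that coefficient of theta, by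
    \<open>theta11_per\<close>.\<close>
  define c where "c = per (\<lambda>z. g z * ex (- z / 2)) / (\<i> * ex (\<tau> / 8))"
  have gc: "g z = c * theta11 \<tau> z" for z
  proof -
    have "g z - c * theta11 \<tau> z = 0"
    proof (rule theta_quasi_periodic_eq_0[where \<tau> = \<tau> and z = z and g = "\<lambda>z. g z - c * theta11 \<tau> z"])
      show "(\<lambda>z. g z - c * theta11 \<tau> z) holomorphic_on UNIV"
        by (intro holomorphic_intros g assms)
      have "per (\<lambda>z. (g z - c * theta11 \<tau> z) * ex (- z / 2)) =
        per (\<lambda>z. g z * ex (- z / 2) - c * (theta11 \<tau> z * ex (- z / 2)))"
        by (simp add: algebra_simps)
      also have "\<dots> = per (\<lambda>z. g z * ex (- z / 2)) - c * per (\<lambda>z. theta11 \<tau> z * ex (- z / 2))"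
        using assms by (subst per_diff; (subst per_cmult)?) (auto intro!: holomorphic_intros g)
      also have "\<dots> = 0" unfolding theta11_per[OF assms] c_def by simp
      finally show "per (\<lambda>z. (g z - c * theta11 \<tau> z) * ex (- z / 2)) = 0" .
    qed (simp_all add: g1 g2 theta11_plus_1 theta11_plus_tau algebra_simps)
    thus ?thesis by simp
  qed
  \<comment> \<open>Otherwise theta at \<open>- 1 / \<tau>\<close> would vanish identically.\<close>
  moreover have "c \<noteq> 0"
  proof
    assume "c = 0"
    obtain z where z: "?\<theta> z \<noteq> 0" using theta11_not_identically_0[OF im] by blast
    from gc[of "z * \<tau>"] \<open>c = 0\<close> z \<tau> show False by (simp add: g_def)
  qed
  ultimately show ?thesis unfolding g_def by blast
qed

text \<open>Classically \<open>- \<i> * sqrt (- \<i> * \<tau>)\<close>. Taking it by choice avoids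
  fixing a branch of the square root; uniqueness holds because theta is not identically
  zero.\<close>

definition theta_factor :: "complex \<Rightarrow> complex" where
  "theta_factor \<tau> = (SOME c. c \<noteq> 0 \<and> (\<forall>z. theta11 (- 1 / \<tau>) (z / \<tau>) * ex (- (z\<^sup>2 / (2 * \<tau>))) = c * theta11 \<tau> z))"

lemma theta_factor:
  assumes "Im \<tau> > 0"
  shows "theta_factor \<tau> \<noteq> 0" (is ?P1) "theta11 (- 1 / \<tau>) (z / \<tau>) = theta_factor \<tau> * ex (z\<^sup>2 / (2 * \<tau>)) * theta11 \<tau> z" (is ?P2)
proof -
  note * = someI_ex[OF theta11_inversion_ex[OF assms], folded theta_factor_def]
  from * show ?P1 by blast
  from * have "theta11 (- 1 / \<tau>) (z / \<tau>) * ex (- (z\<^sup>2 / (2 * \<tau>))) = theta_factor \<tau> * theta11 \<tau> z" by blast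
  thus ?P2
    by (simp add: ex_minus field_simps)
qed

lemma real_analytic_on_id [real_analytic_intros]: "(\<lambda>x::complex. x) real_analytic_on S"
  by (intro real_analytic_on_linear) (auto simp: linear_iff)

lemma theta_factor_real_analytic: "theta_factor real_analytic_on {\<tau>. Im \<tau> > 0}"
proof (rule real_analytic_on_local)
  fix \<tau>0 assume "\<tau>0 \<in> {\<tau>. Im \<tau> > 0}"
  hence im0: "Im \<tau>0 > 0" by simp
  obtain z0 where z0: "theta11 \<tau>0 z0 \<noteq> 0" using theta11_not_identically_0[OF im0] by blast
  define H where "H = {\<tau>. Im \<tau> > 0}"
  have H: "open H" unfolding H_def by (rule open_halfspace_Im_gt)
  define U where "U = H \<inter> (\<lambda>\<tau>. theta11 \<tau> z0) -` (- {0})"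
  have ra: "(\<lambda>\<tau>. theta11 \<tau> z0) real_analytic_on H"
    by (intro real_analytic_intros) (auto simp: H_def)
  hence "open U" unfolding U_def
    by (intro continuous_open_preimage real_analytic_on_imp_continuous_on H) auto
  have UH: "U \<subseteq> H" by (auto simp: U_def)
  have "theta_factor real_analytic_on U"
  proof (rule real_analytic_on_cong[OF \<open>open U\<close>])
    show "theta11 (- 1 / \<tau>) (z0 / \<tau>) / (ex (z0\<^sup>2 / (2 * \<tau>)) * theta11 \<tau> z0) = theta_factor \<tau>" if "\<tau> \<in> U" for \<tau>
      using that theta_factor(2)[of \<tau> z0] by (simp add: U_def H_def)
    show "(\<lambda>\<tau>. theta11 (- 1 / \<tau>) (z0 / \<tau>) / (ex (z0\<^sup>2 / (2 * \<tau>)) * theta11 \<tau> z0)) real_analytic_on U"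
      by (intro real_analytic_intros real_analytic_on_subset[OF ra UH] Im_minus_inverse_pos)
         (auto simp: U_def H_def)
  qed
  moreover have "\<tau>0 \<in> U" using im0 z0 by (simp add: U_def H_def)
  ultimately show "\<exists>U. \<tau>0 \<in> U \<and> theta_factor real_analytic_on U" by blast
qed

section \<open>Wirtinger derivatives\<close>

text \<open>The definitions only involve derivatives along two lines. For a differentiable function
  these are values of the total derivative, which makes the chain rule available.\<close>

lemma wirtinger_derivative:
  fixes f :: "complex \<Rightarrow> complex"
  assumes "(f has_derivative L) (at z)"
  shows "partial_x f z = L 1" "partial_y f z = L \<i>"
proof -
  interpret bounded_linear L using assms by (rule has_derivative_bounded_linear)
  have *: "((\<lambda>h::real. f (z + w * of_real h)) has_vector_derivative L w) (at 0)" for w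
  proof -
    have "((\<lambda>h::real. z + w * of_real h) has_derivative (\<lambda>h. w * of_real h)) (at 0)"
      by (auto intro!: derivative_eq_intros)
    from diff_chain_at[OF this, of f L] assms
    have "((\<lambda>h::real. f (z + w * of_real h)) has_derivative (\<lambda>h. L (w * of_real h))) (at 0)"
      by (simp add: o_def)
    moreover have "L (w * of_real h) = h *\<^sub>R L w" for h
      using scaleR[of h w] by (simp add: scaleR_conv_of_real mult.commute)
    ultimately show ?thesis by (simp add: has_vector_derivative_def)
  qed
  show "partial_x f z = L 1" "partial_y f z = L \<i>"
    unfolding partial_x_def partial_y_def using vector_derivative_at[OF *[of 1]] vector_derivative_at[OF *[of \<i>]]
    by simp_all
qed

text \<open>A real linear map of the plane has the form \<open>A * h + B * cnj h\<close> for unique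
  A and B, so both Wirtinger derivatives can be read off a total derivative.\<close>

lemma wd_unique:
  assumes "(f has_derivative (\<lambda>h. A * h + B * cnj h)) (at z)"
  shows "wd f z = A" "wd_bar f z = B"
  unfolding wd_def wd_bar_def wirtinger_derivative[OF assms] by (simp_all add: algebra_simps)

lemma real_linear_wirtinger:
  assumes "linear (L :: complex \<Rightarrow> complex)"
  shows "L h = (L 1 - \<i> * L \<i>) / 2 * h + (L 1 + \<i> * L \<i>) / 2 * cnj h"
proof -
  have "L h = L (Re h *\<^sub>R 1 + Im h *\<^sub>R \<i>)"
    by (rule arg_cong[of _ _ L]) (simp add: complex_eq_iff)
  also have "\<dots> = Re h *\<^sub>R L 1 + Im h *\<^sub>R L \<i>"
    by (simp only: linear_add[OF assms] linear_cmul[OF assms])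
  also have "\<dots> = (h + cnj h) / 2 * L 1 + (- \<i> * (h - cnj h) / 2) * L \<i>"
    by (simp add: complex_add_cnj complex_diff_cnj scaleR_conv_of_real algebra_simps)
  finally show ?thesis by (simp add: field_simps)
qed

lemma wd_has_derivative:
  assumes "f differentiable (at z)"
  shows "(f has_derivative (\<lambda>h. wd f z * h + wd_bar f z * cnj h)) (at z)"
proof -
  obtain L where L: "(f has_derivative L) (at z)"
    using assms by (auto simp: differentiable_def)
  have "L = (\<lambda>h. wd f z * h + wd_bar f z * cnj h)"
    unfolding wd_def wd_bar_def wirtinger_derivative[OF L]
    by (rule ext, rule real_linear_wirtinger[OF has_derivative_linear[OF L]])
  with L show ?thesis by simp
qed

lemma wd_holomorphic:
  assumes "(f has_field_derivative D) (at z)"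
  shows "wd f z = D" "wd_bar f z = 0"
  using wd_unique[of f D 0 z] assms by (simp_all add: has_field_derivative_def)

lemma wd_mult_holomorphic:
  assumes "(g has_field_derivative D) (at z)" "f differentiable (at z)"
  shows "wd (\<lambda>x. g x * f x) z = D * f z + g z * wd f z" (is ?P1) "wd_bar (\<lambda>x. g x * f x) z = g z * wd_bar f z" (is ?P2)
proof -
  have "((\<lambda>x. g x * f x) has_derivative (\<lambda>h. (D * f z + g z * wd f z) * h + (g z * wd_bar f z) * cnj h)) (at z)"
    using has_derivative_mult[OF has_field_derivative_imp_has_derivative[OF assms(1)] wd_has_derivative[OF assms(2)]]
    by (simp add: algebra_simps)
  from wd_unique[OF this] show ?P1 ?P2 .
qed

lemma wd_cmult:
  assumes "f differentiable (at z)"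
  shows "wd (\<lambda>x. k * f x) z = k * wd f z" "wd_bar (\<lambda>x. k * f x) z = k * wd_bar f z"
  using wd_mult_holomorphic[OF DERIV_const assms, of k] by simp_all

lemma wd_add:
  assumes "f differentiable (at z)" "g differentiable (at z)"
  shows "wd (\<lambda>x. f x + g x) z = wd f z + wd g z"
  by (rule wd_unique[of _ _ "wd_bar f z + wd_bar g z"])
     (rule derivative_eq_intros wd_has_derivative assms refl | simp add: algebra_simps)+

lemma wd_cong:
  assumes "eventually (\<lambda>x. f x = g x) (nhds z)"
  shows "wd f z = wd g z" "wd_bar f z = wd_bar g z" (is ?P1)
proof -
  have *: "vector_derivative (\<lambda>h::real. f (z + w * of_real h)) (at 0) = vector_derivative (\<lambda>h::real. g (z + w * of_real h)) (at 0)" for w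
  proof (rule vector_derivative_cong_eq)
    have "((\<lambda>h::real. z + w * of_real h) \<longlongrightarrow> z) (nhds 0)"
      by (rule tendsto_eq_intros refl filterlim_ident | simp)+
    with assms show "eventually (\<lambda>h::real. h \<in> UNIV \<longrightarrow> f (z + w * of_real h) = g (z + w * of_real h)) (nhds 0)"
      by (auto simp: filterlim_iff)
  qed auto
  show "wd f z = wd g z" ?P1
    using *[of 1] *[of \<i>] by (simp_all add: wd_def wd_bar_def partial_x_def partial_y_def)
qed

text \<open>With the six derivatives in the operators, \<open>d_u_bar\<close> and
  \<open>d_t_bar\<close> make up the total derivative, as the chain rule for the action requires.
  Both are later shown to vanish on the functions considered.\<close>

definition d_u_bar :: "(point \<Rightarrow> complex) \<Rightarrow> point \<Rightarrow> complex" where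
  "d_u_bar F = (\<lambda>(\<tau>, u, v, t). wd_bar (\<lambda>z. F (\<tau>, z, v, t)) u)"

definition d_t_bar :: "(point \<Rightarrow> complex) \<Rightarrow> point \<Rightarrow> complex" where
  "d_t_bar F = (\<lambda>(\<tau>, u, v, t). wd_bar (\<lambda>z. F (\<tau>, u, v, z)) t)"

lemmas wirtinger_defs = d_tau_def d_tau_bar_def d_u_def d_u_bar_def d_v_def d_v_bar_def d_t_def d_t_bar_def

section \<open>The total derivative in four complex variables\<close>

lemma section_has_derivative:
  fixes F :: "point \<Rightarrow> complex"
  assumes "(F has_derivative L) (at (\<tau>, u, v, t))"
  shows "((\<lambda>z. F (z, u, v, t)) has_derivative (\<lambda>h. L (h, 0, 0, 0))) (at \<tau>)" (is ?P1)
    "((\<lambda>z. F (\<tau>, z, v, t)) has_derivative (\<lambda>h. L (0, h, 0, 0))) (at u)" (is ?P2)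
    "((\<lambda>z. F (\<tau>, u, z, t)) has_derivative (\<lambda>h. L (0, 0, h, 0))) (at v)" (is ?P3)
    "((\<lambda>z. F (\<tau>, u, v, z)) has_derivative (\<lambda>h. L (0, 0, 0, h))) (at t)" (is ?P4)
proof -
  have "((\<lambda>z. (z, u, v, t)) has_derivative (\<lambda>h. (h, 0, 0, 0))) (at \<tau>)"
    "((\<lambda>z. (\<tau>, z, v, t)) has_derivative (\<lambda>h. (0, h, 0, 0))) (at u)"
    "((\<lambda>z. (\<tau>, u, z, t)) has_derivative (\<lambda>h. (0, 0, h, 0))) (at v)"
    "((\<lambda>z. (\<tau>, u, v, z)) has_derivative (\<lambda>h. (0, 0, 0, h))) (at t)"
    by (auto intro!: derivative_eq_intros simp: zero_prod_def)
  from this[THEN diff_chain_at, of F L] assms show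
    ?P1 ?P2 ?P3 ?P4
    by (simp_all add: o_def)
qed

lemma section_differentiable:
  fixes F :: "point \<Rightarrow> complex"
  assumes "F differentiable (at (\<tau>, u, v, t))"
  shows "(\<lambda>z. F (z, u, v, t)) differentiable (at \<tau>)" "(\<lambda>z. F (\<tau>, z, v, t)) differentiable (at u)"
    "(\<lambda>z. F (\<tau>, u, z, t)) differentiable (at v)" "(\<lambda>z. F (\<tau>, u, v, z)) differentiable (at t)"
  using assms section_has_derivative[of F _ \<tau> u v t] unfolding differentiable_def by blast+

definition wform :: "(point \<Rightarrow> complex) \<Rightarrow> point \<Rightarrow> point \<Rightarrow> complex" where
  "wform F p = (\<lambda>(h1, h2, h3, h4). d_tau F p * h1 + d_tau_bar F p * cnj h1 + (d_u F p * h2 + d_u_bar F p * cnj h2)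
     + (d_v F p * h3 + d_v_bar F p * cnj h3) + (d_t F p * h4 + d_t_bar F p * cnj h4))"

lemma wform_has_derivative:
  fixes F :: "point \<Rightarrow> complex"
  assumes "F differentiable (at p)"
  shows "(F has_derivative wform F p) (at p)"
proof -
  obtain \<tau> u v t where p: "p = (\<tau>, u, v, t)" by (cases p)
  obtain L where L: "(F has_derivative L) (at (\<tau>, u, v, t))"
    using assms by (auto simp: differentiable_def p)
  have lin: "linear L" using L by (rule has_derivative_linear)
  have sec: "linear (\<lambda>h. L (h, 0, 0, 0))" "linear (\<lambda>h. L (0, h, 0, 0))"
    "linear (\<lambda>h. L (0, 0, h, 0))" "linear (\<lambda>h. L (0, 0, 0, h))"
    by (rule has_derivative_linear, rule section_has_derivative[OF L])+
  have "L (h1, h2, h3, h4) = wform F p (h1, h2, h3, h4)" for h1 h2 h3 h4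
  proof -
    have "L (h1, h2, h3, h4) = L ((h1, 0, 0, 0) + ((0, h2, 0, 0) + ((0, 0, h3, 0) + (0, 0, 0, h4))))"
      by simp
    also have "\<dots> = L (h1, 0, 0, 0) + L (0, h2, 0, 0) + L (0, 0, h3, 0) + L (0, 0, 0, h4)"
      by (simp only: linear_add[OF lin] add.assoc)
    also have "\<dots> = wform F p (h1, h2, h3, h4)"
      unfolding wform_def p wirtinger_defs prod.case wd_def wd_bar_def
        wirtinger_derivative[OF section_has_derivative(1)[OF L]] wirtinger_derivative[OF section_has_derivative(2)[OF L]]
        wirtinger_derivative[OF section_has_derivative(3)[OF L]] wirtinger_derivative[OF section_has_derivative(4)[OF L]]
      by (subst real_linear_wirtinger[OF sec(1)], subst real_linear_wirtinger[OF sec(2)],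
          subst real_linear_wirtinger[OF sec(3)], subst real_linear_wirtinger[OF sec(4)]) simp
    finally show ?thesis .
  qed
  hence "L = wform F p" by (auto simp: fun_eq_iff)
  with L show ?thesis by (simp add: p)
qed

text \<open>Lets the chain rule be computed once, on the total derivative; the partial derivatives
  are then its coefficients.\<close>

lemma wirtinger_unique:
  fixes F :: "point \<Rightarrow> complex"
  assumes "(F has_derivative L) (at p)"
    and L: "\<And>h1 h2 h3 h4. L (h1, h2, h3, h4) =
      A1 * h1 + B1 * cnj h1 + (A2 * h2 + B2 * cnj h2) + (A3 * h3 + B3 * cnj h3) + (A4 * h4 + B4 * cnj h4)"
  shows "d_tau F p = A1" "d_tau_bar F p = B1" "d_u F p = A2" "d_v F p = A3" "d_v_bar F p = B3"
    "d_t F p = A4"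
proof -
  obtain \<tau> u v t where p: "p = (\<tau>, u, v, t)" by (cases p)
  note sec = section_has_derivative[OF assms(1)[unfolded p], unfolded L]
  show "d_tau F p = A1" "d_tau_bar F p = B1" "d_u F p = A2" "d_v F p = A3" "d_v_bar F p = B3" "d_t F p = A4"
    unfolding wirtinger_defs p prod.case
    using wd_unique[of _ A1 B1 \<tau>] wd_unique[of _ A2 B2 u] wd_unique[of _ A3 B3 v] wd_unique[of _ A4 B4 t] sec
    by simp_all
qed

lemma open_section:
  assumes "open S" "(\<tau>, u, v, t) \<in> S"
  shows "eventually (\<lambda>z. (z, u, v, t) \<in> S) (nhds \<tau>)" (is ?P1) "eventually (\<lambda>z. (\<tau>, z, v, t) \<in> S) (nhds u)" (is ?P2)
    "eventually (\<lambda>z. (\<tau>, u, z, t) \<in> S) (nhds v)" (is ?P3) "eventually (\<lambda>z. (\<tau>, u, v, z) \<in> S) (nhds t)" (is ?P4)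
proof -
  have ev: "eventually (\<lambda>p. p \<in> S) (nhds (\<tau>, u, v, t))"
    using assms by (rule eventually_nhds_in_open)
  have lim: "((\<lambda>z. (z, u, v, t)) \<longlongrightarrow> (\<tau>, u, v, t)) (nhds \<tau>)" "((\<lambda>z. (\<tau>, z, v, t)) \<longlongrightarrow> (\<tau>, u, v, t)) (nhds u)"
    "((\<lambda>z. (\<tau>, u, z, t)) \<longlongrightarrow> (\<tau>, u, v, t)) (nhds v)" "((\<lambda>z. (\<tau>, u, v, z)) \<longlongrightarrow> (\<tau>, u, v, t)) (nhds t)"
    by (intro tendsto_Pair tendsto_const filterlim_ident)+
  show ?P1 ?P2 ?P3 ?P4
    using lim[THEN filterlim_iff[THEN iffD1], rule_format, OF ev] by simp_all
qed

lemma wirtinger_cong: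
  assumes "open S" "p \<in> S" "\<And>q. q \<in> S \<Longrightarrow> X q = Y q"
  shows "d_tau X p = d_tau Y p" "d_tau_bar X p = d_tau_bar Y p" (is ?P1) "d_u X p = d_u Y p" "d_u_bar X p = d_u_bar Y p" (is ?P2)
    "d_v X p = d_v Y p" "d_v_bar X p = d_v_bar Y p" (is ?P3) "d_t X p = d_t Y p" "d_t_bar X p = d_t_bar Y p" (is ?P4)
proof -
  obtain \<tau> u v t where p: "p = (\<tau>, u, v, t)" by (cases p)
  note sec = open_section[OF assms(1) assms(2)[unfolded p]]
  have "eventually (\<lambda>z. X (z, u, v, t) = Y (z, u, v, t)) (nhds \<tau>)" "eventually (\<lambda>z. X (\<tau>, z, v, t) = Y (\<tau>, z, v, t)) (nhds u)"
    "eventually (\<lambda>z. X (\<tau>, u, z, t) = Y (\<tau>, u, z, t)) (nhds v)" "eventually (\<lambda>z. X (\<tau>, u, v, z) = Y (\<tau>, u, v, z)) (nhds t)"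
    by (rule eventually_mono[OF sec(1)] eventually_mono[OF sec(2)] eventually_mono[OF sec(3)] eventually_mono[OF sec(4)],
        erule assms(3))+
  thus "d_tau X p = d_tau Y p" ?P1 "d_u X p = d_u Y p" ?P2
    "d_v X p = d_v Y p" ?P3 "d_t X p = d_t Y p" ?P4
    unfolding wirtinger_defs p prod.case by (auto intro!: wd_cong)
qed

lemma wirtinger_real_analytic:
  assumes "F real_analytic_on S"
  shows "d_tau F real_analytic_on S" (is ?P1) "d_tau_bar F real_analytic_on S" (is ?P2) "d_u F real_analytic_on S" (is ?P3)
    "d_v F real_analytic_on S" (is ?P4) "d_v_bar F real_analytic_on S" (is ?P5)
proof -
  define P where "P b = (\<lambda>x. vector_derivative (\<lambda>h. F (x + h *\<^sub>R b)) (at 0))" for b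
  have P: "P b real_analytic_on S" if "b \<in> Basis" for b
    unfolding P_def using assms that by (rule real_analytic_on_partial)
  have eqs: "d_tau F = (\<lambda>x. (P (1, 0, 0, 0) x - \<i> * P (\<i>, 0, 0, 0) x) / 2)"
    "d_tau_bar F = (\<lambda>x. (P (1, 0, 0, 0) x + \<i> * P (\<i>, 0, 0, 0) x) / 2)"
    "d_u F = (\<lambda>x. (P (0, 1, 0, 0) x - \<i> * P (0, \<i>, 0, 0) x) / 2)"
    "d_v F = (\<lambda>x. (P (0, 0, 1, 0) x - \<i> * P (0, 0, \<i>, 0) x) / 2)"
    "d_v_bar F = (\<lambda>x. (P (0, 0, 1, 0) x + \<i> * P (0, 0, \<i>, 0) x) / 2)"
    by (auto simp: fun_eq_iff P_def wirtinger_defs wd_def wd_bar_def partial_x_def partial_y_def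
        scaleR_conv_of_real mult.commute)
  show ?P1 ?P2 ?P3 ?P4 ?P5
    unfolding eqs by (intro real_analytic_intros P; simp add: Basis_prod_def Basis_complex_def zero_prod_def)+
qed

lemma real_analytic_on_point [real_analytic_intros]:
  "(\<lambda>p::point. fst p) real_analytic_on S" "(\<lambda>p::point. fst (snd p)) real_analytic_on S"
  "(\<lambda>p::point. fst (snd (snd p))) real_analytic_on S" "(\<lambda>p::point. snd (snd (snd p))) real_analytic_on S"
  by (intro real_analytic_on_linear, simp add: linear_iff)+

section \<open>The regular set, and first consequences of (F1) and (F2)\<close>

lemma domX_iff: "p \<in> domX \<longleftrightarrow> Im (fst p) > 0"
  by (cases p) (auto simp: domX_def)

lemma open_domX: "open domX"
proof -
  have eq: "domX = {p. 0 < Im (fst p)}" by (auto simp: domX_iff)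
  show ?thesis unfolding eq by (intro open_Collect_less continuous_intros)
qed

lemma thetaprod_real_analytic: "thetaprod real_analytic_on domX"
proof -
  have eq: "thetaprod = (\<lambda>p. theta11 (fst p) (fst (snd (snd p)) - fst (snd p)) * theta11 (fst p) (fst (snd (snd p)) + fst (snd p)))"
    by (auto simp: thetaprod_def fun_eq_iff)
  show ?thesis unfolding eq by (intro real_analytic_intros) (simp_all add: domX_iff)
qed

lemma regX_subset: "regX \<subseteq> domX"
  by (auto simp: regX_def)

lemma open_regX: "open regX"
proof -
  have "regX = domX \<inter> thetaprod -` (- {0})" by (auto simp: regX_def)
  thus ?thesis
    using continuous_open_preimage[OF real_analytic_on_imp_continuous_on[OF thetaprod_real_analytic] open_domX, of "- {0}"]
    by auto
qed

lemma regX_t: "(\<tau>, u, v, t) \<in> regX \<longleftrightarrow> (\<tau>, u, v, t') \<in> regX"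
  by (simp add: regX_def domX_def thetaprod_def)

lemma F1_cong_t:
  assumes "F1 m F" "(\<tau>, u, v, t) \<in> regX"
  shows "F (\<tau>, u, v, t + x) = ex (of_real m * x) * F (\<tau>, u, v, t)"
proof -
  have "(\<tau>, u, v, t + x) \<in> regX" using assms(2) regX_t by blast
  hence "F (\<tau>, u, v, t + x) = ex (of_real m * (t + x)) * F (\<tau>, u, v, 0)"
    using assms(1) unfolding F1_def by blast
  moreover have "F (\<tau>, u, v, t) = ex (of_real m * t) * F (\<tau>, u, v, 0)"
    using assms unfolding F1_def by blast
  ultimately show ?thesis by (simp add: ex_add distrib_left)
qed

lemma F1_d_t:
  assumes "F1 m X" "p \<in> regX"
  shows "d_t X p = 2 * pi * \<i> * m * X p" (is ?P1) "d_t_bar X p = 0"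
proof -
  obtain \<tau> u v t where p: "p = (\<tau>, u, v, t)" by (cases p)
  define k where "k = X (\<tau>, u, v, 0)"
  have X: "X (\<tau>, u, v, z) = ex (of_real m * z) * k" for z
    using assms regX_t unfolding F1_def p k_def by blast
  have "((\<lambda>z. X (\<tau>, u, v, z)) has_field_derivative 2 * pi * \<i> * m * X p) (at t)"
    unfolding p X ex_def by (auto intro!: derivative_eq_intros)
  from wd_holomorphic[OF this] show ?P1 "d_t_bar X p = 0"
    by (simp_all add: d_t_def d_t_bar_def p)
qed

text \<open>(F1) passes to derivatives in the other variables, so \<open>d_t\<close> is the same
  scalar on \<open>d_tau X\<close>, \<open>d_v_bar X\<close> and so on as on
  \<open>X\<close>.\<close>

lemma F1_wirtinger:
  assumes F1: "F1 m X" and ra: "X real_analytic_on regX"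
  shows "F1 m (d_tau X)" "F1 m (d_tau_bar X)" "F1 m (d_u X)" "F1 m (d_v X)" "F1 m (d_v_bar X)"
proof -
  let ?e = "\<lambda>t. ex (of_real m * t)"
  have "d_tau X (\<tau>, u, v, t) = ?e t * d_tau X (\<tau>, u, v, 0) \<and>
    d_tau_bar X (\<tau>, u, v, t) = ?e t * d_tau_bar X (\<tau>, u, v, 0) \<and>
    d_u X (\<tau>, u, v, t) = ?e t * d_u X (\<tau>, u, v, 0) \<and>
    d_v X (\<tau>, u, v, t) = ?e t * d_v X (\<tau>, u, v, 0) \<and>
    d_v_bar X (\<tau>, u, v, t) = ?e t * d_v_bar X (\<tau>, u, v, 0)"
    if p: "(\<tau>, u, v, t) \<in> regX" for \<tau> u v t
  proof -
    have X: "X (\<tau>, u, v, t) = ?e t * X (\<tau>, u, v, 0)" if "(\<tau>, u, v, t) \<in> regX" for \<tau> u v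
      using that F1 unfolding F1_def by blast
    note ev = open_section[OF open_regX p]
    have eq: "eventually (\<lambda>z. X (z, u, v, t) = ?e t * X (z, u, v, 0)) (nhds \<tau>)"
      "eventually (\<lambda>z. X (\<tau>, z, v, t) = ?e t * X (\<tau>, z, v, 0)) (nhds u)"
      "eventually (\<lambda>z. X (\<tau>, u, z, t) = ?e t * X (\<tau>, u, z, 0)) (nhds v)"
      by (rule eventually_mono[OF ev(1)] eventually_mono[OF ev(2)] eventually_mono[OF ev(3)], erule X)+
    have "(\<tau>, u, v, 0) \<in> regX" using p regX_t by blast
    note sd = section_differentiable[OF real_analytic_on_imp_differentiable[OF ra this]]
    show ?thesis
      unfolding wirtinger_defs prod.case wd_cong[OF eq(1)] wd_cong[OF eq(2)] wd_cong[OF eq(3)]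
        wd_cmult[OF sd(1)] wd_cmult[OF sd(2)] wd_cmult[OF sd(3)] by simp
  qed
  thus "F1 m (d_tau X)" "F1 m (d_tau_bar X)" "F1 m (d_u X)" "F1 m (d_v X)" "F1 m (d_v_bar X)"
    unfolding F1_def by blast+
qed

text \<open>Once \<open>d_t\<close> is replaced by \<mu>, the equations are linear in the values of
  derivatives at one point, and their transformation becomes pure algebra.\<close>

lemma F5_iff:
  assumes F1: "F1 m X" and ra: "X real_analytic_on regX" and \<mu>: "\<mu> = 2 * pi * \<i> * m"
  shows "F5 X \<longleftrightarrow> (\<forall>p\<in>regX. 4 * \<mu> * d_tau X p + d_v (d_v X) p - d_u (d_u X) p = 0 \<and>
    4 * \<mu> * (d_tau_bar X p + coord_a p * d_v_bar X p) + d_v_bar (d_v_bar X) p = 0 \<and>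
    2 * coord_a p * \<mu> * d_v_bar X p - d_v (d_v_bar X) p = 0)"
proof -
  note F1s = F1_wirtinger[OF F1 ra]
  have "F1 m (D_tau_bar X)"
    using F1s(2,5) unfolding F1_def D_tau_bar_def by (auto simp: coord_a_def algebra_simps)
  note ts = F1_d_t(1)[OF this] F1_d_t(1)[OF F1s(1)] F1_d_t(1)[OF F1s(5)]
  have D: "D_tau_bar X p = d_tau_bar X p + coord_a p * d_v_bar X p" for p
    by (simp add: D_tau_bar_def)
  show ?thesis
    unfolding F5_def opD_def opD_bar_def opDelta_def
    by (intro ball_cong refl) (simp add: ts \<mu> D mult.assoc)
qed

lemma Fspace_real_analytic:
  assumes "F2 F" shows "F real_analytic_on regX"
proof -
  from assms obtain G where G: "\<And>p. p \<in> regX \<Longrightarrow> G p = thetaprod p * F p" "G real_analytic_on domX"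
    unfolding F2_def by blast
  show ?thesis
  proof (rule real_analytic_on_cong[OF open_regX])
    show "(\<lambda>p. G p / thetaprod p) real_analytic_on regX"
      by (intro real_analytic_intros real_analytic_on_subset[OF G(2) regX_subset]
          real_analytic_on_subset[OF thetaprod_real_analytic regX_subset]) (simp add: regX_def)
  qed (simp add: G regX_def)
qed

text \<open>Off the zeros of \<open>thetaprod\<close>, F is a quotient of two functions that are
  holomorphic in u.\<close>

lemma Fspace_d_u_bar:
  assumes "F2 F" "p \<in> regX" shows "d_u_bar F p = 0"
proof -
  obtain \<tau> u v t where p: "p = (\<tau>, u, v, t)" by (cases p)
  from assms obtain G where G: "\<And>p. p \<in> regX \<Longrightarrow> G p = thetaprod p * F p"
    "\<And>\<tau> v t. Im \<tau> > 0 \<Longrightarrow> (\<lambda>u. G (\<tau>, u, v, t)) holomorphic_on UNIV"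
    unfolding F2_def by blast
  have \<tau>: "Im \<tau> > 0" using assms(2) by (auto simp: p regX_def domX_def)
  have "eventually (\<lambda>z. F (\<tau>, z, v, t) = G (\<tau>, z, v, t) / thetaprod (\<tau>, z, v, t)) (nhds u)"
    by (rule eventually_mono[OF open_section(2)[OF open_regX assms(2)[unfolded p]]]) (simp add: G(1) regX_def)
  hence "d_u_bar F p = wd_bar (\<lambda>z. G (\<tau>, z, v, t) / thetaprod (\<tau>, z, v, t)) u"
    unfolding d_u_bar_def p prod.case by (rule wd_cong)
  moreover have "(\<lambda>z. G (\<tau>, z, v, t) / thetaprod (\<tau>, z, v, t)) field_differentiable (at u)"
  proof (intro field_differentiable_divide)
    show "(\<lambda>z. G (\<tau>, z, v, t)) field_differentiable (at u)"
      using G(2)[OF \<tau>, of v t] by (intro holomorphic_on_imp_differentiable_at[of _ UNIV]) auto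
    have "(\<lambda>z. thetaprod (\<tau>, z, v, t)) holomorphic_on UNIV"
      unfolding thetaprod_def prod.case by (intro holomorphic_intros \<tau>)
    thus "(\<lambda>z. thetaprod (\<tau>, z, v, t)) field_differentiable (at u)"
      by (intro holomorphic_on_imp_differentiable_at[of _ UNIV]) auto
    show "thetaprod (\<tau>, u, v, t) \<noteq> 0" using assms(2) by (simp add: p regX_def)
  qed
  ultimately show ?thesis
    using wd_holomorphic(2) by (auto simp: field_differentiable_def)
qed

text \<open>Stated for arbitrary complex letters because it serves twice: for the unbarred half of
  the differential and, as the matrix entry \<open>c\<close> is real, for the barred half.\<close>

lemma act_form_identity:
  fixes w :: complex
  shows "X1 * (h1 / w\<^sup>2) + X2 * (h2 / w - c * u * h1 / w\<^sup>2) + X3 * (h3 / w - c * v * h1 / w\<^sup>2)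
      + X4 * (h4 - c * (2 * u * h2 - 2 * v * h3) / w + c\<^sup>2 * (u\<^sup>2 - v\<^sup>2) * h1 / w\<^sup>2) =
    (X1 - c * u * X2 - c * v * X3 + c\<^sup>2 * (u\<^sup>2 - v\<^sup>2) * X4) / w\<^sup>2 * h1 + (X2 - 2 * c * u * X4) / w * h2
      + (X3 + 2 * c * v * X4) / w * h3 + X4 * h4"
  unfolding divide_inverse by algebra

section \<open>The action on points and its Jacobian\<close>

locale unimodular =
  fixes \<gamma> :: "real^2^2"
  assumes det: "det \<gamma> = 1"
begin

abbreviation a :: complex where "a \<equiv> of_real (\<gamma> $ 1 $ 1)"
abbreviation b :: complex where "b \<equiv> of_real (\<gamma> $ 1 $ 2)"
abbreviation c :: complex where "c \<equiv> of_real (\<gamma> $ 2 $ 1)"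
abbreviation d :: complex where "d \<equiv> of_real (\<gamma> $ 2 $ 2)"

definition aut :: "complex \<Rightarrow> complex" where "aut \<tau> = c * \<tau> + d"

definition act :: "point \<Rightarrow> point" where
  "act = (\<lambda>(\<tau>, u, v, t). ((a * \<tau> + b) / aut \<tau>, u / aut \<tau>, v / aut \<tau>, t - c * (u\<^sup>2 - v\<^sup>2) / aut \<tau>))"

lemma slash_eq: "slash F \<gamma> p = inverse (aut (fst p)) * F (act p)"
  by (cases p) (simp add: slash_def act_def aut_def Let_def)

lemma det': "a * d - b * c = 1"
proof -
  have "\<gamma> $ 1 $ 1 * \<gamma> $ 2 $ 2 - \<gamma> $ 1 $ 2 * \<gamma> $ 2 $ 1 = 1"
    using det by (simp add: det_2)
  from arg_cong[OF this, of complex_of_real] show ?thesis by simp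
qed

lemma aut_nonzero: "Im \<tau> > 0 \<Longrightarrow> aut \<tau> \<noteq> 0"
proof
  assume "Im \<tau> > 0" and 0: "aut \<tau> = 0"
  hence "\<gamma> $ 2 $ 1 * Im \<tau> = 0" by (simp add: aut_def complex_eq_iff)
  with \<open>Im \<tau> > 0\<close> have "c = 0" by simp
  with 0 have "d = 0" by (simp add: aut_def)
  with \<open>c = 0\<close> det' show False by simp
qed

lemma Im_moebius:
  assumes "Im \<tau> > 0"
  shows "Im ((a * \<tau> + b) / aut \<tau>) = Im \<tau> / (norm (aut \<tau>))\<^sup>2"
proof -
  have "Im ((a * \<tau> + b) * cnj (aut \<tau>)) = (\<gamma> $ 1 $ 1 * \<gamma> $ 2 $ 2 - \<gamma> $ 1 $ 2 * \<gamma> $ 2 $ 1) * Im \<tau>"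
    by (simp add: aut_def algebra_simps)
  also have "\<dots> = Im \<tau>" using det by (simp add: det_2)
  finally have "Im ((a * \<tau> + b) * cnj (aut \<tau>)) = Im \<tau>" .
  thus ?thesis by (simp only: complex_div_cnj[of "a * \<tau> + b"] Im_divide_of_real of_real_power[symmetric])
qed

lemma act_domX: "p \<in> domX \<Longrightarrow> act p \<in> domX"
  using aut_nonzero Im_moebius by (cases p) (auto simp: domX_iff act_def)

text \<open>Both imaginary parts carry the denominator \<open>(norm (aut \<tau>))\<^sup>2\<close>.
  It cancels and leaves \<open>Im (v * cnj (aut \<tau>)) / Im \<tau>\<close>.\<close>

lemma coord_a_act:
  assumes "(\<tau>, u, v, t) \<in> domX"
  shows "coord_a (act (\<tau>, u, v, t)) = coord_a (\<tau>, u, v, t) * aut \<tau> - c * v"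
proof -
  have \<tau>: "Im \<tau> > 0" using assms by (simp add: domX_iff)
  have n: "norm (aut \<tau>) \<noteq> 0" using aut_nonzero[OF \<tau>] by simp
  have "Im (v / aut \<tau>) = Im (v * cnj (aut \<tau>)) / (norm (aut \<tau>))\<^sup>2"
    by (simp only: complex_div_cnj[of v] Im_divide_of_real of_real_power[symmetric])
  hence "Im (v / aut \<tau>) / Im ((a * \<tau> + b) / aut \<tau>) = Im (v * cnj (aut \<tau>)) / Im \<tau>"
    unfolding Im_moebius[OF \<tau>] using n by simp
  hence "coord_a (act (\<tau>, u, v, t)) = of_real (Im (v * cnj (aut \<tau>)) / Im \<tau>)"
    by (simp only: coord_a_def act_def prod.case)
  also have "\<dots> = coord_a (\<tau>, u, v, t) * aut \<tau> - c * v"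
    using \<tau> by (simp add: coord_a_def complex_eq_iff aut_def field_simps)
  finally show ?thesis .
qed

text \<open>The Jacobian of \<open>act\<close>. The determinant enters through the first component,
  where it reduces the derivative of the Moebius map to
  \<open>1 / (aut \<tau>)\<^sup>2\<close>.\<close>

definition act' :: "point \<Rightarrow> point \<Rightarrow> point" where
  "act' = (\<lambda>(\<tau>, u, v, t) (h1, h2, h3, h4). (h1 / (aut \<tau>)\<^sup>2, h2 / aut \<tau> - c * u * h1 / (aut \<tau>)\<^sup>2,
     h3 / aut \<tau> - c * v * h1 / (aut \<tau>)\<^sup>2,
     h4 - c * (2 * u * h2 - 2 * v * h3) / aut \<tau> + c\<^sup>2 * (u\<^sup>2 - v\<^sup>2) * h1 / (aut \<tau>)\<^sup>2))"

lemma act_has_derivative: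
  assumes "p \<in> domX"
  shows "(act has_derivative act' p) (at p)"
proof -
  obtain \<tau> u v t where p: "p = (\<tau>, u, v, t)" by (cases p)
  let ?w = "c * \<tau> + d"
  let ?P = "at (\<tau>, u, v, t)"
  have w: "?w \<noteq> 0" using aut_nonzero[of \<tau>] assms by (simp add: p domX_iff aut_def)
  have act: "act = (\<lambda>p. ((a * fst p + b) / (c * fst p + d), fst (snd p) / (c * fst p + d), fst (snd (snd p)) / (c * fst p + d),
    snd (snd (snd p)) - c * ((fst (snd p))\<^sup>2 - (fst (snd (snd p)))\<^sup>2) / (c * fst p + d)))"
    by (auto simp: act_def aut_def fun_eq_iff)
  have act': "act' p = (\<lambda>h. (fst h / ?w\<^sup>2, fst (snd h) / ?w - c * u * fst h / ?w\<^sup>2,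
     fst (snd (snd h)) / ?w - c * v * fst h / ?w\<^sup>2,
     snd (snd (snd h)) - c * (2 * u * fst (snd h) - 2 * v * fst (snd (snd h))) / ?w
       + c\<^sup>2 * (u\<^sup>2 - v\<^sup>2) * fst h / ?w\<^sup>2))"
    by (auto simp: act'_def aut_def fun_eq_iff p)
  have lin: "((\<lambda>p. c * fst p + d) has_derivative (\<lambda>h. c * fst h)) ?P"
    by (auto intro!: derivative_eq_intros)
  have div: "((\<lambda>p. f p / (c * fst p + d)) has_derivative
      (\<lambda>h. f' h / ?w - c * f (\<tau>, u, v, t) * fst h / ?w\<^sup>2)) ?P"
    if "(f has_derivative f') ?P" for f f' :: "point \<Rightarrow> complex"
  proof -
    have "(x * W - y * (c * z)) / (W * W) = x / W - c * y * z / W\<^sup>2" if "W \<noteq> 0" for x y z W :: complex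
      using that by (simp add: field_simps power2_eq_square)
    with has_derivative_divide'[OF that lin] w show ?thesis by simp
  qed
  have "((\<lambda>p. a * fst p + b) has_derivative (\<lambda>h. a * fst h)) ?P"
    by (auto intro!: derivative_eq_intros)
  from div[OF this] have 1: "((\<lambda>p. (a * fst p + b) / (c * fst p + d)) has_derivative (\<lambda>h. fst h / ?w\<^sup>2)) ?P"
  proof (rule has_derivative_eq_rhs, intro ext)
    fix h :: point
    have "a * fst h / ?w - c * (a * fst (\<tau>, u, v, t) + b) * fst h / ?w\<^sup>2
      = (a * ?w - c * (a * \<tau> + b)) * fst h / ?w\<^sup>2"
    proof -
      have "a * x / W - c * N * x / W\<^sup>2 = (a * W - c * N) * x / W\<^sup>2" if "W \<noteq> 0" for x N W :: complex
        using that by (simp add: field_simps power2_eq_square)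
      with w show ?thesis by simp
    qed
    also have "a * ?w - c * (a * \<tau> + b) = 1"
      using det' by (simp add: algebra_simps)
    finally show "a * fst h / ?w - c * (a * fst (\<tau>, u, v, t) + b) * fst h / ?w\<^sup>2 = fst h / ?w\<^sup>2"
      by simp
  qed
  have "((\<lambda>p. fst (snd p)) has_derivative (\<lambda>h. fst (snd h))) ?P"
    by (auto intro!: derivative_eq_intros)
  from div[OF this] have 2: "((\<lambda>p. fst (snd p) / (c * fst p + d)) has_derivative
      (\<lambda>h. fst (snd h) / ?w - c * u * fst h / ?w\<^sup>2)) ?P" by simp
  have "((\<lambda>p. fst (snd (snd p))) has_derivative (\<lambda>h. fst (snd (snd h)))) ?P"
    by (auto intro!: derivative_eq_intros)
  from div[OF this] have 3: "((\<lambda>p. fst (snd (snd p)) / (c * fst p + d)) has_derivative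
      (\<lambda>h. fst (snd (snd h)) / ?w - c * v * fst h / ?w\<^sup>2)) ?P" by simp
  have "((\<lambda>p. c * ((fst (snd p))\<^sup>2 - (fst (snd (snd p)))\<^sup>2)) has_derivative
      (\<lambda>h. c * (2 * u * fst (snd h) - 2 * v * fst (snd (snd h))))) ?P"
    by (auto intro!: derivative_eq_intros)
  from div[OF this] have 4: "((\<lambda>p. c * ((fst (snd p))\<^sup>2 - (fst (snd (snd p)))\<^sup>2) / (c * fst p + d)) has_derivative
      (\<lambda>h. c * (2 * u * fst (snd h) - 2 * v * fst (snd (snd h))) / ?w - c * (c * (u\<^sup>2 - v\<^sup>2)) * fst h / ?w\<^sup>2)) ?P"
    by simp
  have "((\<lambda>p. snd (snd (snd p))) has_derivative (\<lambda>h. snd (snd (snd h)))) ?P"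
    by (auto intro!: derivative_eq_intros)
  from has_derivative_diff[OF this 4]
  have 5: "((\<lambda>p. snd (snd (snd p)) - c * ((fst (snd p))\<^sup>2 - (fst (snd (snd p)))\<^sup>2) / (c * fst p + d)) has_derivative
      (\<lambda>h. snd (snd (snd h)) - c * (2 * u * fst (snd h) - 2 * v * fst (snd (snd h))) / ?w
       + c\<^sup>2 * (u\<^sup>2 - v\<^sup>2) * fst h / ?w\<^sup>2)) ?P"
    by (rule has_derivative_eq_rhs) (simp add: fun_eq_iff power2_eq_square mult_ac)
  show ?thesis
    unfolding act' unfolding act p by (intro has_derivative_Pair 1 2 3 5)
qed

text \<open>The differential of the composite is sorted by increments and their conjugates. Since
  \<open>act\<close> is holomorphic, barred derivatives mix with barred ones only.\<close>

lemma wirtinger_act: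
  assumes p: "(\<tau>, u, v, t) \<in> domX" and X: "X differentiable (at (act (\<tau>, u, v, t)))"
  defines "q \<equiv> act (\<tau>, u, v, t)" and "w \<equiv> aut \<tau>"
  shows "d_tau (\<lambda>p. X (act p)) (\<tau>, u, v, t) =
      (d_tau X q - c * u * d_u X q - c * v * d_v X q + c\<^sup>2 * (u\<^sup>2 - v\<^sup>2) * d_t X q) / w\<^sup>2" (is ?P1)
    "d_tau_bar (\<lambda>p. X (act p)) (\<tau>, u, v, t) =
      (d_tau_bar X q - c * cnj u * d_u_bar X q - c * cnj v * d_v_bar X q + c\<^sup>2 * cnj (u\<^sup>2 - v\<^sup>2) * d_t_bar X q) / (cnj w)\<^sup>2" (is ?P2)
    "d_u (\<lambda>p. X (act p)) (\<tau>, u, v, t) = (d_u X q - 2 * c * u * d_t X q) / w" (is ?P3)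
    "d_v (\<lambda>p. X (act p)) (\<tau>, u, v, t) = (d_v X q + 2 * c * v * d_t X q) / w" (is ?P4)
    "d_v_bar (\<lambda>p. X (act p)) (\<tau>, u, v, t) = (d_v_bar X q + 2 * c * cnj v * d_t_bar X q) / cnj w" (is ?P5)
    "(\<lambda>p. X (act p)) differentiable (at (\<tau>, u, v, t))" (is ?P6)
proof -
  let ?p = "(\<tau>, u, v, t)"
  have w: "w \<noteq> 0" unfolding w_def using p by (intro aut_nonzero) (simp add: domX_iff)
  have der: "((\<lambda>p. X (act p)) has_derivative (\<lambda>h. wform X q (act' ?p h))) (at ?p)"
    using diff_chain_at[OF act_has_derivative[OF p] wform_has_derivative[OF X]] by (simp add: o_def q_def)
  thus ?P6 by (auto simp: differentiable_def)
  have form: "wform X q (act' ?p (h1, h2, h3, h4)) =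
    (d_tau X q - c * u * d_u X q - c * v * d_v X q + c\<^sup>2 * (u\<^sup>2 - v\<^sup>2) * d_t X q) / w\<^sup>2 * h1 +
    (d_tau_bar X q - c * cnj u * d_u_bar X q - c * cnj v * d_v_bar X q + c\<^sup>2 * cnj (u\<^sup>2 - v\<^sup>2) * d_t_bar X q) / (cnj w)\<^sup>2 * cnj h1 +
    ((d_u X q - 2 * c * u * d_t X q) / w * h2 + (d_u_bar X q - 2 * c * cnj u * d_t_bar X q) / cnj w * cnj h2) +
    ((d_v X q + 2 * c * v * d_t X q) / w * h3 + (d_v_bar X q + 2 * c * cnj v * d_t_bar X q) / cnj w * cnj h3) +
    (d_t X q * h4 + d_t_bar X q * cnj h4)" for h1 h2 h3 h4
  proof -
    have "wform X q (act' ?p (h1, h2, h3, h4)) =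
      (d_tau X q * (h1 / w\<^sup>2) + d_u X q * (h2 / w - c * u * h1 / w\<^sup>2) + d_v X q * (h3 / w - c * v * h1 / w\<^sup>2)
        + d_t X q * (h4 - c * (2 * u * h2 - 2 * v * h3) / w + c\<^sup>2 * (u\<^sup>2 - v\<^sup>2) * h1 / w\<^sup>2)) +
      (d_tau_bar X q * (cnj h1 / (cnj w)\<^sup>2) + d_u_bar X q * (cnj h2 / cnj w - c * cnj u * cnj h1 / (cnj w)\<^sup>2)
        + d_v_bar X q * (cnj h3 / cnj w - c * cnj v * cnj h1 / (cnj w)\<^sup>2)
        + d_t_bar X q * (cnj h4 - c * (2 * cnj u * cnj h2 - 2 * cnj v * cnj h3) / cnj w
           + c\<^sup>2 * ((cnj u)\<^sup>2 - (cnj v)\<^sup>2) * cnj h1 / (cnj w)\<^sup>2))"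
      unfolding wform_def act'_def prod.case w_def[symmetric] complex_cnj_add complex_cnj_diff complex_cnj_mult
        complex_cnj_divide complex_cnj_power complex_cnj_complex_of_real complex_cnj_numeral
      by (simp only: add_ac)
    thus ?thesis
      unfolding act_form_identity complex_cnj_diff complex_cnj_power by (simp only: add_ac)
  qed
  note * = wirtinger_unique[OF der form]
  show ?P1 ?P2 ?P3 ?P4 ?P5
    by (rule *)+
qed

end

section \<open>Invariance under a general unimodular matrix\<close>

lemma wirtinger_at:
  "d_tau X (\<tau>, u, v, t) = wd (\<lambda>z. X (z, u, v, t)) \<tau>" "d_tau_bar X (\<tau>, u, v, t) = wd_bar (\<lambda>z. X (z, u, v, t)) \<tau>"
  "d_u X (\<tau>, u, v, t) = wd (\<lambda>z. X (\<tau>, z, v, t)) u" "d_v X (\<tau>, u, v, t) = wd (\<lambda>z. X (\<tau>, u, z, t)) v"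
  "d_v_bar X (\<tau>, u, v, t) = wd_bar (\<lambda>z. X (\<tau>, u, z, t)) v"
  by (simp_all add: wirtinger_defs)

context unimodular
begin

lemma aut_real_analytic [real_analytic_intros]: "(\<lambda>p. aut (fst p)) real_analytic_on (S :: point set)"
  unfolding aut_def by (intro real_analytic_intros)

lemma aut_fst_nonzero: "p \<in> domX \<Longrightarrow> aut (fst p) \<noteq> 0"
  by (simp add: aut_nonzero domX_iff)

lemma act_eq: "act p = ((a * fst p + b) / aut (fst p), fst (snd p) / aut (fst p), fst (snd (snd p)) / aut (fst p),
    snd (snd (snd p)) - c * ((fst (snd p))\<^sup>2 - (fst (snd (snd p)))\<^sup>2) / aut (fst p))"
  by (cases p) (simp add: act_def)

lemma real_analytic_on_act:
  fixes X :: "point \<Rightarrow> complex"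
  assumes "X real_analytic_on T" "S \<subseteq> domX" "\<And>p. p \<in> S \<Longrightarrow> act p \<in> T"
  shows "(\<lambda>p. X (act p)) real_analytic_on S"
  unfolding act_eq
proof (rule real_analytic_on_compose_point[OF assms(1)])
  have "aut (fst p) \<noteq> 0" if "p \<in> S" for p using that assms(2) aut_fst_nonzero by blast
  thus "(\<lambda>p. (a * fst p + b) / aut (fst p)) real_analytic_on S" "(\<lambda>p. fst (snd p) / aut (fst p)) real_analytic_on S"
    "(\<lambda>p. fst (snd (snd p)) / aut (fst p)) real_analytic_on S"
    "(\<lambda>p. snd (snd (snd p)) - c * ((fst (snd p))\<^sup>2 - (fst (snd (snd p)))\<^sup>2) / aut (fst p)) real_analytic_on S"
    by (intro real_analytic_intros; assumption)+
qed (use assms(3) act_eq in auto)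

end

text \<open>\<open>K\<close> is the automorphy factor of \<open>thetaprod\<close>. Its being nonzero
  makes \<open>regX\<close> invariant; its regularity is what the extension in (F2) needs, since
  that extension is divided by \<open>K\<close>.\<close>

locale theta_automorphy = unimodular +
  fixes K :: "point \<Rightarrow> complex"
  assumes thetaprod_act: "p \<in> domX \<Longrightarrow> thetaprod (act p) = K p * thetaprod p"
    and K_nonzero: "p \<in> domX \<Longrightarrow> K p \<noteq> 0"
    and K_real_analytic: "K real_analytic_on domX"
    and K_holomorphic: "Im \<tau> > 0 \<Longrightarrow> (\<lambda>u. K (\<tau>, u, v, t)) holomorphic_on UNIV"
begin

lemma act_regX: "p \<in> domX \<Longrightarrow> act p \<in> regX \<longleftrightarrow> p \<in> regX"
  using act_domX thetaprod_act K_nonzero by (auto simp: regX_def)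

lemma slash_F1:
  assumes "F1 m F" shows "F1 m (slash F \<gamma>)"
  unfolding F1_def
proof (intro allI impI)
  fix \<tau> u v t assume p: "(\<tau>, u, v, t) \<in> regX"
  hence "(\<tau>, u, v, 0) \<in> regX" using regX_t by blast
  hence "act (\<tau>, u, v, 0) \<in> regX" using act_regX regX_subset by blast
  from F1_cong_t[OF assms this[unfolded act_def prod.case], of t]
  show "slash F \<gamma> (\<tau>, u, v, t) = ex (of_real m * t) * slash F \<gamma> (\<tau>, u, v, 0)"
    by (simp add: slash_eq act_def algebra_simps)
qed

context
  fixes m :: real and F \<mu>
  assumes F1: "F1 m F" and F2: "F2 F" and \<mu>: "\<mu> = 2 * pi * \<i> * m"
begin

abbreviation \<phi> :: "point \<Rightarrow> complex" where "\<phi> \<equiv> slash F \<gamma>"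

lemma F_real_analytic: "F real_analytic_on regX"
  using F2 by (rule Fspace_real_analytic)

lemma slash_real_analytic: "\<phi> real_analytic_on regX"
proof -
  have eq: "\<phi> = (\<lambda>p. inverse (aut (fst p)) * F (act p))"
    by (rule ext) (rule slash_eq)
  show ?thesis unfolding eq
    using regX_subset act_regX aut_fst_nonzero
    by (intro real_analytic_intros real_analytic_on_act[OF F_real_analytic]) auto
qed

text \<open>Written with the inverses \<open>r\<close> and \<open>s\<close>, so that later
  identities are polynomial. Only \<open>d_tau\<close> sees the derivative of the weight
  \<open>inverse (aut \<tau>)\<close>, which is holomorphic and depends on \<tau> alone.\<close>

lemma slash_first_order:
  assumes p: "(\<tau>, u, v, t) \<in> regX"
  defines "q \<equiv> act (\<tau>, u, v, t)" and "r \<equiv> inverse (aut \<tau>)" and "s \<equiv> inverse (cnj (aut \<tau>))"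
  shows "d_tau \<phi> (\<tau>, u, v, t) = - c * r\<^sup>2 * F q
      + r ^ 3 * (d_tau F q - c * u * d_u F q - c * v * d_v F q + c\<^sup>2 * (u\<^sup>2 - v\<^sup>2) * (\<mu> * F q))" (is ?P1)
    "d_tau_bar \<phi> (\<tau>, u, v, t) = r * s\<^sup>2 * (d_tau_bar F q - c * cnj v * d_v_bar F q)" (is ?P2)
    "d_u \<phi> (\<tau>, u, v, t) = r\<^sup>2 * (d_u F q - 2 * c * \<mu> * (u * F q))" (is ?P3)
    "d_v \<phi> (\<tau>, u, v, t) = r\<^sup>2 * (d_v F q + 2 * c * \<mu> * (v * F q))" (is ?P4)
    "d_v_bar \<phi> (\<tau>, u, v, t) = r * s * d_v_bar F q" (is ?P5)
proof -
  let ?p = "(\<tau>, u, v, t)"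
  have dom: "?p \<in> domX" using p regX_subset by blast
  have q: "q \<in> regX" unfolding q_def using act_regX dom p by blast
  have w: "aut \<tau> \<noteq> 0" using aut_fst_nonzero[OF dom] by simp
  have sl: "\<phi> (x, y, z, t) = inverse (aut x) * F (act (x, y, z, t))" for x y z t
    by (simp add: slash_eq)
  note wa = wirtinger_act[OF dom real_analytic_on_imp_differentiable[OF F_real_analytic q[unfolded q_def]], folded q_def]
  note sd = section_differentiable[OF wa(6)]
  have inv: "((\<lambda>z. inverse (aut z)) has_field_derivative - c * r\<^sup>2) (at \<tau>)"
    unfolding r_def aut_def using w by (auto intro!: derivative_eq_intros simp: aut_def power2_eq_square)
  have simps: "d_t F q = \<mu> * F q" "d_t_bar F q = 0" "d_u_bar F q = 0"
    using F1_d_t[OF F1 q] Fspace_d_u_bar[OF F2 q] by (simp_all add: \<mu>)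
  show ?P1
    using wd_mult_holomorphic(1)[OF inv sd(1)] wa(1) w
    by (simp add: wirtinger_at sl simps q_def[symmetric] r_def divide_inverse power2_eq_square power3_eq_cube mult_ac)
  show ?P2
    using wd_mult_holomorphic(2)[OF inv sd(1)] wa(2) w
    by (simp add: wirtinger_at sl simps q_def[symmetric] r_def s_def divide_inverse mult_ac power_inverse)
  show ?P3
    using wd_cmult(1)[OF sd(2), of "inverse (aut \<tau>)"] wa(3) w
    by (simp add: wirtinger_at sl simps q_def[symmetric] r_def divide_inverse power2_eq_square mult_ac)
  show ?P4
    using wd_cmult(1)[OF sd(3), of "inverse (aut \<tau>)"] wa(4) w
    by (simp add: wirtinger_at sl simps q_def[symmetric] r_def divide_inverse power2_eq_square mult_ac)
  show ?P5
    using wd_cmult(2)[OF sd(3), of "inverse (aut \<tau>)"] wa(5) w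
    by (simp add: wirtinger_at sl simps q_def[symmetric] r_def s_def divide_inverse mult_ac)
qed

text \<open>The first order formulas hold on the open set \<open>regX\<close> and may be
  differentiated again. As \<open>aut\<close> does not depend on u and v, the product rule concerns
  only the explicit factors u and v.\<close>

lemma slash_second_order:
  assumes p: "(\<tau>, u, v, t) \<in> regX"
  defines "q \<equiv> act (\<tau>, u, v, t)" and "r \<equiv> inverse (aut \<tau>)" and "s \<equiv> inverse (cnj (aut \<tau>))"
  shows "d_u (d_u \<phi>) (\<tau>, u, v, t) = r\<^sup>2 * (r * (d_u (d_u F) q - 2 * c * u * (\<mu> * d_u F q))
      - 2 * c * \<mu> * (F q + u * (r * (d_u F q - 2 * c * u * (\<mu> * F q)))))" (is ?P1)
    "d_v (d_v \<phi>) (\<tau>, u, v, t) = r\<^sup>2 * (r * (d_v (d_v F) q + 2 * c * v * (\<mu> * d_v F q))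
      + 2 * c * \<mu> * (F q + v * (r * (d_v F q + 2 * c * v * (\<mu> * F q)))))" (is ?P2)
    "d_v_bar (d_v_bar \<phi>) (\<tau>, u, v, t) = r * s\<^sup>2 * d_v_bar (d_v_bar F) q" (is ?P3)
    "d_v (d_v_bar \<phi>) (\<tau>, u, v, t) = r * s * (r * (d_v (d_v_bar F) q + 2 * c * v * (\<mu> * d_v_bar F q)))" (is ?P4)
proof -
  let ?p = "(\<tau>, u, v, t)"
  have dom: "?p \<in> domX" using p regX_subset by blast
  have q: "q \<in> regX" unfolding q_def using act_regX dom p by blast
  note ras = wirtinger_real_analytic[OF F_real_analytic]
  note F1s = F1_wirtinger[OF F1 F_real_analytic]
  have diff: "X differentiable (at (act ?p))" if "X real_analytic_on regX" for X :: "point \<Rightarrow> complex"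
    using real_analytic_on_imp_differentiable[OF that q] by (simp add: q_def)
  note wF = wirtinger_act[OF dom diff[OF F_real_analytic], folded q_def]
  note wu = wirtinger_act[OF dom diff[OF ras(3)], folded q_def]
  note wv = wirtinger_act[OF dom diff[OF ras(4)], folded q_def]
  note wvb = wirtinger_act[OF dom diff[OF ras(5)], folded q_def]
  note sF = section_differentiable[OF wF(6)]
  note su = section_differentiable[OF wu(6)]
  note sv = section_differentiable[OF wv(6)]
  note svb = section_differentiable[OF wvb(6)]
  have dt: "d_t F q = \<mu> * F q" "d_t (d_u F) q = \<mu> * d_u F q" "d_t (d_v F) q = \<mu> * d_v F q"
    "d_t (d_v_bar F) q = \<mu> * d_v_bar F q" "d_t_bar (d_v_bar F) q = 0"
    using F1_d_t[OF F1 q] F1_d_t[OF F1s(3) q] F1_d_t[OF F1s(4) q] F1_d_t[OF F1s(5) q] by (simp_all add: \<mu>)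
  let ?r = "\<lambda>p. inverse (aut (fst p))" and ?s = "\<lambda>p. inverse (cnj (aut (fst p)))"
  note cong = wirtinger_cong[OF open_regX p]
  have "d_u (d_u \<phi>) ?p =
    d_u (\<lambda>p. (?r p)\<^sup>2 * (d_u F (act p) + (- 2 * c * \<mu>) * (fst (snd p) * F (act p)))) ?p"
    by (rule cong) (auto simp: slash_first_order)
  also have "\<dots> = r\<^sup>2 * (d_u (\<lambda>p. d_u F (act p)) ?p
      + (- 2 * c * \<mu>) * (F q + u * d_u (\<lambda>p. F (act p)) ?p))"
  proof -
    have 1: "(\<lambda>z. z * F (act (\<tau>, z, v, t))) differentiable (at u)"
      by (intro differentiable_mult sF(2)) auto
    have 2: "(\<lambda>z. (- 2 * c * \<mu>) * (z * F (act (\<tau>, z, v, t)))) differentiable (at u)"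
      by (rule differentiable_mult[OF differentiable_const 1])
    show ?thesis
      unfolding d_u_def[of "\<lambda>p. (?r p)\<^sup>2 * _ p"] prod.case fst_conv snd_conv
        wd_cmult(1)[OF differentiable_add[OF su(2) 2]] wd_add[OF su(2) 2] wd_cmult(1)[OF 1]
        wd_mult_holomorphic(1)[OF DERIV_ident sF(2)]
      by (simp add: d_u_def[of "\<lambda>p. _ (act p)"] r_def q_def)
  qed
  also have "\<dots> = r\<^sup>2 * (r * (d_u (d_u F) q - 2 * c * u * (\<mu> * d_u F q))
      - 2 * c * \<mu> * (F q + u * (r * (d_u F q - 2 * c * u * (\<mu> * F q)))))"
    unfolding wu(3) wF(3) dt r_def divide_inverse by algebra
  finally show ?P1 .
  have "d_v (d_v \<phi>) ?p =
    d_v (\<lambda>p. (?r p)\<^sup>2 * (d_v F (act p) + (2 * c * \<mu>) * (fst (snd (snd p)) * F (act p)))) ?p"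
    by (rule cong) (auto simp: slash_first_order)
  also have "\<dots> = r\<^sup>2 * (d_v (\<lambda>p. d_v F (act p)) ?p
      + (2 * c * \<mu>) * (F q + v * d_v (\<lambda>p. F (act p)) ?p))"
  proof -
    have 1: "(\<lambda>z. z * F (act (\<tau>, u, z, t))) differentiable (at v)"
      by (intro differentiable_mult sF(3)) auto
    have 2: "(\<lambda>z. (2 * c * \<mu>) * (z * F (act (\<tau>, u, z, t)))) differentiable (at v)"
      by (rule differentiable_mult[OF differentiable_const 1])
    show ?thesis
      unfolding d_v_def[of "\<lambda>p. (?r p)\<^sup>2 * _ p"] prod.case fst_conv snd_conv
        wd_cmult(1)[OF differentiable_add[OF sv(3) 2]] wd_add[OF sv(3) 2] wd_cmult(1)[OF 1]
        wd_mult_holomorphic(1)[OF DERIV_ident sF(3)]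
      by (simp add: d_v_def[of "\<lambda>p. _ (act p)"] r_def q_def)
  qed
  also have "\<dots> = r\<^sup>2 * (r * (d_v (d_v F) q + 2 * c * v * (\<mu> * d_v F q))
      + 2 * c * \<mu> * (F q + v * (r * (d_v F q + 2 * c * v * (\<mu> * F q)))))"
    unfolding wv(4) wF(4) dt r_def divide_inverse by algebra
  finally show ?P2 .
  have "d_v_bar (d_v_bar \<phi>) ?p = d_v_bar (\<lambda>p. ?r p * ?s p * d_v_bar F (act p)) ?p"
    by (rule cong) (auto simp: slash_first_order)
  also have "\<dots> = r * s * d_v_bar (\<lambda>p. d_v_bar F (act p)) ?p"
    using wd_cmult(2)[OF svb(3), of "r * s"] by (simp add: d_v_bar_def[of "\<lambda>p. _ p * d_v_bar F (act p)"] d_v_bar_def[of "\<lambda>p. d_v_bar F (act p)"] r_def s_def)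
  also have "\<dots> = r * s\<^sup>2 * d_v_bar (d_v_bar F) q"
    unfolding wvb(5) dt s_def divide_inverse by algebra
  finally show ?P3 .
  have "d_v (d_v_bar \<phi>) ?p = d_v (\<lambda>p. ?r p * ?s p * d_v_bar F (act p)) ?p"
    by (rule cong) (auto simp: slash_first_order)
  also have "\<dots> = r * s * d_v (\<lambda>p. d_v_bar F (act p)) ?p"
    using wd_cmult(1)[OF svb(3), of "r * s"] by (simp add: d_v_def[of "\<lambda>p. _ p * d_v_bar F (act p)"] d_v_def[of "\<lambda>p. d_v_bar F (act p)"] r_def s_def)
  also have "\<dots> = r * s * (r * (d_v (d_v_bar F) q + 2 * c * v * (\<mu> * d_v_bar F q)))"
    unfolding wvb(4) dt r_def divide_inverse by algebra
  finally show ?P4 .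
qed

lemma slash_F5:
  assumes F5: "F5 F" shows "F5 \<phi>"
  unfolding F5_iff[OF slash_F1[OF F1] slash_real_analytic \<mu>]
proof
  fix p assume p: "p \<in> regX"
  obtain \<tau> u v t where pe: "p = (\<tau>, u, v, t)" by (cases p)
  have dom: "(\<tau>, u, v, t) \<in> domX" using p pe regX_subset by blast
  define q where "q = act (\<tau>, u, v, t)"
  define r where "r = inverse (aut \<tau>)"
  define s where "s = inverse (cnj (aut \<tau>))"
  have w: "aut \<tau> \<noteq> 0" using aut_fst_nonzero[OF dom] by simp
  hence rs: "r * aut \<tau> = 1" "s * cnj (aut \<tau>) = 1" by (simp_all add: r_def s_def)
  have q: "q \<in> regX" unfolding q_def using act_regX dom p pe by blast
  from F5 q have eqs: "4 * \<mu> * d_tau F q + d_v (d_v F) q - d_u (d_u F) q = 0"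
    "4 * \<mu> * (d_tau_bar F q + coord_a q * d_v_bar F q) + d_v_bar (d_v_bar F) q = 0"
    "2 * coord_a q * \<mu> * d_v_bar F q - d_v (d_v_bar F) q = 0"
    unfolding F5_iff[OF F1 F_real_analytic \<mu>] by blast+
  have ca: "coord_a q = coord_a p * aut \<tau> - c * v"
    using coord_a_act[OF dom] by (simp add: q_def pe)
  \<comment> \<open>As \<open>coord_a\<close> is real, conjugating its transformation law gives a
    second one in terms of \<open>cnj (aut \<tau>)\<close>, the form that the barred operator
    needs.\<close>
  have "cnj (coord_a q) = cnj (coord_a p * aut \<tau> - c * v)"
    by (simp only: ca)
  moreover have real: "cnj (coord_a x) = coord_a x" for x
    by (cases x) (simp add: coord_a_def)
  ultimately have cb: "coord_a q = coord_a p * cnj (aut \<tau>) - c * cnj v" by (simp add: real)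
  note f = slash_first_order[OF p[unfolded pe], folded pe, folded q_def[folded pe] r_def s_def]
    slash_second_order[OF p[unfolded pe], folded pe, folded q_def[folded pe] r_def s_def]
  show "4 * \<mu> * d_tau \<phi> p + d_v (d_v \<phi>) p - d_u (d_u \<phi>) p = 0 \<and>
    4 * \<mu> * (d_tau_bar \<phi> p + coord_a p * d_v_bar \<phi> p) + d_v_bar (d_v_bar \<phi>) p = 0 \<and>
    2 * coord_a p * \<mu> * d_v_bar \<phi> p - d_v (d_v_bar \<phi>) p = 0" (is "?A = 0 \<and> ?B = 0 \<and> ?C = 0")
  proof (intro conjI)
    \<comment> \<open>Differentiating the weight contributes
      \<open>- 4 * \<mu> * c * r\<^sup>2 * F q\<close>, and the product rule contributes
      \<open>2 * \<mu> * c * r\<^sup>2 * F q\<close> once from v and once from u. The three cancel,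
      which is what fixes the exponent -1 of the weight.\<close>
    have "?A
      = r ^ 3 * (4 * \<mu> * d_tau F q + d_v (d_v F) q - d_u (d_u F) q)"
      unfolding f by algebra
    thus "?A = 0"
      unfolding eqs by simp
    have "?B
      = r * s\<^sup>2 * (4 * \<mu> * (d_tau_bar F q + coord_a q * d_v_bar F q) + d_v_bar (d_v_bar F) q)"
      unfolding f cb using rs(2) by algebra
    thus "?B = 0"
      unfolding eqs by simp
    have "?C
      = r\<^sup>2 * s * (2 * coord_a q * \<mu> * d_v_bar F q - d_v (d_v_bar F) q)"
      unfolding f ca using rs(1) by algebra
    thus "?C = 0"
      unfolding eqs by simp
  qed
qed

lemma slash_F2: "F2 \<phi>"
  unfolding F2_def
proof
  from F2 obtain G H where G: "\<And>p. p \<in> regX \<Longrightarrow> G p = thetaprod p * F p" "G real_analytic_on domX"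
    "\<And>\<tau> v t. Im \<tau> > 0 \<Longrightarrow> (\<lambda>u. G (\<tau>, u, v, t)) holomorphic_on UNIV"
    and H: "\<And>p. p \<in> regX \<Longrightarrow> H p = d_v_bar F p" "H real_analytic_on domX"
    unfolding F2_def by blast
  \<comment> \<open>\<open>G\<close> is holomorphic in u only, but u also enters the last component
    of \<open>act\<close>. Hence the dependence on t is split off by (F1) as an exponential and
    \<open>G\<close> is evaluated with last entry 0.\<close>
  define G' where "G' p = inverse (aut (fst p)) * inverse (K p) * ex (of_real m * snd (snd (snd (act p)))) *
    G ((a * fst p + b) / aut (fst p), fst (snd p) / aut (fst p), fst (snd (snd p)) / aut (fst p), 0)" for p
  have "G' p = thetaprod p * \<phi> p" if p: "p \<in> regX" for p
  proof -
    have dom: "p \<in> domX" using p regX_subset by blast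
    have q: "act p \<in> regX" using act_regX p dom by blast
    define q0 where "q0 = ((a * fst p + b) / aut (fst p), fst (snd p) / aut (fst p), fst (snd (snd p)) / aut (fst p), 0 :: complex)"
    have q0: "q0 \<in> regX" using q regX_t unfolding act_eq q0_def by blast
    have "F (act p) = ex (of_real m * snd (snd (snd (act p)))) * F q0"
      using F1 q unfolding F1_def act_eq q0_def by auto
    moreover have "thetaprod q0 = K p * thetaprod p"
      using thetaprod_act[OF dom] by (simp add: act_eq q0_def thetaprod_def)
    ultimately show ?thesis
      using K_nonzero[OF dom] by (simp add: G'_def q0_def[symmetric] G(1)[OF q0] slash_eq)
  qed
  moreover have "G' real_analytic_on domX"
    unfolding G'_def act_eq snd_conv
  proof (intro real_analytic_intros real_analytic_on_compose_point[OF G(2)] K_real_analytic K_nonzero)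
    fix p assume "p \<in> domX"
    thus "aut (fst p) \<noteq> 0" "aut (fst p) \<noteq> 0" "aut (fst p) \<noteq> 0" "aut (fst p) \<noteq> 0" "aut (fst p) \<noteq> 0" by (auto simp: aut_fst_nonzero)
    show "((a * fst p + b) / aut (fst p), fst (snd p) / aut (fst p), fst (snd (snd p)) / aut (fst p), 0) \<in> domX"
      using act_domX[OF \<open>p \<in> domX\<close>] by (simp add: act_eq domX_iff)
  qed
  moreover have "(\<lambda>u. G' (\<tau>, u, v, t)) holomorphic_on UNIV" if \<tau>: "Im \<tau> > 0" for \<tau> v t
  proof -
    have im: "Im ((a * \<tau> + b) / aut \<tau>) > 0"
      using act_domX[of "(\<tau>, 0, 0, 0)"] \<tau> by (simp add: act_def domX_iff)
    have dom: "(\<tau>, u, v, t) \<in> domX" for u using \<tau> by (simp add: domX_iff)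
    have "(\<lambda>u. G ((a * \<tau> + b) / aut \<tau>, u / aut \<tau>, v / aut \<tau>, 0)) holomorphic_on UNIV"
    proof -
      have "(\<lambda>u. u / aut \<tau>) holomorphic_on UNIV"
        using aut_nonzero[OF \<tau>] by (intro holomorphic_intros) auto
      from holomorphic_on_compose_gen[OF this G(3)[OF im]] show ?thesis by (simp add: o_def)
    qed
    thus ?thesis
      unfolding G'_def act_eq fst_conv snd_conv
      using aut_nonzero[OF \<tau>] K_nonzero[OF dom]
      by (intro holomorphic_intros K_holomorphic[OF \<tau>]) auto
  qed
  ultimately show "\<exists>G. (\<forall>p\<in>regX. G p = thetaprod p * \<phi> p) \<and> G real_analytic_on domX \<and>
     (\<forall>\<tau> v t. 0 < Im \<tau> \<longrightarrow> (\<lambda>u. G (\<tau>, u, v, t)) holomorphic_on UNIV)" by blast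
  \<comment> \<open>No theta factor occurs here: \<open>d_v_bar\<close> multiplies by
    \<open>inverse (aut \<tau>)\<close> and its conjugate only.\<close>
  define H' where "H' p = inverse (aut (fst p)) * inverse (cnj (aut (fst p))) * H (act p)" for p
  have "H' p = d_v_bar \<phi> p" if p: "p \<in> regX" for p
  proof -
    have "act p \<in> regX" using act_regX p regX_subset by blast
    thus ?thesis using slash_first_order(5)[of "fst p" "fst (snd p)" "fst (snd (snd p))" "snd (snd (snd p))"] p
      by (simp add: H'_def H(1))
  qed
  moreover have "H' real_analytic_on domX"
    unfolding H'_def using aut_fst_nonzero act_domX
    by (intro real_analytic_intros real_analytic_on_act[OF H(2)]) auto
  ultimately show "\<exists>H. (\<forall>p\<in>regX. H p = d_v_bar \<phi> p) \<and> H real_analytic_on domX" by blast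
qed

end

end

section \<open>The generators\<close>

lemma matS_entries [simp]: "matS $ 1 $ 1 = 0" "matS $ 1 $ 2 = -1" "matS $ 2 $ 1 = 1" "matS $ 2 $ 2 = 0"
  by (simp_all add: matS_def)

lemma matT_entries [simp]: "matT $ 1 $ 1 = 1" "matT $ 1 $ 2 = 1" "matT $ 2 $ 1 = 0" "matT $ 2 $ 2 = 1"
  by (simp_all add: matT_def)

lemma det_matS: "det matS = 1" and det_matT: "det matT = 1"
  by (simp_all add: det_2)

lemma slash_matS: "slash F matS (\<tau>, u, v, t) = inverse \<tau> * F (- 1 / \<tau>, u / \<tau>, v / \<tau>, t - (u\<^sup>2 - v\<^sup>2) / \<tau>)"
  by (simp add: slash_def)

lemma slash_matT: "slash F matT (\<tau>, u, v, t) = F (\<tau> + 1, u, v, t)"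
  by (simp add: slash_def)

text \<open>The exponents of the two theta factors add up by \<open>((v - u)\<^sup>2 + (v +
  u)\<^sup>2) / 2 = u\<^sup>2 + v\<^sup>2\<close>.\<close>

definition inversion_factor :: "point \<Rightarrow> complex" where
  "inversion_factor p = (theta_factor (fst p))\<^sup>2 * ex (((fst (snd p))\<^sup>2 + (fst (snd (snd p)))\<^sup>2) / fst p)"

lemma theta_automorphy_matS:
  "theta_automorphy matS inversion_factor"
proof -
  interpret unimodular matS by standard (rule det_matS)
  show ?thesis
  proof
    fix p assume p: "p \<in> domX"
    obtain \<tau> u v t where pe: "p = (\<tau>, u, v, t)" by (cases p)
    have \<tau>: "Im \<tau> > 0" "\<tau> \<noteq> 0" using p by (auto simp: pe domX_iff)
    have e: "ex ((v - u)\<^sup>2 / (2 * \<tau>)) * ex ((v + u)\<^sup>2 / (2 * \<tau>)) = ex ((u\<^sup>2 + v\<^sup>2) / \<tau>)"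
      unfolding ex_add[symmetric] using \<tau>(2) by (intro arg_cong[of _ _ ex]) (simp add: field_simps power2_eq_square)
    have "thetaprod (act p) = theta11 (- 1 / \<tau>) ((v - u) / \<tau>) * theta11 (- 1 / \<tau>) ((v + u) / \<tau>)"
      by (simp add: pe act_def aut_def thetaprod_def diff_divide_distrib add_divide_distrib)
    also have "\<dots> = (theta_factor \<tau>)\<^sup>2 * (ex ((v - u)\<^sup>2 / (2 * \<tau>)) * ex ((v + u)\<^sup>2 / (2 * \<tau>))) * (theta11 \<tau> (v - u) * theta11 \<tau> (v + u))"
      unfolding theta_factor(2)[OF \<tau>(1)] by (simp add: power2_eq_square)
    finally show "thetaprod (act p) = inversion_factor p * thetaprod p"
      unfolding e by (simp add: pe thetaprod_def inversion_factor_def)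
    show "inversion_factor p \<noteq> 0"
      using theta_factor(1)[OF \<tau>(1)] by (simp add: pe inversion_factor_def)
  next
    have "(\<lambda>p. theta_factor (fst p)) real_analytic_on domX"
      by (rule real_analytic_on_compose[OF theta_factor_real_analytic])
         (auto simp: domX_iff intro!: real_analytic_intros)
    thus "inversion_factor real_analytic_on domX"
      unfolding inversion_factor_def[abs_def] by (intro real_analytic_intros) (auto simp: domX_iff)
  next
    fix \<tau> v t :: complex assume "Im \<tau> > 0"
    thus "(\<lambda>u. inversion_factor (\<tau>, u, v, t)) holomorphic_on UNIV"
      unfolding inversion_factor_def fst_conv snd_conv by (intro holomorphic_intros) auto
  qed
qed

lemma theta_automorphy_matT: "theta_automorphy matT (\<lambda>_. ex (1/4))"
proof -
  interpret unimodular matT by standard (rule det_matT)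
  have "ex (1/8) * ex (1/8) = ex (1/4)" by (simp add: ex_add[symmetric])
  hence "thetaprod (act p) = ex (1/4) * thetaprod p" for p
    by (cases p) (simp add: act_def aut_def thetaprod_def theta11_tau_plus_1 mult.left_commute)
  thus ?thesis by unfold_locales (auto intro!: real_analytic_intros)
qed

lemma regX_matS:
  assumes "Im \<tau> > 0"
  shows "(- 1 / \<tau>, u / \<tau>, v / \<tau>, t') \<in> regX \<longleftrightarrow> (\<tau>, u, v, t) \<in> regX"
proof -
  interpret theta_automorphy matS inversion_factor
    by (rule theta_automorphy_matS)
  have "act (\<tau>, u, v, t) = (- 1 / \<tau>, u / \<tau>, v / \<tau>, t - (u\<^sup>2 - v\<^sup>2) / \<tau>)"
    by (simp add: act_def aut_def)
  with act_regX[of "(\<tau>, u, v, t)"] assms have "(- 1 / \<tau>, u / \<tau>, v / \<tau>, t - (u\<^sup>2 - v\<^sup>2) / \<tau>) \<in> regX \<longleftrightarrow> (\<tau>, u, v, t) \<in> regX"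
    by (simp add: domX_iff)
  thus ?thesis using regX_t by blast
qed

lemma regX_matT: "(\<tau> + 1, u, v, t) \<in> regX \<longleftrightarrow> (\<tau>, u, v, t) \<in> regX"
  by (simp add: regX_def domX_def thetaprod_def theta11_tau_plus_1)

section \<open>The translation laws under the two generators\<close>

lemma theta11_int_zero: "theta11 \<tau> (z + of_int n) = 0 \<longleftrightarrow> theta11 \<tau> z = 0"
proof (induction n rule: int_induct[where k = 0])
  case (step1 i)
  thus ?case using theta11_plus_1[of \<tau> "z + of_int i"] by (simp add: add.assoc)
next
  case (step2 i)
  thus ?case using theta11_plus_1[of \<tau> "z + of_int (i - 1)"] by (simp add: add.assoc)
qed simp

lemma regX_int: "(\<tau>, u + of_int j, v + of_int k, t) \<in> regX \<longleftrightarrow> (\<tau>, u, v, t) \<in> regX"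
  using theta11_int_zero[of \<tau> "v - u" "k - j"] theta11_int_zero[of \<tau> "v + u" "k + j"]
  by (simp add: regX_def domX_def thetaprod_def algebra_simps)

text \<open>The two transformed points have different t-slots because the action shifts t by a
  quadratic term. (F1) turns the difference into an exponential, after which the law for F is
  applied at a common \<open>t'\<close>.\<close>

lemma slash_matS_ratio:
  assumes F1: "F1 m F" and p: "(\<tau>, u, v, t) \<in> regX" and q: "(\<tau>, u', v', t) \<in> regX"
    and F: "\<And>t'. (- 1 / \<tau>, u / \<tau>, v / \<tau>, t') \<in> regX \<Longrightarrow> (- 1 / \<tau>, u' / \<tau>, v' / \<tau>, t') \<in> regX \<Longrightarrow>
      F (- 1 / \<tau>, u' / \<tau>, v' / \<tau>, t') = e * F (- 1 / \<tau>, u / \<tau>, v / \<tau>, t')"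
  shows "slash F matS (\<tau>, u', v', t) =
    (ex (of_real m * ((u\<^sup>2 - v\<^sup>2 - (u'\<^sup>2 - v'\<^sup>2)) / \<tau>)) * e) * slash F matS (\<tau>, u, v, t)"
proof -
  define t0 where "t0 = t - (u\<^sup>2 - v\<^sup>2) / \<tau>"
  have \<tau>: "Im \<tau> > 0" using q by (auto simp: regX_def domX_def)
  have p': "(- 1 / \<tau>, u / \<tau>, v / \<tau>, t0) \<in> regX" using p by (rule regX_matS[OF \<tau>, THEN iffD2])
  have q': "(- 1 / \<tau>, u' / \<tau>, v' / \<tau>, t0) \<in> regX" using q by (rule regX_matS[OF \<tau>, THEN iffD2])
  have eq: "t - (u'\<^sup>2 - v'\<^sup>2) / \<tau> = t0 + (u\<^sup>2 - v\<^sup>2 - (u'\<^sup>2 - v'\<^sup>2)) / \<tau>"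
    by (simp add: t0_def diff_divide_distrib)
  show ?thesis
    unfolding slash_matS eq t0_def[symmetric] F1_cong_t[OF F1 q'] F[OF p' q'] by (simp only: mult_ac)
qed

text \<open>Division by \<tau> makes integers into multiples of \<open>- 1 / \<tau>\<close> with the
  opposite sign, and multiples of \<tau> into integers. So the two laws, and with them s and s', are
  exchanged.\<close>

lemma F3_matS:
  assumes F1: "F1 m F" and F3: "F3 m s s' F" and s': "2 * s' \<in> \<int>"
  shows "F3 m s' s (slash F matS)"
  unfolding F3_def
proof (intro allI conjI impI; elim conjE)
  fix j k :: int and \<tau> u v t
  assume p: "(\<tau>, u, v, t) \<in> regX" and q: "(\<tau>, u + of_int j, v + of_int k, t) \<in> regX"
  let ?x = "- 1 / \<tau>"
  let ?y = "of_real s' * (of_int (- j) + of_int (- k)) + 2 * of_real m * (of_int (- k) * (v / \<tau>) - of_int (- j) * (u / \<tau>))"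
  have \<tau>: "\<tau> \<noteq> 0" using p by (auto simp: regX_def domX_def)
  hence sh: "(u + of_int j) / \<tau> = u / \<tau> + of_int (- j) * ?x" "(v + of_int k) / \<tau> = v / \<tau> + of_int (- k) * ?x"
    by (simp_all add: field_simps)
  have "slash F matS (\<tau>, u + of_int j, v + of_int k, t) =
    (ex (of_real m * ((u\<^sup>2 - v\<^sup>2 - ((u + of_int j)\<^sup>2 - (v + of_int k)\<^sup>2)) / \<tau>)) *
      (ex ?y * qp ?x (m * ((of_int (- k))\<^sup>2 - (of_int (- j))\<^sup>2)))) * slash F matS (\<tau>, u, v, t)"
    by (rule slash_matS_ratio[OF F1 p q], unfold sh) (use F3 in \<open>unfold F3_def, blast\<close>)
  also have "ex (of_real m * ((u\<^sup>2 - v\<^sup>2 - ((u + of_int j)\<^sup>2 - (v + of_int k)\<^sup>2)) / \<tau>)) *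
      (ex ?y * qp ?x (m * ((of_int (- k))\<^sup>2 - (of_int (- j))\<^sup>2))) = ex (of_real s' * (of_int j + of_int k))"
  proof -
    \<comment> \<open>The reversed sign yields \<open>- s'\<close> where \<open>s'\<close> is
      wanted; since \<open>2 * s'\<close> is an integer, \<open>ex\<close> does not see the
      difference.\<close>
    obtain N where N: "2 * s' = of_int N" using s' by (auto elim: Ints_cases)
    have "of_real m * ((u\<^sup>2 - v\<^sup>2 - ((u + of_int j)\<^sup>2 - (v + of_int k)\<^sup>2)) / \<tau>) +
      (?y + of_real (m * ((of_int (- k))\<^sup>2 - (of_int (- j))\<^sup>2)) * ?x) - of_real s' * (of_int j + of_int k)
      = - (of_real (2 * s') * (of_int j + of_int k))"
      using \<tau> by (simp add: field_simps power2_eq_square)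
    also have "\<dots> \<in> \<int>" unfolding N by simp
    finally show ?thesis unfolding qp_def ex_add[symmetric] ex_eq_iff .
  qed
  finally show "slash F matS (\<tau>, u + of_int j, v + of_int k, t) =
    ex (of_real s' * (of_int j + of_int k)) * slash F matS (\<tau>, u, v, t)" .
next
  fix j k :: int and \<tau> u v t
  assume p: "(\<tau>, u, v, t) \<in> regX" and q: "(\<tau>, u + of_int j * \<tau>, v + of_int k * \<tau>, t) \<in> regX"
  have \<tau>: "\<tau> \<noteq> 0" using p by (auto simp: regX_def domX_def)
  hence sh: "(u + of_int j * \<tau>) / \<tau> = u / \<tau> + of_int j" "(v + of_int k * \<tau>) / \<tau> = v / \<tau> + of_int k"
    by (simp_all add: field_simps)
  have "slash F matS (\<tau>, u + of_int j * \<tau>, v + of_int k * \<tau>, t) =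
    (ex (of_real m * ((u\<^sup>2 - v\<^sup>2 - ((u + of_int j * \<tau>)\<^sup>2 - (v + of_int k * \<tau>)\<^sup>2)) / \<tau>)) *
      ex (of_real s * (of_int j + of_int k))) * slash F matS (\<tau>, u, v, t)"
    by (rule slash_matS_ratio[OF F1 p q], unfold sh) (use F3 in \<open>unfold F3_def, blast\<close>)
  also have "ex (of_real m * ((u\<^sup>2 - v\<^sup>2 - ((u + of_int j * \<tau>)\<^sup>2 - (v + of_int k * \<tau>)\<^sup>2)) / \<tau>)) * ex (of_real s * (of_int j + of_int k))
    = ex (of_real s * (of_int j + of_int k) + 2 * of_real m * (of_int k * v - of_int j * u)) * qp \<tau> (m * ((of_int k)\<^sup>2 - (of_int j)\<^sup>2))"
    unfolding qp_def ex_add[symmetric]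
    using \<tau> by (intro arg_cong[of _ _ ex]) (simp add: field_simps power2_eq_square)
  finally show "slash F matS (\<tau>, u + of_int j * \<tau>, v + of_int k * \<tau>, t) =
    ex (of_real s * (of_int j + of_int k) + 2 * of_real m * (of_int k * v - of_int j * u)) * qp \<tau> (m * ((of_int k)\<^sup>2 - (of_int j)\<^sup>2)) * slash F matS (\<tau>, u, v, t)" .
qed

lemma F4_matS:
  assumes F1: "F1 m F" and F4: "F4 m F" and m: "m > 0"
  shows "F4 m (slash F matS)"
  unfolding F4_def Let_def
proof (intro allI conjI impI; elim conjE)
  fix k :: int and \<tau> u v t
  let ?h = "complex_of_int k / (2 * of_real m)"
  assume p: "(\<tau>, u, v, t) \<in> regX" and q: "(\<tau>, u + ?h, v + ?h, t) \<in> regX"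
  have \<tau>: "\<tau> \<noteq> 0" using p by (auto simp: regX_def domX_def)
  hence sh: "(x + ?h) / \<tau> = x / \<tau> + of_int (- k) / (2 * of_real m) * (- 1 / \<tau>)" for x
    using m by (simp add: field_simps)
  have "slash F matS (\<tau>, u + ?h, v + ?h, t) = (ex (of_real m * ((u\<^sup>2 - v\<^sup>2 - ((u + ?h)\<^sup>2 - (v + ?h)\<^sup>2)) / \<tau>)) *
      ex (of_int (- k) * (v / \<tau> - u / \<tau>))) * slash F matS (\<tau>, u, v, t)"
    by (rule slash_matS_ratio[OF F1 p q], unfold sh) (use F4 in \<open>unfold F4_def Let_def, blast\<close>)
  \<comment> \<open>The exponential coming from t cancels the factor of (F4); for shifts by
    multiples of \<tau>, below, it supplies that factor.\<close>
  also have "of_real m * ((u\<^sup>2 - v\<^sup>2 - ((u + ?h)\<^sup>2 - (v + ?h)\<^sup>2)) / \<tau>) = - (of_int (- k) * (v / \<tau> - u / \<tau>))"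
    using m \<tau> by (simp add: power2_eq_square field_simps)
  finally show "slash F matS (\<tau>, u + ?h, v + ?h, t) = slash F matS (\<tau>, u, v, t)"
    by (simp add: ex_minus)
next
  fix k :: int and \<tau> u v t
  let ?h = "complex_of_int k / (2 * of_real m)"
  assume p: "(\<tau>, u, v, t) \<in> regX" and q: "(\<tau>, u + ?h * \<tau>, v + ?h * \<tau>, t) \<in> regX"
  have \<tau>: "\<tau> \<noteq> 0" using p by (auto simp: regX_def domX_def)
  hence sh: "(x + ?h * \<tau>) / \<tau> = x / \<tau> + ?h" for x
    by (simp add: add_divide_distrib)
  have "slash F matS (\<tau>, u + ?h * \<tau>, v + ?h * \<tau>, t) =
    (ex (of_real m * ((u\<^sup>2 - v\<^sup>2 - ((u + ?h * \<tau>)\<^sup>2 - (v + ?h * \<tau>)\<^sup>2)) / \<tau>)) * 1) * slash F matS (\<tau>, u, v, t)"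
    by (rule slash_matS_ratio[OF F1 p q], unfold sh mult_1) (use F4 in \<open>unfold F4_def Let_def, blast\<close>)
  also have "of_real m * ((u\<^sup>2 - v\<^sup>2 - ((u + ?h * \<tau>)\<^sup>2 - (v + ?h * \<tau>)\<^sup>2)) / \<tau>) = of_int k * (v - u)"
    using m \<tau> by (simp add: power2_eq_square field_simps)
  finally show "slash F matS (\<tau>, u + ?h * \<tau>, v + ?h * \<tau>, t) = ex (of_int k * (v - u)) * slash F matS (\<tau>, u, v, t)"
    by simp
qed

text \<open>\<open>j * \<tau>\<close> is \<open>j * (\<tau> + 1) - j\<close>, so the shift is an
  integral one followed by one along the new lattice vector. The summand m in the new exponent
  completes \<open>k\<^sup>2 - j\<^sup>2\<close> to a product that is always even.\<close>

lemma F3_matT: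
  assumes F3: "F3 m s s' F" and m: "2 * m \<in> \<int>" and s: "2 * s \<in> \<int>"
  shows "F3 m s (s + s' + m) (slash F matT)"
  unfolding F3_def slash_matT
proof (intro allI conjI impI; elim conjE)
  fix j k :: int and \<tau> u v t
  assume "(\<tau>, u, v, t) \<in> regX" and "(\<tau>, u + of_int j, v + of_int k, t) \<in> regX"
  hence "(\<tau> + 1, u, v, t) \<in> regX" "(\<tau> + 1, u + of_int j, v + of_int k, t) \<in> regX"
    by (simp_all add: regX_matT)
  thus "F (\<tau> + 1, u + of_int j, v + of_int k, t) = ex (of_real s * (of_int j + of_int k)) * F (\<tau> + 1, u, v, t)"
    using F3 unfolding F3_def by blast
next
  fix j k :: int and \<tau> u v t
  assume "(\<tau>, u, v, t) \<in> regX" and "(\<tau>, u + of_int j * \<tau>, v + of_int k * \<tau>, t) \<in> regX"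
  define x where "x = \<tau> + 1"
  define u0 where "u0 = u + of_int (- j)"
  define v0 where "v0 = v + of_int (- k)"
  have sh: "u + of_int j * \<tau> = u0 + of_int j * x" "v + of_int k * \<tau> = v0 + of_int k * x"
    by (simp_all add: x_def u0_def v0_def algebra_simps)
  have p: "(x, u, v, t) \<in> regX" and q: "(x, u0 + of_int j * x, v0 + of_int k * x, t) \<in> regX"
    using \<open>(\<tau>, u, v, t) \<in> regX\<close> \<open>(\<tau>, u + of_int j * \<tau>, v + of_int k * \<tau>, t) \<in> regX\<close>
    unfolding sh[symmetric] by (simp_all add: x_def regX_matT)
  have r: "(x, u0, v0, t) \<in> regX" unfolding u0_def v0_def regX_int by (rule p)
  let ?y = "of_real s' * (of_int j + of_int k) + 2 * of_real m * (of_int k * v0 - of_int j * u0)"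
  let ?z = "of_real (s + s' + m) * (of_int j + of_int k) + 2 * of_real m * (of_int k * v - of_int j * u)"
  let ?n = "m * ((of_int k)\<^sup>2 - (of_int j)\<^sup>2)"
  have "F (x, u0 + of_int j * x, v0 + of_int k * x, t) = ex ?y * qp x ?n * F (x, u0, v0, t)"
    using F3 q r unfolding F3_def by blast
  also have "F (x, u0, v0, t) = ex (of_real s * (of_int (- j) + of_int (- k))) * F (x, u, v, t)"
    using F3 p r unfolding F3_def u0_def v0_def by blast
  also have "ex ?y * qp x ?n * (ex (of_real s * (of_int (- j) + of_int (- k))) * F (x, u, v, t)) =
    (ex ?y * qp x ?n * ex (of_real s * (of_int (- j) + of_int (- k)))) * F (x, u, v, t)"
    by (simp only: mult.assoc)
  also have "ex ?y * qp x ?n * ex (of_real s * (of_int (- j) + of_int (- k))) = ex ?z * qp \<tau> ?n"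
  proof -
    obtain M where M: "2 * m = of_int M" using m by (auto elim: Ints_cases)
    obtain N where N: "2 * s = of_int N" using s by (auto elim: Ints_cases)
    \<comment> \<open>\<open>j + k\<close> and \<open>k - j + 1\<close> have opposite parity, so m
      times their product is an integral multiple of \<open>2 * m\<close>.\<close>
    have "even ((j + k) * (k - j + 1))" by auto
    then obtain L where L: "(j + k) * (k - j + 1) = 2 * L" by (elim evenE)
    have L': "(complex_of_int j + of_int k) * (of_int k - of_int j + 1) = 2 * of_int L"
      using arg_cong[OF L, of complex_of_int] by simp
    have "?y + of_real ?n * x + of_real s * (of_int (- j) + of_int (- k)) - (?z + of_real ?n * \<tau>)
      = - (of_real (2 * s) * (of_int j + of_int k)) - of_real m * ((of_int j + of_int k) * (of_int k - of_int j + 1))"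
      by (simp add: x_def u0_def v0_def algebra_simps power2_eq_square)
    also have "\<dots> = - (of_real (2 * s) * (of_int j + of_int k)) - of_real (2 * m) * of_int L"
      unfolding L' by simp
    also have "\<dots> \<in> \<int>" unfolding M N by simp
    finally show ?thesis unfolding qp_def ex_add[symmetric] ex_eq_iff .
  qed
  finally show "F (\<tau> + 1, u + of_int j * \<tau>, v + of_int k * \<tau>, t) = ex ?z * qp \<tau> ?n * F (\<tau> + 1, u, v, t)"
    unfolding sh x_def .
qed

lemma regX_section_continuous:
  assumes F2: "F2 F"
  shows "continuous_on {x. (\<tau>, x + h, v, t) \<in> regX} (\<lambda>x. F (\<tau>, x + h, v, t))"
  by (rule continuous_on_compose2[OF real_analytic_on_imp_continuous_on[OF Fspace_real_analytic[OF F2]]])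
     (auto intro!: continuous_intros)

lemma open_regX_section: "open {x. (\<tau>, x + h, v, t) \<in> regX}"
proof -
  have "open ((\<lambda>x. (\<tau>, x + h, v, t)) -` regX)"
    by (intro open_vimage open_regX continuous_intros)
  thus ?thesis by (simp add: vimage_def)
qed

text \<open>
  Shifting by \<open>h * \<tau>\<close> is shifting by \<open>h * (\<tau> + 1)\<close> after shifting by \<open>- h\<close>, and the intermediate
  point may fail to lie in \<open>regX\<close>. It does for a dense set of \<open>u\<close>, and both sides are continuous.
\<close>

lemma F4_matT:
  assumes F2: "F2 F" and F4: "F4 m F"
  shows "F4 m (slash F matT)"
  unfolding F4_def Let_def slash_matT
proof (intro allI conjI impI; elim conjE)
  fix k :: int and \<tau> u v t
  let ?h = "complex_of_int k / (2 * of_real m)"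
  assume "(\<tau>, u, v, t) \<in> regX" and "(\<tau>, u + ?h, v + ?h, t) \<in> regX"
  thus "F (\<tau> + 1, u + ?h, v + ?h, t) = F (\<tau> + 1, u, v, t)"
    using F4 unfolding F4_def Let_def regX_matT[symmetric, of \<tau>] by blast
next
  fix k :: int and \<tau> u v t
  let ?h = "complex_of_int k / (2 * of_real m)"
  define h where "h = complex_of_int k / (2 * of_real m)"
  assume p: "(\<tau>, u, v, t) \<in> regX" and q: "(\<tau>, u + ?h * \<tau>, v + ?h * \<tau>, t) \<in> regX"
  define x where "x = \<tau> + 1"
  have im: "Im x > 0" using p by (auto simp: x_def regX_def domX_def)
  define U where "U = {y. (x, y + h * \<tau>, v + h * \<tau>, t) \<in> regX} \<inter> {y. (x, y + 0, v, t) \<in> regX}"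
  define L where "L y = F (x, y + h * \<tau>, v + h * \<tau>, t)" for y
  define R where "R y = ex (of_int k * (v - y)) * F (x, y + 0, v, t)" for y
  have "open U" unfolding U_def by (intro open_Int open_regX_section)
  have "continuous_on U (\<lambda>y. L y - R y)"
    unfolding L_def R_def
    by (intro continuous_intros continuous_on_subset[OF regX_section_continuous[OF F2]]) (auto simp: U_def)
  hence op: "open (U \<inter> (\<lambda>y. L y - R y) -` (- {0}))"
    using \<open>open U\<close> by (intro continuous_open_preimage) auto
  have uU: "u \<in> U" using p q by (simp add: U_def h_def x_def regX_matT)
  \<comment> \<open>The intermediate point keeps \<open>v - y\<close> and changes
    \<open>v + y\<close> into \<open>v + y - 2 * h\<close>, so one theta value decides whether it
    lies in \<open>regX\<close>.\<close>
  have LR: "L y = R y" if y: "y \<in> U" and th: "theta11 x (v + y - 2 * h) \<noteq> 0" for y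
  proof -
    have yr: "(x, y, v, t) \<in> regX" "(x, y + h * \<tau>, v + h * \<tau>, t) \<in> regX" using y by (simp_all add: U_def)
    have "v - h + (y - h) = v + y - 2 * h" by simp
    hence mid: "(x, y - h, v - h, t) \<in> regX"
      using yr(1) th by (auto simp: regX_def domX_def thetaprod_def)
    have e: "y - h + h * x = y + h * \<tau>" "v - h + h * x = v + h * \<tau>"
      by (simp_all add: x_def algebra_simps)
    have "F (x, y - h + h, v - h + h, t) = F (x, y - h, v - h, t)"
      using F4 mid yr(1) unfolding F4_def Let_def h_def[symmetric]
      by (metis diff_add_cancel h_def)
    moreover have "F (x, y - h + h * x, v - h + h * x, t) = ex (of_int k * (v - h - (y - h))) * F (x, y - h, v - h, t)"
    proof -
      have "(x, y - h + h * x, v - h + h * x, t) \<in> regX" unfolding e by (rule yr(2))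
      with F4 mid show ?thesis unfolding F4_def Let_def h_def by blast
    qed
    ultimately show ?thesis unfolding L_def R_def e by simp
  qed
  have "L u = R u"
  proof (rule ccontr)
    assume "L u \<noteq> R u"
    \<comment> \<open>The open set where \<open>L\<close> and \<open>R\<close> differ, written in
      the variable \<open>z = v + y - 2 * h\<close> to which \<open>theta11_dense\<close>
      applies.\<close>
    define W where "W = (\<lambda>z. z + (2 * h - v)) -` (U \<inter> (\<lambda>y. L y - R y) -` (- {0}))"
    have "open W" unfolding W_def by (intro open_vimage op continuous_intros)
    moreover have "v + u - 2 * h \<in> W" using uU \<open>L u \<noteq> R u\<close> by (simp add: W_def)
    ultimately obtain z where z: "z \<in> W" "theta11 x z \<noteq> 0" using theta11_dense[OF im] by metis
    have "v + (z + (2 * h - v)) - 2 * h = z" by simp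
    with LR[of "z + (2 * h - v)"] z show False by (auto simp: W_def)
  qed
  thus "F (\<tau> + 1, u + ?h * \<tau>, v + ?h * \<tau>, t) = ex (of_int k * (v - u)) * F (\<tau> + 1, u, v, t)"
    by (simp add: L_def R_def h_def x_def)
qed

lemma Fspace_matS:
  assumes "m > 0" "2 * s' \<in> \<int>" "F \<in> Fspace m s s'"
  shows "slash F matS \<in> Fspace m s' s"
proof -
  have F: "F1 m F" "F2 F" "F3 m s s' F" "F4 m F" "F5 F" using assms(3) by (auto simp: Fspace_def)
  interpret theta_automorphy matS inversion_factor
    by (rule theta_automorphy_matS)
  show ?thesis
    unfolding Fspace_def
    using slash_F1[OF F(1)] slash_F2[OF F(1,2) refl] slash_F5[OF F(1,2) refl F(5)]
      F3_matS[OF F(1,3) assms(2)] F4_matS[OF F(1,4) assms(1)] by blast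
qed

lemma Fspace_matT:
  assumes "2 * m \<in> \<int>" "2 * s \<in> \<int>" "F \<in> Fspace m s s'"
  shows "slash F matT \<in> Fspace m s (s + s' + m)"
proof -
  have F: "F1 m F" "F2 F" "F3 m s s' F" "F4 m F" "F5 F" using assms(3) by (auto simp: Fspace_def)
  interpret theta_automorphy matT "\<lambda>_. ex (1/4)"
    by (rule theta_automorphy_matT)
  show ?thesis
    unfolding Fspace_def
    using slash_F1[OF F(1)] slash_F2[OF F(1,2) refl] slash_F5[OF F(1,2) refl F(5)]
      F3_matT[OF F(3) assms(1,2)] F4_matT[OF F(2,4)] by blast
qed

section \<open>The modular group\<close>

text \<open>All conditions refer to \<open>regX\<close>, and as it is open the derivatives agree
  there too. This is needed because the action of a product is the composed action only on
  \<open>domX\<close>.\<close>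

lemma Fspace_cong_imp:
  assumes eq: "\<And>p. p \<in> regX \<Longrightarrow> F p = F' p" and F: "F \<in> Fspace m s s'"
  shows "F' \<in> Fspace m s s'"
proof -
  have F: "F1 m F" "F2 F" "F3 m s s' F" "F4 m F" "F5 F" using F by (auto simp: Fspace_def)
  note cong = wirtinger_cong[OF open_regX]
  have D: "d_tau F p = d_tau F' p" "d_u F p = d_u F' p" "d_v F p = d_v F' p" "d_v_bar F p = d_v_bar F' p"
    "D_tau_bar F p = D_tau_bar F' p" if "p \<in> regX" for p
    using cong[OF that, of F F'] eq by (simp_all add: D_tau_bar_def)
  have "F1 m F'"
    using F(1) eq regX_t unfolding F1_def by metis
  moreover have "F2 F'"
    using F(2) unfolding F2_def by (simp add: eq D)
  moreover have "F3 m s s' F'"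
    using F(3) unfolding F3_def by (simp add: eq)
  moreover have "F4 m F'"
    using F(4) unfolding F4_def Let_def by (simp add: eq)
  moreover have "F5 F'"
    unfolding F5_def
  proof
    fix p assume p: "p \<in> regX"
    have "opD F p = opD F' p"
      unfolding opD_def using cong[OF p, of "d_tau F" "d_tau F'"] cong[OF p, of "d_v F" "d_v F'"]
        cong[OF p, of "d_u F" "d_u F'"] by (simp add: D)
    moreover have "opD_bar F p = opD_bar F' p"
      unfolding opD_bar_def using cong[OF p, of "D_tau_bar F" "D_tau_bar F'"] cong[OF p, of "d_v_bar F" "d_v_bar F'"]
      by (simp add: D)
    moreover have "opDelta F p = opDelta F' p"
      unfolding opDelta_def using cong[OF p, of "d_v_bar F" "d_v_bar F'"] by (simp add: D)
    ultimately show "opD F' p = 0 \<and> opD_bar F' p = 0 \<and> opDelta F' p = 0"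
      using F(5) p unfolding F5_def by metis
  qed
  ultimately show ?thesis by (simp add: Fspace_def)
qed

text \<open>On \<open>domX\<close> no denominator vanishes, and the factors \<open>aut\<close>
  satisfy the cocycle relation named \<open>zw\<close> below.\<close>

lemma slash_mult:
  assumes "det \<gamma> = 1" "det \<delta> = 1" "p \<in> domX"
  shows "slash F (\<gamma> ** \<delta>) p = slash (slash F \<gamma>) \<delta> p"
proof -
  interpret g: unimodular \<gamma> by standard (rule assms)
  interpret d: unimodular \<delta> by standard (rule assms)
  interpret gd: unimodular "\<gamma> ** \<delta>" by standard (simp add: det_mul assms)
  obtain \<tau> u v t where p: "p = (\<tau>, u, v, t)" by (cases p)
  have w2: "d.aut \<tau> \<noteq> 0" using d.aut_fst_nonzero[OF assms(3)] by (simp add: p)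
  have w1: "g.aut ((d.a * \<tau> + d.b) / d.aut \<tau>) \<noteq> 0"
    using g.aut_fst_nonzero[OF d.act_domX[OF assms(3)]] by (simp add: p d.act_def)
  have ent: "gd.a = g.a * d.a + g.b * d.c" "gd.b = g.a * d.b + g.b * d.d"
    "gd.c = g.c * d.a + g.d * d.c" "gd.d = g.c * d.b + g.d * d.d"
    by (simp_all add: matrix_matrix_mult_def sum_2)
  define w where "w = d.aut \<tau>"
  define z where "z = g.aut ((d.a * \<tau> + d.b) / d.aut \<tau>)"
  have wz: "w \<noteq> 0" "z \<noteq> 0" using w1 w2 by (simp_all add: w_def z_def)
  have zw: "z * w = gd.aut \<tau>"
    using w2 unfolding z_def w_def g.aut_def gd.aut_def ent by (simp add: field_simps d.aut_def)
  define y where "y = g.a * ((d.a * \<tau> + d.b) / w) + g.b"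
  have "y * w = g.a * (d.a * \<tau> + d.b) + g.b * w"
    using wz by (simp add: y_def distrib_right)
  also have "\<dots> = gd.a * \<tau> + gd.b"
    unfolding ent w_def d.aut_def by (simp add: algebra_simps)
  finally have yw: "gd.a * \<tau> + gd.b = y * w" ..
  have 1: "(gd.a * \<tau> + gd.b) / gd.aut \<tau> = (g.a * ((d.a * \<tau> + d.b) / w) + g.b) / z"
    unfolding y_def[symmetric] yw zw[symmetric] using wz by simp
  have 2: "x / gd.aut \<tau> = x / w / z" for x
    unfolding zw[symmetric] by (simp add: mult.commute)
  \<comment> \<open>This consequence of \<open>det \<delta> = 1\<close> makes the t-shift of the
    product the sum of the two successive t-shifts.\<close>
  have c: "gd.c * w = g.c + d.c * (z * w)"
    using d.det' unfolding zw unfolding w_def d.aut_def gd.aut_def ent by algebra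
  have 3: "gd.c * (u\<^sup>2 - v\<^sup>2) / gd.aut \<tau> = d.c * (u\<^sup>2 - v\<^sup>2) / w + g.c * ((u / w)\<^sup>2 - (v / w)\<^sup>2) / z"
  proof -
    have gc: "gd.c = g.c / w + d.c * z" using c wz by (simp add: field_simps)
    show ?thesis unfolding zw[symmetric] gc using wz by (simp add: field_simps power2_eq_square)
  qed
  have act: "gd.act p = g.act (d.act p)"
    unfolding p gd.act_def d.act_def g.act_def prod.case w_def[symmetric] z_def[folded w_def, symmetric] 1 2[of u] 2[of v] 3
    by simp
  have "inverse (gd.aut (fst p)) = inverse (d.aut (fst p)) * inverse (g.aut (fst (d.act p)))"
    by (simp add: p d.act_def zw[symmetric] z_def w_def)
  thus ?thesis by (simp add: gd.slash_eq d.slash_eq g.slash_eq act)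
qed

section \<open>Generation of the modular group by S and T\<close>

definition imat :: "int \<Rightarrow> int \<Rightarrow> int \<Rightarrow> int \<Rightarrow> real^2^2" where
  "imat a b c d = vector [vector [of_int a, of_int b], vector [of_int c, of_int d]]"

lemma imat_mult: "imat a b c d ** imat a' b' c' d' = imat (a * a' + b * c') (a * b' + b * d') (c * a' + d * c') (c * b' + d * d')"
  by (simp add: vec_eq_iff forall_2 matrix_matrix_mult_def sum_2 imat_def)

lemma det_imat: "det (imat a b c d) = of_int (a * d - b * c)"
  by (simp add: det_2 imat_def)

lemma SL2Z_imat:
  assumes "\<gamma> \<in> SL2Z" obtains a b c d where "\<gamma> = imat a b c d" "a * d - b * c = 1"
proof -
  from assms have int: "\<gamma> $ i $ j \<in> \<int>" for i j by (simp add: SL2Z_def)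
  obtain a b c d where e: "\<gamma> $ 1 $ 1 = of_int a" "\<gamma> $ 1 $ 2 = of_int b" "\<gamma> $ 2 $ 1 = of_int c" "\<gamma> $ 2 $ 2 = of_int d"
    using int[of 1 1] int[of 1 2] int[of 2 1] int[of 2 2] by (auto elim!: Ints_cases)
  have g: "\<gamma> = imat a b c d"
    by (simp add: vec_eq_iff forall_2 imat_def e)
  have "det \<gamma> = 1" using assms by (simp add: SL2Z_def)
  hence "real_of_int (a * d - b * c) = 1" unfolding g det_imat .
  hence "a * d - b * c = 1" by linarith
  with g show thesis by (rule that)
qed

lemma imat_SL2Z: "a * d - b * c = 1 \<Longrightarrow> imat a b c d \<in> SL2Z"
  by (simp add: SL2Z_def det_imat forall_2) (simp add: imat_def)

text \<open>There is no case for inverses, so S and T have to generate as a monoid, and the inverses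
  of both are produced as words. The rest is the Euclidean algorithm on the lower row, by descent on
  the lower left entry.\<close>

lemma SL2Z_induct [consumes 1, case_names S T mult]:
  assumes \<gamma>: "\<gamma> \<in> SL2Z" and S: "P matS" and T: "P matT"
    and mult: "\<And>\<gamma> \<delta>. \<gamma> \<in> SL2Z \<Longrightarrow> \<delta> \<in> SL2Z \<Longrightarrow> P \<gamma> \<Longrightarrow> P \<delta> \<Longrightarrow> P (\<gamma> ** \<delta>)"
  shows "P \<gamma>"
proof -
  have S': "P (imat 0 (-1) 1 0)" and T': "P (imat 1 1 0 1)"
    using S T by (simp_all add: imat_def matS_def matT_def)
  have m: "P (imat (a * a' + b * c') (a * b' + b * d') (c * a' + d * c') (c * b' + d * d'))"
    if "P (imat a b c d)" "P (imat a' b' c' d')" "a * d - b * c = 1" "a' * d' - b' * c' = 1" for a b c d a' b' c' d'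
    using mult[OF imat_SL2Z imat_SL2Z that(1,2)] that by (simp add: imat_mult)
  have N: "P (imat (-1) 0 0 (-1))" using m[OF S' S'] by simp
  have Si: "P (imat 0 1 (-1) 0)" using m[OF N S'] by simp
  \<comment> \<open>\<open>S T S T S\<close> is minus the inverse of \<open>T\<close>\<close>
  have "P (imat 0 (-1) 1 1)" using m[OF S' T'] by simp
  from m[OF this S'] have "P (imat (-1) 0 1 (-1))" by simp
  from m[OF this T'] have "P (imat (-1) (-1) 1 0)" by simp
  from m[OF this S'] have "P (imat (-1) 1 0 (-1))" by simp
  from m[OF N this] have Ti: "P (imat 1 (-1) 0 1)" by simp
  have Tn: "P (imat 1 n 0 1)" for n
  proof (induction n rule: int_induct[where k = 0])
    case base
    show ?case using m[OF N N] by simp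
  next
    case (step1 i)
    show ?case using m[OF step1(2) T'] by (simp add: add.commute)
  next
    case (step2 i)
    show ?case using m[OF step2(2) Ti] by (simp add: add.commute)
  qed
  have "P (imat a b c d)" if "a * d - b * c = 1" for a b c d
    using that
  proof (induction "nat \<bar>c\<bar>" arbitrary: a b c d rule: less_induct)
    case less
    show ?case
    proof (cases "c = 0")
      case True
      with less.prems have ad: "a * d = 1" by simp
      hence "a = 1 \<and> d = 1 \<or> a = -1 \<and> d = -1" by (simp add: zmult_eq_1_iff)
      thus ?thesis
      proof
        assume "a = 1 \<and> d = 1"
        with Tn[of b] True show ?thesis by simp
      next
        assume "a = -1 \<and> d = -1"
        with m[OF N Tn[of "- b"]] True show ?thesis by simp
      qed
    next
      case False
      \<comment> \<open>Right multiplication by the \<open>n\<close>-th power of T and then by S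
        puts the remainder \<open>d mod c\<close> into the lower left entry; the inverse of S and
        the power \<open>- n\<close> of T undo this.\<close>
      define n where "n = - (d div c)"
      have d': "c * n + d = d mod c" by (simp add: n_def minus_mult_div_eq_mod[symmetric])
      hence "nat \<bar>c * n + d\<bar> < nat \<bar>c\<bar>" using abs_mod_less[OF False, of d] by simp
      moreover have det: "(a * n + b) * (- c) - (- a) * (c * n + d) = 1"
        using less.prems by (simp add: algebra_simps)
      ultimately have "P (imat (a * n + b) (- a) (c * n + d) (- c))"
        by (rule less.hyps)
      from m[OF this Si det] have "P (imat a (a * n + b) c (c * n + d))" by simp
      from m[OF this Tn[of "- n"]] show ?thesis using less.prems by (simp add: algebra_simps)
    qed
  qed
  with \<gamma> show ?thesis by (elim SL2Z_imat) simp
qed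

text \<open>s and s' enter only through \<open>ex\<close> of their product with the integer
  \<open>j + k\<close>.\<close>

lemma Fspace_int_cong:
  assumes "s - r \<in> \<int>" "s' - r' \<in> \<int>" shows "Fspace m s s' = Fspace m r r'"
proof -
  have e: "ex (of_real x * (of_int j + of_int k) + y) = ex (of_real x' * (of_int j + of_int k) + y)"
    if xx: "x - x' \<in> \<int>" for x x' y and j k :: int
  proof -
    obtain N where N: "x - x' = of_int N" using xx by (auto elim: Ints_cases)
    have "of_real x * (of_int j + of_int k) + y - (of_real x' * (of_int j + of_int k) + y)
      = of_real (x - x') * (of_int j + of_int k)" by (simp add: algebra_simps)
    also have "\<dots> \<in> \<int>" unfolding N by simp
    finally show ?thesis unfolding ex_eq_iff .
  qed
  have "F3 m s s' F \<longleftrightarrow> F3 m r r' F" for F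
    unfolding F3_def e[OF assms(2)] e[OF assms(1), of _ _ 0, simplified] ..
  thus ?thesis by (simp add: Fspace_def)
qed

theorem theorem2p4:
  fixes m s s' :: real
  assumes "m > 0" and "2 * m \<in> \<int>" and "2 * s \<in> \<int>" and "2 * s' \<in> \<int>"
  shows "(\<forall>F \<in> Fspace m s s'.
            slash F matS \<in> Fspace m s' s \<and> slash F matT \<in> Fspace m s (s + s' + m))
       \<and> (m - s \<in> \<int> \<and> s - s' \<in> \<int> \<longrightarrow>
            (\<forall>\<gamma> \<in> SL2Z. \<forall>F \<in> Fspace m s s'. slash F \<gamma> \<in> Fspace m s s'))"
proof (intro conjI ballI impI; (elim conjE)?)
  show "slash F matS \<in> Fspace m s' s" if "F \<in> Fspace m s s'" for F
    using Fspace_matS[OF assms(1,4) that] .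
  show "slash F matT \<in> Fspace m s (s + s' + m)" if "F \<in> Fspace m s s'" for F
    using Fspace_matT[OF assms(2,3) that] .
  fix \<gamma> F assume ms: "m - s \<in> \<int>" and ss: "s - s' \<in> \<int>" and "\<gamma> \<in> SL2Z" "F \<in> Fspace m s s'"
  have "s' - s \<in> \<int>" using Ints_minus[OF ss] by simp
  hence eqS: "Fspace m s' s = Fspace m s s'" using ss by (intro Fspace_int_cong)
  \<comment> \<open>This is the difference \<open>m + s\<close> between the exponents
    \<open>s + s' + m\<close> and \<open>s'\<close>.\<close>
  have "(m - s) + 2 * s \<in> \<int>" by (intro Ints_add ms assms)
  hence eqT: "Fspace m s (s + s' + m) = Fspace m s s'"
    by (intro Fspace_int_cong) (simp_all add: algebra_simps)
  have "\<forall>F \<in> Fspace m s s'. slash F \<gamma> \<in> Fspace m s s'"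
    using \<open>\<gamma> \<in> SL2Z\<close>
  proof (induction rule: SL2Z_induct)
    case S
    show ?case using Fspace_matS[OF assms(1,4), where s = s] unfolding eqS by blast
  next
    case T
    show ?case using Fspace_matT[OF assms(2,3), where s' = s'] unfolding eqT by blast
  next
    case (mult \<gamma> \<delta>)
    show ?case
    proof
      fix F assume "F \<in> Fspace m s s'"
      hence in_space: "slash (slash F \<gamma>) \<delta> \<in> Fspace m s s'" using mult by blast
      have det: "det \<gamma> = 1" "det \<delta> = 1" using mult by (simp_all add: SL2Z_def)
      have "slash (slash F \<gamma>) \<delta> p = slash F (\<gamma> ** \<delta>) p" if "p \<in> regX" for p
        by (rule slash_mult[OF det subsetD[OF regX_subset that], symmetric])
      from this in_space show "slash F (\<gamma> ** \<delta>) \<in> Fspace m s s'"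
        by (rule Fspace_cong_imp)
    qed
  qed
  with \<open>F \<in> Fspace m s s'\<close> show "slash F \<gamma> \<in> Fspace m s s'" by blast
qed

end
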